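(* Let $n\ge 2$, let $\lambda=(\lambda_1,\lambda_2,\ldots)\vdash n$ be a partition of $n$, and let $r$ be an integer with $1\le r\le n-\lambda_2$. Let $b_{\lambda,r}$ denote the multiplicity of the irreducible representation $S^{\lambda}$ in the decomposition of $(S^{(n-1,1)})^{\otimes r}$ into irreducible representations of $S_n$. Then $$b_{\lambda,r}=f^{\bar\lambda}\sum_{s=|\bar\lambda|}^{r}(-1)^{r-s}\binom{r}{s}\left(\sum_{i=|\bar\lambda|}^{s}\binom{i}{|\bar\lambda|}\genfrac\{\}{0pt}{}{s}{i}\right),$$ where $\bar\lambda=(\lambda_2,\lambda_3,\ldots)$ has weight $|\bar\lambda|=\lambda_2+\lambda_3+\cdots$, $f^{\bar\lambda}$ is the number of standard Young tableaux of shape $\bar\lambda$, and $\genfrac\{\}{0pt}{}{s}{i}$ is the Stirling number of the second kind.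
   Context: Representations are finite-dimensional complex representations. The irreducible representations of the symmetric group $S_n$ are indexed by the partitions $\lambda=(\lambda_1\ge\lambda_2\ge\cdots)$ of $n$; $S^{\lambda}$ denotes the Specht module attached to $\lambda$, in the standard convention in which $S^{(n)}$ is the trivial representation. $S^{(n-1,1)}$ is the $(n-1)$-dimensional standard representation of $S_n$, i.e. the complement of the trivial representation in the $n$-dimensional permutation representation; its character at $\sigma$ is the number of fixed points of $\sigma$ minus one. $(S^{(n-1,1)})^{\otimes r}$ is its $r$-th tensor power with the diagonal action of $S_n$. Parts beyond the length of $\lambda$ are $0$; in particular $\lambda_2=0$ and $\bar\lambda=\emptyset$ when $\lambda=(n)$, and $f^{\emptyset}=1$. The Stirling number of the second kind $\genfrac\{\}{0pt}{}{s}{i}$ is the number of partitions of an $s$-element set into $i$ nonempty blocks, with $\genfrac\{\}{0pt}{}{0}{0}=1$ and $\genfrac\{\}{0pt}{}{s}{0}=0$ for $s\ge1$. A sum whose lower limit exceeds its upper limit is $0$. *)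

theory Defs
  imports
    Complex_Main
    "HOL-Library.Function_Algebras"
    "HOL-Library.FuncSet"
    "HOL-Library.More_List"
    "HOL-Combinatorics.Stirling"
    "HOL-Algebra.Sym_Groups"
begin

section \<open>Finite-dimensional complex representations\<close>

text \<open>
  The ambient complex vector spaces are the function spaces \<open>'x \<Rightarrow> complex\<close> with pointwise
  operations; a representation lives on a finite-dimensional subspace. Every
  finite-dimensional complex representation is isomorphic to one of this form.
\<close>

definition cscale :: "complex \<Rightarrow> ('x \<Rightarrow> complex) \<Rightarrow> 'x \<Rightarrow> complex" where
  "cscale c f = (\<lambda>x. c * f x)"

interpretation cfun: vector_space "cscale :: complex \<Rightarrow> ('x \<Rightarrow> complex) \<Rightarrow> 'x \<Rightarrow> complex"
  by unfold_locales (auto simp: cscale_def fun_eq_iff algebra_simps)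

definition linear_map_on ::
    "('x \<Rightarrow> complex) set \<Rightarrow> (('x \<Rightarrow> complex) \<Rightarrow> ('y \<Rightarrow> complex)) \<Rightarrow> bool" where
  "linear_map_on V T \<longleftrightarrow>
     (\<forall>v\<in>V. \<forall>w\<in>V. T (v + w) = T v + T w) \<and>
     (\<forall>c. \<forall>v\<in>V. T (cscale c v) = cscale c (T v))"

definition group_rep ::
    "('g, 'm) monoid_scheme \<Rightarrow> ('g \<Rightarrow> ('x \<Rightarrow> complex) \<Rightarrow> ('x \<Rightarrow> complex)) \<Rightarrow> ('x \<Rightarrow> complex) set \<Rightarrow> bool"
  where
  "group_rep G \<rho> V \<longleftrightarrow>
     cfun.subspace V \<and> (\<exists>B. finite B \<and> cfun.span B = V) \<and>
     (\<forall>g\<in>carrier G. linear_map_on V (\<rho> g) \<and> \<rho> g ` V \<subseteq> V) \<and>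
     (\<forall>v\<in>V. \<rho> \<one>\<^bsub>G\<^esub> v = v) \<and>
     (\<forall>g\<in>carrier G. \<forall>h\<in>carrier G. \<forall>v\<in>V. \<rho> (g \<otimes>\<^bsub>G\<^esub> h) v = \<rho> g (\<rho> h v))"

definition irreducible_rep ::
    "('g, 'm) monoid_scheme \<Rightarrow> ('g \<Rightarrow> ('x \<Rightarrow> complex) \<Rightarrow> ('x \<Rightarrow> complex)) \<Rightarrow> ('x \<Rightarrow> complex) set \<Rightarrow> bool"
  where
  "irreducible_rep G \<rho> V \<longleftrightarrow>
     group_rep G \<rho> V \<and> V \<noteq> {0} \<and>
     (\<forall>W. W \<subseteq> V \<and> cfun.subspace W \<and> (\<forall>g\<in>carrier G. \<rho> g ` W \<subseteq> W) \<longrightarrow> W = {0} \<or> W = V)"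

definition isomorphic_reps ::
    "('g, 'm) monoid_scheme \<Rightarrow>
     ('g \<Rightarrow> ('x \<Rightarrow> complex) \<Rightarrow> ('x \<Rightarrow> complex)) \<Rightarrow> ('x \<Rightarrow> complex) set \<Rightarrow>
     ('g \<Rightarrow> ('y \<Rightarrow> complex) \<Rightarrow> ('y \<Rightarrow> complex)) \<Rightarrow> ('y \<Rightarrow> complex) set \<Rightarrow> bool"
  where
  "isomorphic_reps G \<rho> V \<sigma> W \<longleftrightarrow>
     (\<exists>T. linear_map_on V T \<and> bij_betw T V W \<and>
          (\<forall>g\<in>carrier G. \<forall>v\<in>V. T (\<rho> g v) = \<sigma> g (T v)))"

text \<open>\<open>V\<close> is the internal direct sum of the irreducible subrepresentations in \<open>\<W>\<close>.\<close>

definition irreducible_decomposition ::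
    "('g, 'm) monoid_scheme \<Rightarrow> ('g \<Rightarrow> ('x \<Rightarrow> complex) \<Rightarrow> ('x \<Rightarrow> complex)) \<Rightarrow> ('x \<Rightarrow> complex) set \<Rightarrow>
     ('x \<Rightarrow> complex) set set \<Rightarrow> bool"
  where
  "irreducible_decomposition G \<rho> V \<W> \<longleftrightarrow>
     finite \<W> \<and> (\<forall>W\<in>\<W>. W \<subseteq> V \<and> irreducible_rep G \<rho> W) \<and>
     (\<forall>v\<in>V. \<exists>!w. w \<in> (\<Pi>\<^sub>E W\<in>\<W>. W) \<and> v = (\<Sum>W\<in>\<W>. w W))"

text \<open>The multiplicity of the irreducible representation \<open>(\<sigma>, U)\<close> in \<open>(\<rho>, V)\<close>.\<close>

definition multiplicity_rep ::
    "('g, 'm) monoid_scheme \<Rightarrow>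
     ('g \<Rightarrow> ('y \<Rightarrow> complex) \<Rightarrow> ('y \<Rightarrow> complex)) \<Rightarrow> ('y \<Rightarrow> complex) set \<Rightarrow>
     ('g \<Rightarrow> ('x \<Rightarrow> complex) \<Rightarrow> ('x \<Rightarrow> complex)) \<Rightarrow> ('x \<Rightarrow> complex) set \<Rightarrow> nat"
  where
  "multiplicity_rep G \<sigma> U \<rho> V =
     (THE m. \<exists>\<W>. irreducible_decomposition G \<rho> V \<W> \<and>
                 m = card {W \<in> \<W>. isomorphic_reps G \<rho> W \<sigma> U})"


section \<open>Permutation actions on function spaces\<close>

text \<open>
  If \<open>\<phi>\<close> is a left action of permutations on \<open>'x\<close>, this is the induced left action
  \<open>(p \<cdot> f)(x) = f (p\<^sup>-\<^sup>1 \<cdot> x)\<close> on functions; it sends the indicator function of \<open>x\<close> to the one of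
  \<open>p \<cdot> x\<close>.
\<close>

definition fun_action ::
    "((nat \<Rightarrow> nat) \<Rightarrow> 'x \<Rightarrow> 'x) \<Rightarrow> (nat \<Rightarrow> nat) \<Rightarrow> ('x \<Rightarrow> complex) \<Rightarrow> ('x \<Rightarrow> complex)" where
  "fun_action \<phi> p f = (\<lambda>x. f (\<phi> (inv' p) x))"

abbreviation point_action :: "(nat \<Rightarrow> nat) \<Rightarrow> (nat \<Rightarrow> complex) \<Rightarrow> (nat \<Rightarrow> complex)" where
  "point_action \<equiv> fun_action (\<lambda>p. p)"

abbreviation tuple_action :: "(nat \<Rightarrow> nat) \<Rightarrow> (nat list \<Rightarrow> complex) \<Rightarrow> (nat list \<Rightarrow> complex)" where
  "tuple_action \<equiv> fun_action map"

abbreviation tabloid_action ::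
    "(nat \<Rightarrow> nat) \<Rightarrow> (nat set list \<Rightarrow> complex) \<Rightarrow> (nat set list \<Rightarrow> complex)" where
  "tabloid_action \<equiv> fun_action (\<lambda>p. map ((`) p))"


section \<open>The standard representation and tensor powers\<close>

text \<open>
  The complement of the constant functions in the permutation representation of \<open>S\<^sub>n\<close> on the
  functions \<open>{1..n} \<rightarrow> complex\<close> (extended by \<open>0\<close> to all of \<open>nat\<close>), under \<^const>\<open>point_action\<close>.
\<close>

definition standard_rep :: "nat \<Rightarrow> (nat \<Rightarrow> complex) set" where
  "standard_rep n = {f. (\<forall>x. x \<notin> {1..n} \<longrightarrow> f x = 0) \<and> (\<Sum>x\<in>{1..n}. f x) = 0}"

text \<open>
  The \<open>r\<close>-th tensor power of a space \<open>V\<close> of functions on \<open>X\<close> is realised inside the functions on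
  \<open>r\<close>-tuples over \<open>X\<close> as the span of the pure tensors
  \<open>(v\<^sub>1 \<otimes> \<dots> \<otimes> v\<^sub>r)(x\<^sub>1, \<dots>, x\<^sub>r) = v\<^sub>1 x\<^sub>1 \<cdot> \<dots> \<cdot> v\<^sub>r x\<^sub>r\<close>.
\<close>

definition pure_tensor :: "('x \<Rightarrow> complex) list \<Rightarrow> 'x list \<Rightarrow> complex" where
  "pure_tensor vs = (\<lambda>xs. if length xs = length vs then \<Prod>j<length vs. (vs ! j) (xs ! j) else 0)"

definition tensor_power :: "nat \<Rightarrow> ('x \<Rightarrow> complex) set \<Rightarrow> ('x list \<Rightarrow> complex) set" where
  "tensor_power r V = cfun.span {pure_tensor vs |vs. length vs = r \<and> set vs \<subseteq> V}"

text \<open>On tensor powers, \<^const>\<open>tuple_action\<close> is the diagonal action.\<close>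

lemma tuple_action_pure_tensor:
  "tuple_action p (pure_tensor vs) = pure_tensor (map (point_action p) vs)"
  by (auto simp: fun_action_def pure_tensor_def fun_eq_iff intro!: prod.cong)


section \<open>Partitions, tableaux and Specht modules\<close>

definition is_partition :: "nat list \<Rightarrow> nat \<Rightarrow> bool" where
  "is_partition lam n \<longleftrightarrow> sorted_wrt (\<ge>) lam \<and> 0 \<notin> set lam \<and> sum_list lam = n"

text \<open>Parts are numbered from 1; parts beyond the length are 0.\<close>

definition part :: "nat list \<Rightarrow> nat \<Rightarrow> nat" where
  "part lam i = nth_default 0 lam (i - 1)"

text \<open>Cells are pairs (row, column), counted from 0.\<close>

definition diagram :: "nat list \<Rightarrow> (nat \<times> nat) set" where
  "diagram lam = {(i, j). i < length lam \<and> j < lam ! i}"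

definition standard_tableaux :: "nat list \<Rightarrow> (nat \<times> nat \<Rightarrow> nat) set" where
  "standard_tableaux lam =
     {t \<in> extensional (diagram lam).
        bij_betw t (diagram lam) {1..sum_list lam} \<and>
        (\<forall>i j j'. (i, j) \<in> diagram lam \<and> (i, j') \<in> diagram lam \<and> j < j' \<longrightarrow> t (i, j) < t (i, j')) \<and>
        (\<forall>i i' j. (i, j) \<in> diagram lam \<and> (i', j) \<in> diagram lam \<and> i < i' \<longrightarrow> t (i, j) < t (i', j))}"

definition num_SYT :: "nat list \<Rightarrow> nat" where
  "num_SYT lam = card (standard_tableaux lam)"

definition is_tableau :: "nat list \<Rightarrow> (nat \<times> nat \<Rightarrow> nat) \<Rightarrow> bool" where
  "is_tableau lam t \<longleftrightarrow> bij_betw t (diagram lam) {1..sum_list lam}"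

text \<open>The tabloid of a tableau (its class up to row equivalence) is the list of its row sets.\<close>

definition tabloid :: "nat list \<Rightarrow> (nat \<times> nat \<Rightarrow> nat) \<Rightarrow> nat set list" where
  "tabloid lam t = map (\<lambda>i. {t (i, j) |j. j < lam ! i}) [0..<length lam]"

definition column_stabilizer :: "nat list \<Rightarrow> (nat \<times> nat \<Rightarrow> nat) \<Rightarrow> (nat \<Rightarrow> nat) set" where
  "column_stabilizer lam t =
     {p. p permutes {1..sum_list lam} \<and>
         (\<forall>j. p ` {t (i, j) |i. (i, j) \<in> diagram lam} = {t (i, j) |i. (i, j) \<in> diagram lam})}"

text \<open>
  A formal linear combination of tabloids is the function giving its coefficients, so this is
  the sum of \<open>sign p\<close> times the tabloid of \<open>p \<cdot> t\<close> over the column stabilizer of \<open>t\<close>.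
\<close>

definition polytabloid :: "nat list \<Rightarrow> (nat \<times> nat \<Rightarrow> nat) \<Rightarrow> nat set list \<Rightarrow> complex" where
  "polytabloid lam t =
     (\<lambda>T. \<Sum>p\<in>column_stabilizer lam t. if T = tabloid lam (p \<circ> t) then of_int (sign p) else 0)"

definition specht :: "nat list \<Rightarrow> (nat set list \<Rightarrow> complex) set" where
  "specht lam = cfun.span {polytabloid lam t |t. is_tableau lam t}"

lemma num_SYT_empty: "num_SYT [] = 1"
proof -
  have "diagram [] = {}" by (simp add: diagram_def)
  then have "standard_tableaux [] = {\<lambda>_. undefined}"
    by (simp add: standard_tableaux_def bij_betw_def)
  then show ?thesis by (simp add: num_SYT_def)
qed


section \<open>The spaces above are representations of the symmetric group\<close>

lemma finite_dim_supported:
  assumes "finite X" and V: "cfun.subspace V" and sup: "\<And>f x. f \<in> V \<Longrightarrow> x \<notin> X \<Longrightarrow> f x = 0"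
  shows "\<exists>B. finite B \<and> cfun.span B = V"
proof -
  let ?d = "\<lambda>a. (\<lambda>x. if x = a then 1 else 0) :: 'a \<Rightarrow> complex"
  have V_sub: "V \<subseteq> cfun.span (?d ` X)"
  proof
    fix f assume f: "f \<in> V"
    have sum_app: "(\<Sum>a\<in>X. cscale (f a) (?d a)) y = (\<Sum>a\<in>X. cscale (f a) (?d a) y)" for y
      using \<open>finite X\<close> by (induction X rule: finite_induct) auto
    have "f = (\<Sum>a\<in>X. cscale (f a) (?d a))"
    proof
      fix y
      have "(\<Sum>a\<in>X. cscale (f a) (?d a) y) = (\<Sum>a\<in>X. if y = a then f a else 0)"
        by (rule sum.cong) (auto simp: cscale_def)
      also have "\<dots> = f y" using \<open>finite X\<close> sup[OF f] by (simp add: sum.delta)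
      finally show "f y = (\<Sum>a\<in>X. cscale (f a) (?d a)) y" by (simp add: sum_app)
    qed
    also have "\<dots> \<in> cfun.span (?d ` X)"
      by (intro cfun.span_sum cfun.span_scale cfun.span_base) auto
    finally show "f \<in> cfun.span (?d ` X)" .
  qed
  obtain B where B: "B \<subseteq> V" "\<not> cfun.dependent B" "V \<subseteq> cfun.span B"
    using cfun.basis_exists[of V] by metis
  have "finite B"
    using cfun.independent_span_bound[of "?d ` X" B] B V_sub \<open>finite X\<close> by auto
  moreover have "cfun.span B = V"
    using B V cfun.span_minimal by blast
  ultimately show ?thesis by blast
qed

lemma group_rep_fun_action:
  assumes "finite X" "cfun.subspace V" "\<And>f x. f \<in> V \<Longrightarrow> x \<notin> X \<Longrightarrow> f x = 0"
    and inv: "\<And>p f. p permutes {1..n} \<Longrightarrow> f \<in> V \<Longrightarrow> fun_action \<phi> p f \<in> V"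
    and id: "\<And>x. \<phi> id x = x" and comp: "\<And>p q x. \<phi> (p \<circ> q) x = \<phi> p (\<phi> q x)"
  shows "group_rep (sym_group n) (fun_action \<phi>) V"
proof -
  have fd: "\<exists>B. finite B \<and> cfun.span B = V"
    by (rule finite_dim_supported[of X]) (use assms(1-3) in auto)
  have "fun_action \<phi> (p \<circ> q) f = fun_action \<phi> p (fun_action \<phi> q f)"
    if "p permutes {1..n}" "q permutes {1..n}" for p q f
    using that comp by (simp add: fun_action_def o_inv_distrib permutes_bij)
  moreover have "fun_action \<phi> id f = f" for f using id by (simp add: fun_action_def)
  moreover have "linear_map_on V (fun_action \<phi> p)" for p
    by (auto simp: linear_map_on_def fun_action_def cscale_def fun_eq_iff)
  ultimately show ?thesis
    using assms(2) inv fd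
    by (auto simp: group_rep_def sym_group_def)
qed

lemma fun_action_span:
  assumes "\<And>f. f \<in> S \<Longrightarrow> fun_action \<phi> p f \<in> S" and "g \<in> cfun.span S"
  shows "fun_action \<phi> p g \<in> cfun.span S"
  using assms(2)
proof (induction rule: cfun.span_induct_alt)
  case base
  have "fun_action \<phi> p 0 = 0" by (simp add: fun_action_def fun_eq_iff)
  then show ?case by (simp only: cfun.span_zero)
next
  case (step c x y)
  have "fun_action \<phi> p (cscale c x + y) = cscale c (fun_action \<phi> p x) + fun_action \<phi> p y"
    by (simp add: fun_action_def cscale_def fun_eq_iff)
  moreover have "cscale c (fun_action \<phi> p x) + fun_action \<phi> p y \<in> cfun.span S"
    using step assms(1) by (metis cfun.span_add cfun.span_scale cfun.span_base)
  ultimately show ?case by metis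
qed

lemma span_supported:
  assumes "\<And>f x. f \<in> S \<Longrightarrow> x \<notin> X \<Longrightarrow> f x = 0" and "g \<in> cfun.span S" and "x \<notin> X"
  shows "(g x :: complex) = 0"
  using assms(2)
  by (induction rule: cfun.span_induct_alt) (use assms(1,3) in \<open>auto simp: cscale_def\<close>)

lemma standard_rep_invariant:
  assumes p: "p permutes {1..n}" and f: "f \<in> standard_rep n"
  shows "point_action p f \<in> standard_rep n"
proof -
  have q: "inv' p permutes {1..n}" using p by (rule permutes_inv)
  have "(\<Sum>x\<in>{1..n}. f (inv' p x)) = (\<Sum>x\<in>{1..n}. f x)"
    using sum.permute[OF q, of f] by (simp add: o_def)
  then show ?thesis using f permutes_not_in[OF q]
    by (auto simp: standard_rep_def fun_action_def)
qed

lemma group_rep_standard: "group_rep (sym_group n) point_action (standard_rep n)"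
proof (rule group_rep_fun_action[where X = "{1..n}"])
  show "cfun.subspace (standard_rep n)"
    by (auto simp: cfun.subspace_def standard_rep_def cscale_def sum.distrib simp flip: sum_distrib_left)
qed (use standard_rep_invariant in \<open>auto simp: standard_rep_def\<close>)

lemma group_rep_tensor_power:
  "group_rep (sym_group n) tuple_action (tensor_power r (standard_rep n))"
proof (rule group_rep_fun_action[where X = "{xs. set xs \<subseteq> {1..n} \<and> length xs = r}"])
  show "finite {xs. set xs \<subseteq> {1..n} \<and> length xs = r}" by (rule finite_lists_length_eq) simp
  show "cfun.subspace (tensor_power r (standard_rep n))" by (simp add: tensor_power_def)
next
  fix f xs assume "f \<in> tensor_power r (standard_rep n)" "xs \<notin> {xs. set xs \<subseteq> {1..n} \<and> length xs = r}"
  then show "f xs = 0" unfolding tensor_power_def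
  proof (rule span_supported[rotated])
    fix f xs assume f: "f \<in> {pure_tensor vs |vs. length vs = r \<and> set vs \<subseteq> standard_rep n}"
      and xs: "xs \<notin> {xs. set xs \<subseteq> {1..n} \<and> length xs = r}"
    then obtain vs where vs: "f = pure_tensor vs" "length vs = r" "set vs \<subseteq> standard_rep n" by auto
    show "f xs = 0"
    proof (cases "length xs = r")
      case True
      with xs obtain j where j: "j < r" "xs ! j \<notin> {1..n}" by (auto simp: set_conv_nth subset_iff)
      then have "vs ! j \<in> standard_rep n" using vs by (auto intro: nth_mem)
      then have "(vs ! j) (xs ! j) = 0" using j by (auto simp: standard_rep_def)
      then show ?thesis using vs j True by (auto simp: pure_tensor_def)
    qed (use vs in \<open>auto simp: pure_tensor_def\<close>)
  qed
next
  fix p f assume p: "p permutes {1..n}" and f: "f \<in> tensor_power r (standard_rep n)"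
  show "tuple_action p f \<in> tensor_power r (standard_rep n)"
    using f unfolding tensor_power_def
  proof (rule fun_action_span[rotated])
    fix f assume "f \<in> {pure_tensor vs |vs. length vs = r \<and> set vs \<subseteq> standard_rep n}"
    then obtain vs where vs: "f = pure_tensor vs" "length vs = r" "set vs \<subseteq> standard_rep n" by auto
    then have "tuple_action p f = pure_tensor (map (point_action p) vs)"
      by (simp add: tuple_action_pure_tensor)
    moreover have "set (map (point_action p) vs) \<subseteq> standard_rep n"
      using vs standard_rep_invariant[OF p] by auto
    ultimately show "tuple_action p f \<in> {pure_tensor vs |vs. length vs = r \<and> set vs \<subseteq> standard_rep n}"
      using vs by (metis (mono_tags, lifting) length_map mem_Collect_eq)
  qed
qed auto

lemma tabloid_comp: "tabloid lam (p \<circ> t) = map ((`) p) (tabloid lam t)"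
  by (auto simp: tabloid_def)

lemma action_polytabloid:
  assumes q: "q permutes {1..sum_list lam}"
  shows "tabloid_action q (polytabloid lam t) = polytabloid lam (q \<circ> t)"
proof
  fix T :: "nat set list"
  let ?c = "\<lambda>p. q \<circ> p \<circ> inv' q"
  let ?d = "\<lambda>p. inv' q \<circ> p \<circ> q"
  have [simp]: "inv' q (q x) = x" "q (inv' q x) = x" for x
    using q by (simp_all add: permutes_inverses)
  have iq: "inv' q permutes {1..sum_list lam}" using q by (rule permutes_inv)
  have im1: "{(q \<circ> t) (i, j) |i. (i, j) \<in> diagram lam} = q ` {t (i, j) |i. (i, j) \<in> diagram lam}" for j
    by auto
  have im2: "inv' q ` q ` A = A" "q ` inv' q ` A = A" for A by (auto simp: image_iff)
  have cc: "?c p ` q ` A = q ` p ` A" and dd: "?d p ` A = inv' q ` p ` q ` A" for p A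
    by (simp_all only: image_comp[symmetric] im2)
  have sg: "sign (?c p) = sign p" if "p permutes {1..sum_list lam}" for p
  proof -
    have "permutation p" "permutation q" "permutation (inv' q)"
      using that q iq by (auto simp: permutation_permutes)
    then show ?thesis
      by (simp add: sign_compose permutation_compose sign_inverse sign_idempotent mult.commute mult.left_commute)
  qed
  have Teq: "map ((`) (inv' q)) T = tabloid lam (p \<circ> t) \<longleftrightarrow> T = tabloid lam (?c p \<circ> (q \<circ> t))" for p
  proof -
    have "tabloid lam (?c p \<circ> (q \<circ> t)) = map ((`) q) (tabloid lam (p \<circ> t))"
      by (subst tabloid_comp[symmetric]) (auto simp: o_def)
    moreover have "map ((`) (inv' q)) (map ((`) q) U) = U" "map ((`) q) (map ((`) (inv' q)) U) = U" for U
      by (simp_all add: o_def im2)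
    ultimately show ?thesis by metis
  qed
  show "tabloid_action q (polytabloid lam t) T = polytabloid lam (q \<circ> t) T"
    unfolding fun_action_def polytabloid_def
  proof (rule sum.reindex_bij_witness[where i = ?d and j = ?c])
    fix p assume p: "p \<in> column_stabilizer lam t"
    then have pp: "p permutes {1..sum_list lam}" by (simp add: column_stabilizer_def)
    show "?d (?c p) = p" by (auto simp: o_def)
    have "?c p permutes {1..sum_list lam}" using pp q iq by (auto intro: permutes_compose)
    then show "?c p \<in> column_stabilizer lam (q \<circ> t)"
      using p unfolding column_stabilizer_def im1 by (simp add: cc[unfolded o_def])
    show "(if T = tabloid lam (?c p \<circ> (q \<circ> t)) then of_int (sign (?c p)) else 0) =
          (if map ((`) (inv' q)) T = tabloid lam (p \<circ> t) then complex_of_int (sign p) else 0)"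
      using Teq[of p] sg[OF pp] by simp
  next
    fix p assume p: "p \<in> column_stabilizer lam (q \<circ> t)"
    then have pp: "p permutes {1..sum_list lam}" by (simp add: column_stabilizer_def)
    show "?c (?d p) = p" by (auto simp: o_def)
    have "?d p permutes {1..sum_list lam}" using pp q iq by (auto intro: permutes_compose)
    moreover have "?d p ` {t (i, j) |i. (i, j) \<in> diagram lam} = {t (i, j) |i. (i, j) \<in> diagram lam}" for j
      using p unfolding dd column_stabilizer_def im1 mem_Collect_eq by (metis im2(1))
    ultimately show "?d p \<in> column_stabilizer lam t"
      unfolding column_stabilizer_def mem_Collect_eq by blast
  qed
qed

lemma group_rep_specht:
  assumes "is_partition lam n"
  shows "group_rep (sym_group n) tabloid_action (specht lam)"
proof (rule group_rep_fun_action[where X = "{T. set T \<subseteq> Pow {1..n} \<and> length T = length lam}"])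
  have n: "sum_list lam = n" using assms by (simp add: is_partition_def)
  show "finite {T :: nat set list. set T \<subseteq> Pow {1..n} \<and> length T = length lam}" by (rule finite_lists_length_eq) simp
  show "cfun.subspace (specht lam)" by (simp add: specht_def)
  have bij: "is_tableau lam (p \<circ> t)" if "p permutes {1..n}" "is_tableau lam t" for p t
    using that n unfolding is_tableau_def by (metis bij_betw_trans permutes_imp_bij)
  have tab: "tabloid lam t \<in> {T. set T \<subseteq> Pow {1..n} \<and> length T = length lam}" if "is_tableau lam t" for t
    using bij_betwE[OF that[unfolded is_tableau_def]] n
    by (fastforce simp: tabloid_def diagram_def)
  fix f T assume "f \<in> specht lam" "T \<notin> {T. set T \<subseteq> Pow {1..n} \<and> length T = length lam}"
  then show "f T = 0" unfolding specht_def
  proof (rule span_supported[rotated])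
    fix f T assume f: "f \<in> {polytabloid lam t |t. is_tableau lam t}"
      and T: "T \<notin> {T. set T \<subseteq> Pow {1..n} \<and> length T = length lam}"
    then obtain t where t: "f = polytabloid lam t" "is_tableau lam t" by auto
    have "T \<noteq> tabloid lam (p \<circ> t)" if "p \<in> column_stabilizer lam t" for p
      using tab[OF bij[OF _ t(2), of p]] that T n by (auto simp: column_stabilizer_def)
    then show "f T = 0" unfolding t polytabloid_def by (auto intro!: sum.neutral)
  qed
next
  fix p f assume p: "p permutes {1..n}" and f: "f \<in> specht lam"
  have n: "sum_list lam = n" using assms by (simp add: is_partition_def)
  have bij: "is_tableau lam (p \<circ> t)" if "is_tableau lam t" for t
    using that n p unfolding is_tableau_def by (metis bij_betw_trans permutes_imp_bij)
  show "tabloid_action p f \<in> specht lam"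
    using f unfolding specht_def
    by (rule fun_action_span[rotated]) (use action_polytabloid p n bij in blast)
qed (auto simp: image_comp)

end

theory Submission
  imports Defs
begin

text \<open>
  The multiplicity of an irreducible module with scalar endomorphisms in \<open>V\<close> is the inner product
  of the two characters. The character of the tensor power at \<open>g\<close> is \<open>(fix g - 1) ^ r\<close>, which
  expands into the powers \<open>(fix g) ^ s\<close> and these, via Stirling numbers, into the numbers of injective
  \<open>i\<close>-tuples fixed by \<open>g\<close>. Averaging the latter against the character of \<open>S\<^sup>\<lambda>\<close> gives the
  dimension of the space of vectors of \<open>S\<^sup>\<lambda>\<close> fixed by the symmetric group on \<open>m = n - i\<close> letters,
  so it remains to see that this dimension is the number \<open>K m \<lambda>\<close> of standard tableaux of shape
  \<open>\<lambda>\<close> with \<open>1, \<dots>, m\<close> in the first row. For \<open>m \<ge> \<lambda>\<^sub>2\<close> that number is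
  \<open>(i choose \<bar>\<lambda>'\<bar>) f \<lambda>'\<close> with \<open>\<lambda>'\<close> the partition without its first row.

  Symmetrizing the corresponding polytabloids gives linearly independent fixed vectors, hence
  \<open>dim \<ge> K m \<lambda>\<close>. Instead of Garnir relations or branching rules, a global count gives equality:
  decomposing the permutation module on injective \<open>(n - m)\<close>-tuples yields
  \<open>\<Sum>\<^sub>\<lambda> dim Fix\<^sub>m(S\<^sup>\<lambda>) dim S\<^sup>\<lambda> \<le> n! / m!\<close>, while \<open>\<Sum>\<^sub>\<lambda> K m \<lambda> f \<lambda> = n! / m!\<close> by counting paths in
  Young's lattice.
\<close>

section \<open>Traces of linear operators on function spaces\<close>

text \<open>Nothing identifies the irreducible summands of a given module as Specht modules. Schur's
  lemma is therefore split: its vanishing half is proved for all irreducibles, its scalar half only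
  for Specht modules, where the column antisymmetrizer provides it. For the same reason the count
  over injective tuples yields only an inequality, as summands of other types are dropped; this
  suffices because it points against the bound from symmetrized polytabloids.

  The dimension of a Specht module is not known beforehand either. It is the case
  \<open>m = 0\<close> of the quantity to be determined, so in each term of the count both factors
  are bounded below by tableau numbers, and equal totals force equality in both since these numbers
  are positive.

  The hypothesis on \<open>r\<close> enters through \<open>m \<ge> part lam 2\<close>: the entries
  \<open>1, ..., m\<close> then fill every first-row cell that has a cell below it, so the remaining
  entries are divided between the first row and the lower rows without further constraint. This is
  the origin of the binomial coefficient \<open>i choose k\<close>.\<close>

definition supported :: "'x set \<Rightarrow> ('x \<Rightarrow> complex) set" where
  "supported X = {f. \<forall>x. x \<notin> X \<longrightarrow> f x = 0}"

definition unit_fun :: "'x \<Rightarrow> 'x \<Rightarrow> complex" where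
  "unit_fun a = (\<lambda>x. if x = a then 1 else 0)"

abbreviation lin :: "(('x \<Rightarrow> complex) \<Rightarrow> ('y \<Rightarrow> complex)) \<Rightarrow> bool" where
  "lin \<equiv> linear_map_on UNIV"

text \<open>For an operator \<open>F\<close> that is linear only on a subspace \<open>V\<close>, the
  trace is taken of \<open>F \<circ> P\<close> with \<open>P\<close> a projection onto
  \<open>V\<close>. This avoids matrices relative to bases of subspaces.\<close>

definition trace_on :: "'x set \<Rightarrow> (('x \<Rightarrow> complex) \<Rightarrow> ('x \<Rightarrow> complex)) \<Rightarrow> complex" where
  "trace_on X F = (\<Sum>x\<in>X. F (unit_fun x) x)"

lemma sum_fun_apply: "(\<Sum>a\<in>A. g a) y = (\<Sum>a\<in>A. g a y :: complex)"
  by (induction A rule: infinite_finite_induct) auto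

lemma linear_map_onD:
  assumes "linear_map_on V T"
  shows "v \<in> V \<Longrightarrow> w \<in> V \<Longrightarrow> T (v + w) = T v + T w"
    and "v \<in> V \<Longrightarrow> T (cscale c v) = cscale c (T v)"
  using assms by (auto simp: linear_map_on_def)

lemma linear_map_on_0:
  assumes "linear_map_on V T" "cfun.subspace V"
  shows "T 0 = 0"
  using linear_map_onD(2)[OF assms(1), of 0 0] cfun.subspace_0[OF assms(2)] by simp

lemma linear_map_on_sum:
  assumes T: "linear_map_on V T" and V: "cfun.subspace V" and "\<And>i. i \<in> I \<Longrightarrow> f i \<in> V"
  shows "T (\<Sum>i\<in>I. f i) = (\<Sum>i\<in>I. T (f i))"
  using assms(3)
proof (induction I rule: infinite_finite_induct)
  case (insert i I)
  then have "(\<Sum>i\<in>I. f i) \<in> V" by (intro cfun.subspace_sum[OF V]) auto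
  then have "T (f i + (\<Sum>i\<in>I. f i)) = T (f i) + T (\<Sum>i\<in>I. f i)"
    using insert.prems by (intro linear_map_onD(1)[OF T]) auto
  moreover have "T (\<Sum>i\<in>I. f i) = (\<Sum>i\<in>I. T (f i))" using insert by blast
  ultimately show ?case unfolding sum.insert[OF insert.hyps] by (rule trans[OF _ arg_cong2[of _ _ _ _ "(+)"], OF _ refl])
qed (auto simp: linear_map_on_0[OF T V])

lemma linear_map_on_diff:
  assumes T: "linear_map_on V T" and V: "cfun.subspace V" and "v \<in> V" "w \<in> V"
  shows "T (v - w) = T v - T w"
proof -
  have "T ((v - w) + w) = T (v - w) + T w"
    using assms by (intro linear_map_onD(1)[OF T]) (auto intro: cfun.subspace_diff)
  then show ?thesis by simp
qed

lemma lin_sum: "lin F \<Longrightarrow> F (\<Sum>i\<in>I. f i) = (\<Sum>i\<in>I. F (f i))"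
  by (rule linear_map_on_sum) auto

lemma linear_map_on_compose:
  "linear_map_on V T \<Longrightarrow> T ` V \<subseteq> W \<Longrightarrow> linear_map_on W S \<Longrightarrow> linear_map_on V (S \<circ> T)"
  by (auto simp: linear_map_on_def image_subset_iff)

lemma linear_map_on_sum_ops:
  assumes "\<And>i. i \<in> I \<Longrightarrow> linear_map_on V (F i)"
  shows "linear_map_on V (\<lambda>f. \<Sum>i\<in>I. F i f)"
  using assms
  by (auto simp: linear_map_on_def sum.distrib cfun.scale_sum_right intro!: sum.cong)

lemma subspace_supported: "cfun.subspace (supported X)"
  by (auto simp: cfun.subspace_def supported_def cscale_def)

lemma supported_expand:
  assumes "finite X" "f \<in> supported X"
  shows "f = (\<Sum>x\<in>X. cscale (f x) (unit_fun x))"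
proof
  fix y
  have "(\<Sum>x\<in>X. cscale (f x) (unit_fun x)) y = (\<Sum>x\<in>X. if y = x then f x else 0)"
    unfolding sum_fun_apply by (intro sum.cong) (auto simp: cscale_def unit_fun_def)
  also have "\<dots> = f y" using assms by (auto simp: supported_def)
  finally show "f y = (\<Sum>x\<in>X. cscale (f x) (unit_fun x)) y" by simp
qed

lemma lin_expand:
  assumes "finite X" "f \<in> supported X" "lin F"
  shows "F f y = (\<Sum>x\<in>X. f x * F (unit_fun x) y)"
proof -
  have "F f = (\<Sum>x\<in>X. cscale (f x) (F (unit_fun x)))"
    by (subst supported_expand[OF assms(1,2)])
      (simp add: lin_sum[OF assms(3)] linear_map_onD(2)[OF assms(3)])
  then show ?thesis by (simp add: sum_fun_apply cscale_def)
qed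

text \<open>Both sides are the sum of the products of matrix entries of \<open>A\<close> and
  \<open>B\<close>, taken in the two orders. The two index sets may differ, so the rule also serves
  for maps between different spaces.\<close>

lemma trace_on_commute:
  assumes "finite X" "finite Y" "lin A" "lin B"
    and "\<And>x. x \<in> X \<Longrightarrow> B (unit_fun x) \<in> supported Y"
    and "\<And>y. y \<in> Y \<Longrightarrow> A (unit_fun y) \<in> supported X"
  shows "trace_on X (A \<circ> B) = trace_on Y (B \<circ> A)"
proof -
  have "trace_on X (A \<circ> B) = (\<Sum>x\<in>X. \<Sum>y\<in>Y. B (unit_fun x) y * A (unit_fun y) x)"
    unfolding trace_on_def o_def
    by (intro sum.cong refl lin_expand) (use assms in auto)
  also have "\<dots> = (\<Sum>y\<in>Y. \<Sum>x\<in>X. A (unit_fun y) x * B (unit_fun x) y)"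
    by (subst sum.swap) (simp add: mult.commute)
  also have "\<dots> = trace_on Y (B \<circ> A)"
    unfolding trace_on_def o_def
    by (intro sum.cong refl lin_expand[symmetric]) (use assms in auto)
  finally show ?thesis .
qed

lemma trace_on_sum: "trace_on X (\<lambda>f. \<Sum>i\<in>I. F i f) = (\<Sum>i\<in>I. trace_on X (F i))"
  unfolding trace_on_def sum_fun_apply by (rule sum.swap)

section \<open>Projections onto subspaces and traces of restricted operators\<close>

definition is_projection :: "('x \<Rightarrow> complex) set \<Rightarrow> (('x \<Rightarrow> complex) \<Rightarrow> ('x \<Rightarrow> complex)) \<Rightarrow> bool" where
  "is_projection V P \<longleftrightarrow> lin P \<and> range P \<subseteq> V \<and> (\<forall>v\<in>V. P v = v)"

definition projection :: "('x \<Rightarrow> complex) set \<Rightarrow> ('x \<Rightarrow> complex) \<Rightarrow> ('x \<Rightarrow> complex)" where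
  "projection V = (SOME P. is_projection V P)"

lemma linear_iff_lin: "Vector_Spaces.linear cscale cscale F \<longleftrightarrow> lin F"
  by (auto simp: Vector_Spaces.linear_iff linear_map_on_def cfun.vector_space_axioms)

text \<open>A linear left inverse of the inclusion of \<open>V\<close> is a projection onto
  \<open>V\<close>.\<close>

lemma is_projection_projection:
  assumes "cfun.subspace V"
  shows "is_projection V (projection V)"
proof -
  interpret vp: vector_space_pair "cscale :: complex \<Rightarrow> ('a \<Rightarrow> complex) \<Rightarrow> _"
    "cscale :: complex \<Rightarrow> ('a \<Rightarrow> complex) \<Rightarrow> _" ..
  have "Vector_Spaces.linear cscale cscale (\<lambda>f :: 'a \<Rightarrow> complex. f)"
    by (simp add: linear_iff_lin linear_map_on_def)
  from vp.linear_exists_left_inverse_on[OF this assms]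
  obtain g where "range g \<subseteq> V" "lin g" "\<forall>v\<in>V. g v = v"
    by (auto simp: linear_iff_lin)
  then have "is_projection V g" by (auto simp: is_projection_def)
  then show ?thesis unfolding projection_def by (rule someI[of "is_projection V"])
qed

lemma is_projectionD:
  assumes "is_projection V P"
  shows "lin P" "P f \<in> V" "v \<in> V \<Longrightarrow> P v = v"
  using assms by (auto simp: is_projection_def)

lemma lin_compose_projection:
  assumes "linear_map_on V T" "is_projection V P"
  shows "lin (T \<circ> P)"
  using assms by (intro linear_map_on_compose[of _ P V T]) (auto simp: is_projection_def)

text \<open>With \<open>S\<close> the inverse of \<open>T\<close>, put
  \<open>A = F \<circ> S \<circ> Q\<close> and \<open>B = T \<circ> P\<close>. The two operators are
  then \<open>A \<circ> B\<close> and \<open>B \<circ> A\<close>.\<close>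

lemma trace_on_transport:
  assumes "finite X" "finite Y" "W \<subseteq> supported X" "U \<subseteq> supported Y"
    and W: "cfun.subspace W" and U: "cfun.subspace U"
    and P: "is_projection W P" and Q: "is_projection U Q"
    and T: "linear_map_on W T" "bij_betw T W U"
    and F: "linear_map_on W F" "F ` W \<subseteq> W"
    and H: "linear_map_on U H"
    and TF: "\<And>w. w \<in> W \<Longrightarrow> T (F w) = H (T w)"
  shows "trace_on X (F \<circ> P) = trace_on Y (H \<circ> Q)"
proof -
  define S where "S = inv_into W T"
  have SU: "S u \<in> W" "T (S u) = u" if "u \<in> U" for u
    using that T(2) unfolding S_def
    by (auto simp: bij_betw_def inv_into_into f_inv_into_f)
  have ST: "S (T w) = w" if "w \<in> W" for w
    using that T(2) unfolding S_def by (simp add: bij_betw_inv_into_left)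
  have TW: "T w \<in> U" if "w \<in> W" for w using that T(2) by (auto dest: bij_betwE)
  have S: "linear_map_on U S"
    unfolding linear_map_on_def
  proof (intro conjI ballI allI)
    fix v w assume vw: "v \<in> U" "w \<in> U"
    have "S (v + w) = S (T (S v + S w))" using vw SU by (simp add: linear_map_onD(1)[OF T(1)])
    also have "\<dots> = S v + S w" using vw SU W by (intro ST) (auto intro: cfun.subspace_add)
    finally show "S (v + w) = S v + S w" .
  next
    fix c v assume v: "v \<in> U"
    have "S (cscale c v) = S (T (cscale c (S v)))" using v SU by (simp add: linear_map_onD(2)[OF T(1)])
    also have "\<dots> = cscale c (S v)" using v SU W by (intro ST) (auto intro: cfun.subspace_scale)
    finally show "S (cscale c v) = cscale c (S v)" .
  qed
  define A where "A = F \<circ> S \<circ> Q"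
  define B where "B = T \<circ> P"
  note Pd = is_projectionD[OF P] and Qd = is_projectionD[OF Q]
  have "lin B" unfolding B_def by (rule lin_compose_projection[OF T(1) P])
  moreover have "lin A" unfolding A_def
    by (intro lin_compose_projection[OF _ Q] linear_map_on_compose[OF S _ F(1)]) (use SU in auto)
  moreover have "B f \<in> supported Y" for f using Pd TW assms(4) by (auto simp: B_def)
  moreover have "A f \<in> supported X" for f using Qd(2) SU(1) F(2) assms(3) by (auto simp: A_def image_subset_iff subset_iff)
  ultimately have "trace_on X (A \<circ> B) = trace_on Y (B \<circ> A)"
    using assms(1,2) by (intro trace_on_commute)
  moreover have "A \<circ> B = F \<circ> P" using Pd(2) Qd(3) TW ST by (simp add: A_def B_def o_def)
  moreover have "B \<circ> A = H \<circ> Q"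
  proof
    fix f
    have "F (S (Q f)) \<in> W" using Qd SU F by auto
    then have "(B \<circ> A) f = T (F (S (Q f)))" using Pd by (simp add: A_def B_def)
    also have "\<dots> = H (T (S (Q f)))" using Qd SU by (intro TF) auto
    finally show "(B \<circ> A) f = (H \<circ> Q) f" using Qd SU by simp
  qed
  ultimately show ?thesis by simp
qed

text \<open>Transport along the identity map: the trace does not depend on the complement that a
  projection singles out.\<close>

lemma trace_on_projection_cong:
  assumes "finite X" "W \<subseteq> supported X" "cfun.subspace W" "is_projection W P" "is_projection W Q"
    and "linear_map_on W F" "F ` W \<subseteq> W"
  shows "trace_on X (F \<circ> P) = trace_on X (F \<circ> Q)"
  by (rule trace_on_transport[where T = "\<lambda>f. f"]) 
    (use assms in \<open>auto simp: linear_map_on_def bij_betw_def\<close>)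

lemma finite_basis_exists:
  assumes "finite X" "V \<subseteq> supported X" "cfun.subspace V"
  obtains B where "finite B" "B \<subseteq> V" "cfun.independent B" "cfun.span B = V" "card B = cfun.dim V"
proof -
  obtain B where B: "B \<subseteq> V" "cfun.independent B" "V \<subseteq> cfun.span B" "card B = cfun.dim V"
    using cfun.basis_exists[of V] by metis
  have "supported X \<subseteq> cfun.span (unit_fun ` X)"
  proof
    fix f :: "'a \<Rightarrow> complex" assume "f \<in> supported X"
    then have "f = (\<Sum>x\<in>X. cscale (f x) (unit_fun x))" by (rule supported_expand[OF assms(1)])
    also have "\<dots> \<in> cfun.span (unit_fun ` X)"
      by (intro cfun.span_sum cfun.span_scale cfun.span_base) auto
    finally show "f \<in> cfun.span (unit_fun ` X)" .
  qed
  then have "finite B"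
    using cfun.independent_span_bound[of "unit_fun ` X" B] B assms by auto
  moreover have "cfun.span B = V" using B assms cfun.span_minimal by blast
  ultimately show ?thesis using that B by blast
qed

text \<open>Coordinates in a basis \<open>B\<close> of \<open>V\<close> write \<open>P\<close> as a
  sum of rank-one operators, and the one belonging to \<open>b\<close> has trace
  \<open>\<phi> b b = 1\<close>.\<close>

lemma trace_on_projection:
  assumes "finite X" "V \<subseteq> supported X" "cfun.subspace V" "is_projection V P"
  shows "trace_on X P = of_nat (cfun.dim V)"
proof -
  obtain B where B: "finite B" "B \<subseteq> V" "cfun.independent B" "cfun.span B = V" "card B = cfun.dim V"
    using finite_basis_exists[OF assms(1-3)] .
  note Pd = is_projectionD[OF assms(4)]
  define \<phi> where "\<phi> b f = cfun.representation B (P f) b" for b f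
  have Pe: "P f y = (\<Sum>b\<in>B. \<phi> b f * b y)" for f y
  proof -
    have "P f = (\<Sum>b\<in>B. cscale (\<phi> b f) b)"
      unfolding \<phi>_def using cfun.sum_representation_eq[OF B(3) _ B(1) order_refl] Pd B by metis
    then show ?thesis by (simp add: sum_fun_apply cscale_def)
  qed
  have lin\<phi>: "\<phi> b f = (\<Sum>x\<in>X. f x * \<phi> b (unit_fun x))" if "f \<in> supported X" for b f
  proof -
    have "P f = (\<Sum>x\<in>X. cscale (f x) (P (unit_fun x)))"
      by (subst supported_expand[OF assms(1) that])
        (simp add: lin_sum[OF Pd(1)] linear_map_onD(2)[OF Pd(1)])
    then show ?thesis unfolding \<phi>_def
      using cfun.representation_sum[OF B(3), of X "\<lambda>x. cscale (f x) (P (unit_fun x))"]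
        cfun.representation_scale[OF B(3)] Pd(2) B(4) cfun.subspace_scale[OF assms(3)] by simp
  qed
  have "trace_on X P = (\<Sum>b\<in>B. \<Sum>x\<in>X. b x * \<phi> b (unit_fun x))"
    unfolding trace_on_def Pe by (subst sum.swap) (simp add: mult.commute)
  also have "\<dots> = (\<Sum>b\<in>B. \<phi> b b)"
    by (intro sum.cong refl lin\<phi>[symmetric]) (use B assms in auto)
  also have "\<dots> = (\<Sum>b\<in>B. 1)"
    unfolding \<phi>_def using Pd B cfun.representation_basis[OF B(3)] by (intro sum.cong refl) auto
  finally show ?thesis using B by simp
qed

section \<open>Characters and multiplicities\<close>

definition char_on ::
    "'x set \<Rightarrow> ('g \<Rightarrow> ('x \<Rightarrow> complex) \<Rightarrow> ('x \<Rightarrow> complex)) \<Rightarrow> ('x \<Rightarrow> complex) set \<Rightarrow> 'g \<Rightarrow> complex" where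
  "char_on X \<rho> V g = trace_on X (\<rho> g \<circ> projection V)"

lemma group_repD:
  assumes "group_rep G \<rho> V"
  shows "cfun.subspace V" "\<And>g. g \<in> carrier G \<Longrightarrow> linear_map_on V (\<rho> g)"
    "\<And>g. g \<in> carrier G \<Longrightarrow> \<rho> g ` V \<subseteq> V" "\<And>g v. g \<in> carrier G \<Longrightarrow> v \<in> V \<Longrightarrow> \<rho> g v \<in> V"
    "\<And>v. v \<in> V \<Longrightarrow> \<rho> \<one>\<^bsub>G\<^esub> v = v"
    "\<And>g h v. g \<in> carrier G \<Longrightarrow> h \<in> carrier G \<Longrightarrow> v \<in> V \<Longrightarrow> \<rho> (g \<otimes>\<^bsub>G\<^esub> h) v = \<rho> g (\<rho> h v)"
  using assms unfolding group_rep_def by blast+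

lemma group_rep_subspace:
  assumes V: "group_rep G \<rho> V" and "finite X" "V \<subseteq> supported X"
    and "cfun.subspace W" "W \<subseteq> V" "\<And>g. g \<in> carrier G \<Longrightarrow> \<rho> g ` W \<subseteq> W"
  shows "group_rep G \<rho> W"
proof -
  have "W \<subseteq> supported X" using assms by blast
  then obtain B where "finite B" "cfun.span B = W"
    using finite_basis_exists[OF assms(2) _ assms(4)] by metis
  moreover have "linear_map_on W (\<rho> g)" if "g \<in> carrier G" for g
    using group_repD(2)[OF V that] \<open>W \<subseteq> V\<close> unfolding linear_map_on_def by blast
  ultimately show ?thesis
    unfolding group_rep_def using assms(4-6) group_repD(5,6)[OF V] by blast
qed

lemma char_on_eq_trace:
  assumes "group_rep G \<rho> V" "finite X" "V \<subseteq> supported X" "is_projection V P" "g \<in> carrier G"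
  shows "char_on X \<rho> V g = trace_on X (\<rho> g \<circ> P)"
  unfolding char_on_def using assms group_repD[OF assms(1)]
  by (intro trace_on_projection_cong) (auto intro: is_projection_projection)

lemma char_on_isomorphic:
  assumes "group_rep G \<rho> V" "finite X" "V \<subseteq> supported X"
    and "group_rep G \<sigma> W" "finite Y" "W \<subseteq> supported Y"
    and "isomorphic_reps G \<rho> V \<sigma> W" "g \<in> carrier G"
  shows "char_on X \<rho> V g = char_on Y \<sigma> W g"
proof -
  obtain T where T: "linear_map_on V T" "bij_betw T V W"
    "\<And>v. v \<in> V \<Longrightarrow> T (\<rho> g v) = \<sigma> g (T v)"
    using assms(7,8) unfolding isomorphic_reps_def by blast
  show ?thesis unfolding char_on_def
    by (rule trace_on_transport[where T = T])
      (use assms T group_repD[OF assms(1)] group_repD[OF assms(4)] in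
        \<open>auto intro: is_projection_projection\<close>)
qed

lemma char_on_one:
  assumes "group_rep G \<rho> V" "finite X" "V \<subseteq> supported X"
  shows "char_on X \<rho> V \<one>\<^bsub>G\<^esub> = of_nat (cfun.dim V)"
proof -
  note V = group_repD[OF assms(1)]
  note P = is_projection_projection[OF V(1)]
  have "\<rho> \<one>\<^bsub>G\<^esub> \<circ> projection V = projection V"
    using V(5) is_projectionD(2)[OF P] by (simp add: fun_eq_iff)
  then show ?thesis
    unfolding char_on_def using trace_on_projection[OF assms(2,3) V(1) P] by simp
qed

lemma irreducible_decompositionD:
  assumes "irreducible_decomposition G \<rho> V \<W>"
  shows "finite \<W>" "\<And>W. W \<in> \<W> \<Longrightarrow> W \<subseteq> V" "\<And>W. W \<in> \<W> \<Longrightarrow> irreducible_rep G \<rho> W"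
    "\<And>v. v \<in> V \<Longrightarrow> \<exists>!w. w \<in> (\<Pi>\<^sub>E W\<in>\<W>. W) \<and> v = (\<Sum>W\<in>\<W>. w W)"
  using assms unfolding irreducible_decomposition_def by blast+

lemma irreducible_repD:
  assumes "irreducible_rep G \<rho> V"
  shows "group_rep G \<rho> V" "V \<noteq> {0}"
    "\<And>W. W \<subseteq> V \<Longrightarrow> cfun.subspace W \<Longrightarrow> (\<And>g. g \<in> carrier G \<Longrightarrow> \<rho> g ` W \<subseteq> W) \<Longrightarrow> W = {0} \<or> W = V"
  using assms unfolding irreducible_rep_def by blast+

text \<open>The component maps of the direct sum, composed with \<open>projection V\<close>, are
  projections onto the summands and add up to \<open>projection V\<close>. The trace is additive and
  independent of the projections used.\<close>

lemma char_on_decomposition: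
  assumes V: "group_rep G \<rho> V" and X: "finite X" "V \<subseteq> supported X"
    and dec: "irreducible_decomposition G \<rho> V \<W>" and g: "g \<in> carrier G"
  shows "char_on X \<rho> V g = (\<Sum>W\<in>\<W>. char_on X \<rho> W g)"
proof -
  note D = irreducible_decompositionD[OF dec]
  note VD = group_repD[OF V]
  note P = is_projection_projection[OF VD(1)]
  note Pd = is_projectionD[OF P]
  have WD: "cfun.subspace W" if "W \<in> \<W>" for W
    using irreducible_repD(1)[OF D(3)[OF that]] by (rule group_repD)
  define c where "c v = (THE w. w \<in> (\<Pi>\<^sub>E W\<in>\<W>. W) \<and> v = (\<Sum>W\<in>\<W>. w W))" for v
  have c: "c v \<in> (\<Pi>\<^sub>E W\<in>\<W>. W)" "(\<Sum>W\<in>\<W>. c v W) = v" if "v \<in> V" for v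
    using theI'[OF D(4)[OF that]] unfolding c_def by auto
  have cI: "c (\<Sum>W\<in>\<W>. w W) W = w W" if "W \<in> \<W>" "\<And>W. W \<in> \<W> \<Longrightarrow> w W \<in> W" for w W
  proof -
    \<comment> \<open>Uniqueness of components holds among the extensional functions of
      \<open>\<Pi>\<^sub>E\<close>, so \<open>w\<close> must be made undefined off
      \<open>\<W>\<close> first.\<close>
    let ?w = "restrict w \<W>"
    have "(\<Sum>W\<in>\<W>. w W) \<in> V"
      using that D(2) by (intro cfun.subspace_sum[OF VD(1)]) auto
    then have "c (\<Sum>W\<in>\<W>. w W) = ?w"
      unfolding c_def by (intro the1_equality D(4)) (use that in auto)
    then show ?thesis using that by simp
  qed
  have cW: "c v W \<in> W" if "v \<in> V" "W \<in> \<W>" for v W using c(1)[OF that(1)] that(2) by auto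
  have lin_c: "linear_map_on V (\<lambda>v. c v W)" if W: "W \<in> \<W>" for W
    unfolding linear_map_on_def
  proof (intro conjI ballI allI)
    fix v w assume vw: "v \<in> V" "w \<in> V"
    have "c (\<Sum>W\<in>\<W>. c v W + c w W) W = c v W + c w W"
      using vw cW WD by (intro cI W) (auto intro: cfun.subspace_add)
    then show "c (v + w) W = c v W + c w W" using c(2) vw by (simp add: sum.distrib)
  next
    fix a v assume v: "v \<in> V"
    have "c (\<Sum>W\<in>\<W>. cscale a (c v W)) W = cscale a (c v W)"
      using v cW WD by (intro cI W) (auto intro: cfun.subspace_scale)
    then show "c (cscale a v) W = cscale a (c v W)"
      using c(2) v by (simp flip: cfun.scale_sum_right)
  qed
  define Q where "Q W = (\<lambda>v. c v W) \<circ> projection V" for W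
  have Q: "is_projection W (Q W)" if W: "W \<in> \<W>" for W
    unfolding is_projection_def
  proof (intro conjI ballI)
    show "lin (Q W)" unfolding Q_def by (rule lin_compose_projection[OF lin_c[OF W] P])
    show "range (Q W) \<subseteq> W" using cW[OF Pd(2) W] by (auto simp: Q_def)
    fix v assume v: "v \<in> W"
    have "c (\<Sum>W'\<in>\<W>. if W' = W then v else 0) W = (if W = W then v else 0)"
      using v WD by (intro cI W) (auto intro: cfun.subspace_0)
    then have "c v W = v" using D(1) W by (simp add: sum.delta)
    then show "Q W v = v" using D(2)[OF W] v Pd(3) by (auto simp: Q_def)
  qed
  have "\<rho> g \<circ> projection V = (\<lambda>f. \<Sum>W\<in>\<W>. (\<rho> g \<circ> Q W) f)"
  proof
    fix f
    have "\<rho> g (projection V f) = \<rho> g (\<Sum>W\<in>\<W>. c (projection V f) W)" using c(2) Pd(2) by simp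
    also have "\<dots> = (\<Sum>W\<in>\<W>. \<rho> g (c (projection V f) W))"
      using cW[OF Pd(2)] D(2) by (intro linear_map_on_sum[OF VD(2)[OF g] VD(1)]) blast
    finally show "(\<rho> g \<circ> projection V) f = (\<Sum>W\<in>\<W>. (\<rho> g \<circ> Q W) f)" by (simp add: Q_def)
  qed
  then have "char_on X \<rho> V g = (\<Sum>W\<in>\<W>. trace_on X (\<rho> g \<circ> Q W))"
    unfolding char_on_def by (simp only: trace_on_sum)
  also have "\<dots> = (\<Sum>W\<in>\<W>. char_on X \<rho> W g)"
    using D(2) X irreducible_repD(1)[OF D(3)] Q g
    by (intro sum.cong refl char_on_eq_trace[symmetric]) blast+
  finally show ?thesis .
qed

section \<open>Intertwiners, Schur's lemma and orthogonality of characters\<close>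

definition intertwiner ::
    "('g, 'm) monoid_scheme \<Rightarrow>
     ('g \<Rightarrow> ('x \<Rightarrow> complex) \<Rightarrow> ('x \<Rightarrow> complex)) \<Rightarrow> ('x \<Rightarrow> complex) set \<Rightarrow>
     ('g \<Rightarrow> ('y \<Rightarrow> complex) \<Rightarrow> ('y \<Rightarrow> complex)) \<Rightarrow> ('y \<Rightarrow> complex) set \<Rightarrow>
     (('x \<Rightarrow> complex) \<Rightarrow> ('y \<Rightarrow> complex)) \<Rightarrow> bool"
  where
  "intertwiner G \<rho> V \<sigma> W T \<longleftrightarrow>
     linear_map_on V T \<and> T ` V \<subseteq> W \<and> (\<forall>g\<in>carrier G. \<forall>v\<in>V. T (\<rho> g v) = \<sigma> g (T v))"

text \<open>The scalar half of Schur's lemma as a property of a module. For Specht modules it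
  follows from the column antisymmetrizer, without an eigenvalue argument.\<close>

definition scalar_endomorphisms ::
    "('g, 'm) monoid_scheme \<Rightarrow> ('g \<Rightarrow> ('x \<Rightarrow> complex) \<Rightarrow> ('x \<Rightarrow> complex)) \<Rightarrow> ('x \<Rightarrow> complex) set \<Rightarrow> bool"
  where
  "scalar_endomorphisms G \<rho> V \<longleftrightarrow>
     (\<forall>T. intertwiner G \<rho> V \<rho> V T \<longrightarrow> (\<exists>c. \<forall>v\<in>V. T v = cscale c v))"

text \<open>Kernel and image are invariant, so each is zero or everything; kernel \<open>{0}\<close>
  together with image \<open>W\<close> would make \<open>T\<close> an isomorphism.\<close>

lemma schur_zero:
  assumes V: "irreducible_rep G \<rho> V" and W: "irreducible_rep G \<sigma> W"
    and T: "intertwiner G \<rho> V \<sigma> W T" and not_iso: "\<not> isomorphic_reps G \<rho> V \<sigma> W" and v: "v \<in> V"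
  shows "T v = 0"
proof -
  note Vd = group_repD[OF irreducible_repD(1)[OF V]] and Wd = group_repD[OF irreducible_repD(1)[OF W]]
  have lin: "linear_map_on V T" and im: "T ` V \<subseteq> W"
    and eq: "\<And>g v. g \<in> carrier G \<Longrightarrow> v \<in> V \<Longrightarrow> T (\<rho> g v) = \<sigma> g (T v)"
    using T by (auto simp: intertwiner_def)
  note lin0 = linear_map_on_0[OF lin Vd(1)]
  define K where "K = {v\<in>V. T v = 0}"
  have "K = {0} \<or> K = V"
  proof (rule irreducible_repD(3)[OF V])
    show "cfun.subspace K"
      using Vd(1) lin0 linear_map_onD[OF lin] by (auto simp: K_def cfun.subspace_def)
    show "\<rho> g ` K \<subseteq> K" if "g \<in> carrier G" for g
      using that Vd(4) eq linear_map_on_0[OF Wd(2)[OF that] Wd(1)] by (auto simp: K_def)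
  qed (auto simp: K_def)
  moreover have "T ` V = {0} \<or> T ` V = W"
  proof (rule irreducible_repD(3)[OF W])
    show "cfun.subspace (T ` V)"
    proof (rule cfun.subspaceI)
      show "0 \<in> T ` V" using lin0 cfun.subspace_0[OF Vd(1)] by (metis imageI)
      show "x + y \<in> T ` V" if "x \<in> T ` V" "y \<in> T ` V" for x y
        using that linear_map_onD(1)[OF lin] cfun.subspace_add[OF Vd(1)] by (smt (verit) imageE imageI)
      show "cscale c x \<in> T ` V" if "x \<in> T ` V" for c x
        using that linear_map_onD(2)[OF lin] cfun.subspace_scale[OF Vd(1)] by (smt (verit) imageE imageI)
    qed
    show "\<sigma> g ` T ` V \<subseteq> T ` V" if "g \<in> carrier G" for g
      using that Vd(4) eq by (auto simp: image_subset_iff simp flip: eq)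
  qed (rule im)
  moreover have "\<not> (K = {0} \<and> T ` V = W)"
  proof
    assume *: "K = {0} \<and> T ` V = W"
    have "inj_on T V"
    proof (rule inj_onI)
      fix x y assume xy: "x \<in> V" "y \<in> V" "T x = T y"
      then have "x - y \<in> K"
        using linear_map_on_diff[OF lin Vd(1)] cfun.subspace_diff[OF Vd(1)] by (auto simp: K_def)
      then show "x = y" using * by auto
    qed
    then have "isomorphic_reps G \<rho> V \<sigma> W"
      using * lin eq unfolding isomorphic_reps_def bij_betw_def by blast
    then show False using not_iso by contradiction
  qed
  ultimately show ?thesis using v by (auto simp: K_def)
qed


lemma sum_group_left_mult:
  assumes "group G" "h \<in> carrier G"
  shows "(\<Sum>g\<in>carrier G. f (h \<otimes>\<^bsub>G\<^esub> g)) = (\<Sum>g\<in>carrier G. f g)"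
proof -
  interpret group G by fact
  show ?thesis
    by (rule sum.reindex_bij_witness[where i = "\<lambda>g. inv\<^bsub>G\<^esub> h \<otimes>\<^bsub>G\<^esub> g" and j = "\<lambda>g. h \<otimes>\<^bsub>G\<^esub> g"])
      (use assms(2) in \<open>auto simp: m_assoc[symmetric]\<close>)
qed


text \<open>Left without the factor \<open>1 / card (carrier G)\<close>; the division takes place
  only where a projection is wanted.\<close>

definition averaged ::
    "('g, 'm) monoid_scheme \<Rightarrow> ('g \<Rightarrow> ('x \<Rightarrow> complex) \<Rightarrow> ('x \<Rightarrow> complex)) \<Rightarrow>
     ('g \<Rightarrow> ('y \<Rightarrow> complex) \<Rightarrow> ('y \<Rightarrow> complex)) \<Rightarrow> (('x \<Rightarrow> complex) \<Rightarrow> ('y \<Rightarrow> complex)) \<Rightarrow>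
     ('x \<Rightarrow> complex) \<Rightarrow> ('y \<Rightarrow> complex)" where
  "averaged G \<rho> \<sigma> F v = (\<Sum>g\<in>carrier G. \<sigma> g (F (\<rho> (inv\<^bsub>G\<^esub> g) v)))"

text \<open>Applying \<open>\<rho> h\<close> first amounts to shifting the summation index from
  \<open>g\<close> to \<open>h g\<close>, after which \<open>\<sigma> h\<close> can be pulled out of
  the sum.\<close>

lemma intertwiner_averaged:
  assumes G: "group G" and V: "group_rep G \<rho> V" and W: "group_rep G \<sigma> W"
    and F: "linear_map_on V F" "F ` V \<subseteq> W"
  shows "intertwiner G \<rho> V \<sigma> W (averaged G \<rho> \<sigma> F)"
proof -
  interpret group G by fact
  note Vd = group_repD[OF V] and Wd = group_repD[OF W]
  have FW: "F v \<in> W" if "v \<in> V" for v using F that by blast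
  have "linear_map_on V (averaged G \<rho> \<sigma> F)"
    unfolding averaged_def
  proof (rule linear_map_on_sum_ops)
    fix g assume g: "g \<in> carrier G"
    have "linear_map_on V (F \<circ> \<rho> (inv\<^bsub>G\<^esub> g))"
      using g Vd F by (intro linear_map_on_compose[of V _ V]) auto
    then have "linear_map_on V (\<sigma> g \<circ> (F \<circ> \<rho> (inv\<^bsub>G\<^esub> g)))"
      using g Vd(4) FW Wd(2) by (intro linear_map_on_compose[of V _ W]) auto
    then show "linear_map_on V (\<lambda>v. \<sigma> g (F (\<rho> (inv\<^bsub>G\<^esub> g) v)))" by (simp add: o_def)
  qed
  moreover have "averaged G \<rho> \<sigma> F v \<in> W" if "v \<in> V" for v
    unfolding averaged_def
    using Wd Vd(4) FW that by (intro cfun.subspace_sum) auto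
  moreover have "averaged G \<rho> \<sigma> F (\<rho> h v) = \<sigma> h (averaged G \<rho> \<sigma> F v)"
    if h: "h \<in> carrier G" and v: "v \<in> V" for h v
  proof -
    have "averaged G \<rho> \<sigma> F (\<rho> h v)
        = (\<Sum>g\<in>carrier G. \<sigma> (h \<otimes>\<^bsub>G\<^esub> g) (F (\<rho> (inv\<^bsub>G\<^esub> (h \<otimes>\<^bsub>G\<^esub> g)) (\<rho> h v))))"
      unfolding averaged_def by (rule sum_group_left_mult[OF G h, symmetric])
    also have "\<dots> = (\<Sum>g\<in>carrier G. \<sigma> h (\<sigma> g (F (\<rho> (inv\<^bsub>G\<^esub> g) v))))"
    proof (rule sum.cong[OF refl])
      fix g assume g: "g \<in> carrier G"
      have "\<rho> (inv\<^bsub>G\<^esub> (h \<otimes>\<^bsub>G\<^esub> g)) (\<rho> h v) = \<rho> (inv\<^bsub>G\<^esub> (h \<otimes>\<^bsub>G\<^esub> g) \<otimes>\<^bsub>G\<^esub> h) v"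
        using g h v by (intro Vd(6)[symmetric]) auto
      also have "inv\<^bsub>G\<^esub> (h \<otimes>\<^bsub>G\<^esub> g) \<otimes>\<^bsub>G\<^esub> h = inv\<^bsub>G\<^esub> g"
        using g h by (simp add: inv_mult_group m_assoc)
      finally show "\<sigma> (h \<otimes>\<^bsub>G\<^esub> g) (F (\<rho> (inv\<^bsub>G\<^esub> (h \<otimes>\<^bsub>G\<^esub> g)) (\<rho> h v)))
          = \<sigma> h (\<sigma> g (F (\<rho> (inv\<^bsub>G\<^esub> g) v)))"
        using Wd(6)[OF h g] FW Vd(4) g v by simp
    qed
    also have "\<dots> = \<sigma> h (averaged G \<rho> \<sigma> F v)"
      unfolding averaged_def
      using Wd Vd(4) FW h v
      by (subst linear_map_on_sum[OF Wd(2)[OF h] Wd(1)]) auto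
    finally show ?thesis .
  qed
  ultimately show ?thesis unfolding intertwiner_def by blast
qed

text \<open>
  The average of the rank-one map \<open>v \<mapsto> v x \<cdot> b\<close>. Summing the diagonal matrix
  entries of these averages gives the inner product of the two characters.
\<close>

definition averaged_map ::
    "('g, 'm) monoid_scheme \<Rightarrow> ('g \<Rightarrow> ('x \<Rightarrow> complex) \<Rightarrow> ('x \<Rightarrow> complex)) \<Rightarrow>
     ('g \<Rightarrow> ('y \<Rightarrow> complex) \<Rightarrow> ('y \<Rightarrow> complex)) \<Rightarrow> 'x \<Rightarrow> ('y \<Rightarrow> complex) \<Rightarrow>
     ('x \<Rightarrow> complex) \<Rightarrow> ('y \<Rightarrow> complex)" where
  "averaged_map G \<rho> \<sigma> x b v = (\<Sum>g\<in>carrier G. cscale (\<rho> (inv\<^bsub>G\<^esub> g) v x) (\<sigma> g b))"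

lemma intertwiner_averaged_map:
  assumes G: "group G" and V: "group_rep G \<rho> V" and W: "group_rep G \<sigma> W" and b: "b \<in> W"
  shows "intertwiner G \<rho> V \<sigma> W (averaged_map G \<rho> \<sigma> x b)"
proof -
  note Wd = group_repD[OF W]
  have "averaged_map G \<rho> \<sigma> x b = averaged G \<rho> \<sigma> (\<lambda>v. cscale (v x) b)"
    unfolding averaged_def averaged_map_def using b linear_map_onD(2)[OF Wd(2)] by simp
  moreover have "linear_map_on V (\<lambda>v. cscale (v x) b)"
    by (auto simp: linear_map_on_def cscale_def fun_eq_iff algebra_simps)
  ultimately show ?thesis
    using intertwiner_averaged[OF G V W] b Wd(1) by (auto intro: cfun.subspace_scale)
qed

lemma sum_char_on_mult:
  assumes V: "group_rep G \<rho> V" and W: "group_rep G \<sigma> W"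
  shows "(\<Sum>g\<in>carrier G. char_on X \<rho> V (inv\<^bsub>G\<^esub> g) * char_on Y \<sigma> W g) =
    (\<Sum>y\<in>Y. \<Sum>x\<in>X. averaged_map G \<rho> \<sigma> x (projection W (unit_fun y)) (projection V (unit_fun x)) y)"
proof -
  have "(\<Sum>g\<in>carrier G. char_on X \<rho> V (inv\<^bsub>G\<^esub> g) * char_on Y \<sigma> W g) =
    (\<Sum>g\<in>carrier G. \<Sum>y\<in>Y. \<Sum>x\<in>X. \<rho> (inv\<^bsub>G\<^esub> g) (projection V (unit_fun x)) x * \<sigma> g (projection W (unit_fun y)) y)"
    unfolding char_on_def trace_on_def o_def
    by (intro sum.cong refl) (subst sum.swap, simp add: sum_product)
  also have "\<dots> = (\<Sum>y\<in>Y. \<Sum>x\<in>X. \<Sum>g\<in>carrier G. \<rho> (inv\<^bsub>G\<^esub> g) (projection V (unit_fun x)) x * \<sigma> g (projection W (unit_fun y)) y)"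
    by (subst sum.swap, intro sum.cong refl, subst sum.swap, rule refl)
  finally show ?thesis
    unfolding averaged_map_def sum_fun_apply cscale_def .
qed

text \<open>Each averaged rank-one map intertwines two non-isomorphic irreducibles and hence
  vanishes, so all the matrix entries in \<open>sum_char_on_mult\<close> are 0.\<close>

lemma char_orthogonal:
  assumes G: "group G" and V: "irreducible_rep G \<rho> V" and W: "irreducible_rep G \<sigma> W"
    and "\<not> isomorphic_reps G \<rho> V \<sigma> W"
  shows "(\<Sum>g\<in>carrier G. char_on X \<rho> V (inv\<^bsub>G\<^esub> g) * char_on Y \<sigma> W g) = 0"
proof -
  note V' = irreducible_repD(1)[OF V] and W' = irreducible_repD(1)[OF W]
  note pV = is_projectionD[OF is_projection_projection[OF group_repD(1)[OF V']]]
  note pW = is_projectionD[OF is_projection_projection[OF group_repD(1)[OF W']]]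
  have "averaged_map G \<rho> \<sigma> x (projection W (unit_fun y)) (projection V (unit_fun x)) = 0" for x y
    by (rule schur_zero[OF V W intertwiner_averaged_map[OF G V' W' pW(2)] assms(4) pV(2)])
  then show ?thesis unfolding sum_char_on_mult[OF V' W'] by simp
qed

lemma dim_pos:
  assumes "finite X" "V \<subseteq> supported X" "cfun.subspace V" "V \<noteq> {0}"
  shows "cfun.dim V > 0"
proof (rule ccontr)
  assume "\<not> 0 < cfun.dim V"
  moreover obtain B where "finite B" "cfun.span B = V" "card B = cfun.dim V"
    using finite_basis_exists[OF assms(1-3)] by metis
  ultimately show False using assms(4) by auto
qed

text \<open>Each averaged rank-one map is a scalar by hypothesis. Comparing traces shows that this
  scalar times the dimension is the group order times a matrix entry of the projection
  \<open>p\<close>. Summing over all entries leaves the trace of \<open>p \<circ> p = p\<close>,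
  which is the dimension again and cancels.\<close>

lemma char_norm:
  assumes G: "group G" "finite (carrier G)" and W: "group_rep G \<sigma> W" and "W \<noteq> {0}"
    and Y: "finite Y" "W \<subseteq> supported Y" and scal: "scalar_endomorphisms G \<sigma> W"
  shows "(\<Sum>g\<in>carrier G. char_on Y \<sigma> W (inv\<^bsub>G\<^esub> g) * char_on Y \<sigma> W g) = of_nat (card (carrier G))"
proof -
  interpret group G by fact
  note Wd = group_repD[OF W]
  note P = is_projection_projection[OF Wd(1)]
  note Pd = is_projectionD[OF P]
  define p where "p = projection W"
  let ?d = "of_nat (cfun.dim W) :: complex" and ?N = "of_nat (card (carrier G)) :: complex"
  have d: "?d \<noteq> 0" using dim_pos[OF Y Wd(1) assms(4)] by simp
  have key: "averaged_map G \<sigma> \<sigma> x (p (unit_fun y)) v z * ?d = ?N * p (unit_fun y) x * v z"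
    if v: "v \<in> W" for x y v z
  proof -
    let ?A = "averaged_map G \<sigma> \<sigma> x (p (unit_fun y))"
    have b: "p (unit_fun y) \<in> W" using Pd by (simp add: p_def)
    have Ai: "intertwiner G \<sigma> W \<sigma> W ?A"
      by (rule intertwiner_averaged_map[OF G(1) W W b])
    then obtain c where c: "\<And>v. v \<in> W \<Longrightarrow> ?A v = cscale c v"
      using scal unfolding scalar_endomorphisms_def by blast
    have "trace_on Y (?A \<circ> p) = c * trace_on Y p"
      using c Pd by (simp add: p_def trace_on_def sum_distrib_left cscale_def o_def)
    also have "trace_on Y p = ?d" unfolding p_def by (rule trace_on_projection[OF Y Wd(1) P])
    finally have "c * ?d = trace_on Y (?A \<circ> p)" by (simp only:)
    also have "\<dots> = (\<Sum>g\<in>carrier G. \<Sum>z\<in>Y. \<sigma> g (p (unit_fun y)) z * (\<sigma> (inv\<^bsub>G\<^esub> g) \<circ> p) (unit_fun z) x)"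
      unfolding trace_on_def averaged_map_def o_def sum_fun_apply cscale_def
      by (subst sum.swap) (simp add: mult.commute)
    \<comment> \<open>Conjugation by \<open>g\<close> does not change the trace, so every summand is
      the trace of the rank-one map itself.\<close>
    also have "\<dots> = (\<Sum>g\<in>carrier G. p (unit_fun y) x)"
    proof (rule sum.cong[OF refl])
      fix g assume g: "g \<in> carrier G"
      have gb: "\<sigma> g (p (unit_fun y)) \<in> W" using Wd(4)[OF g b] .
      have "(\<Sum>z\<in>Y. \<sigma> g (p (unit_fun y)) z * (\<sigma> (inv\<^bsub>G\<^esub> g) \<circ> p) (unit_fun z) x)
          = (\<sigma> (inv\<^bsub>G\<^esub> g) \<circ> p) (\<sigma> g (p (unit_fun y))) x"
        using g gb Y P Wd(2) by (intro lin_expand[symmetric] lin_compose_projection) (auto simp: p_def)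
      also have "\<dots> = \<sigma> (inv\<^bsub>G\<^esub> g) (\<sigma> g (p (unit_fun y))) x" using Pd gb by (simp add: p_def)
      also have "\<dots> = \<sigma> (inv\<^bsub>G\<^esub> g \<otimes>\<^bsub>G\<^esub> g) (p (unit_fun y)) x"
        using Wd(6)[of "inv\<^bsub>G\<^esub> g" g "p (unit_fun y)"] g b by simp
      also have "\<dots> = p (unit_fun y) x" using g b Wd(5) by simp
      finally show "(\<Sum>z\<in>Y. \<sigma> g (p (unit_fun y)) z * (\<sigma> (inv\<^bsub>G\<^esub> g) \<circ> p) (unit_fun z) x)
          = p (unit_fun y) x" .
    qed
    finally have "c * ?d = ?N * p (unit_fun y) x" by simp
    then show ?thesis using c[OF v] by (simp add: cscale_def mult.assoc mult.left_commute mult.commute)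
  qed
  have "(\<Sum>g\<in>carrier G. char_on Y \<sigma> W (inv\<^bsub>G\<^esub> g) * char_on Y \<sigma> W g) * ?d
      = (\<Sum>y\<in>Y. \<Sum>x\<in>Y. ?N * p (unit_fun y) x * p (unit_fun x) y)"
    unfolding sum_char_on_mult[OF W W] sum_distrib_right p_def[symmetric]
    by (intro sum.cong refl key) (simp add: p_def Pd)
  also have "\<dots> = ?N * (\<Sum>y\<in>Y. \<Sum>x\<in>Y. p (unit_fun y) x * p (unit_fun x) y)"
    by (simp add: sum_distrib_left mult.assoc)
  also have "(\<Sum>y\<in>Y. \<Sum>x\<in>Y. p (unit_fun y) x * p (unit_fun x) y) = (\<Sum>y\<in>Y. p (p (unit_fun y)) y)"
    using Pd Y by (intro sum.cong refl lin_expand[symmetric]) (auto simp: p_def)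
  also have "\<dots> = trace_on Y p" using Pd by (simp add: p_def trace_on_def)
  also have "\<dots> = ?d" unfolding p_def by (rule trace_on_projection[OF Y Wd(1) P])
  finally show ?thesis using d by simp
qed

text \<open>By additivity of characters it is enough to look at one summand: an isomorphic one has
  the character of \<open>U\<close> and contributes the norm, any other is orthogonal to it. Scalar
  endomorphisms are thus asked of \<open>U\<close> alone and not of the unknown summands.\<close>

lemma card_isomorphic_summands:
  assumes G: "group G" "finite (carrier G)" and V: "group_rep G \<rho> V" and X: "finite X" "V \<subseteq> supported X"
    and dec: "irreducible_decomposition G \<rho> V \<W>"
    and U: "irreducible_rep G \<sigma> U" and Y: "finite Y" "U \<subseteq> supported Y" and scal: "scalar_endomorphisms G \<sigma> U"
  shows "of_nat (card {W \<in> \<W>. isomorphic_reps G \<rho> W \<sigma> U}) * of_nat (card (carrier G))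
    = (\<Sum>g\<in>carrier G. char_on X \<rho> V (inv\<^bsub>G\<^esub> g) * char_on Y \<sigma> U g)"
proof -
  interpret group G by fact
  note D = irreducible_decompositionD[OF dec]
  note U' = irreducible_repD(1)[OF U]
  let ?N = "of_nat (card (carrier G)) :: complex"
  have "(\<Sum>g\<in>carrier G. char_on X \<rho> V (inv\<^bsub>G\<^esub> g) * char_on Y \<sigma> U g)
     = (\<Sum>g\<in>carrier G. \<Sum>W\<in>\<W>. char_on X \<rho> W (inv\<^bsub>G\<^esub> g) * char_on Y \<sigma> U g)"
    unfolding sum_distrib_right[symmetric]
    by (intro sum.cong refl arg_cong2[where f = "(*)"] char_on_decomposition[OF V X dec]) auto
  also have "\<dots> = (\<Sum>W\<in>\<W>. \<Sum>g\<in>carrier G. char_on X \<rho> W (inv\<^bsub>G\<^esub> g) * char_on Y \<sigma> U g)"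
    by (rule sum.swap)
  also have "\<dots> = (\<Sum>W\<in>\<W>. if isomorphic_reps G \<rho> W \<sigma> U then ?N else 0)"
  proof (rule sum.cong[OF refl])
    fix W assume W: "W \<in> \<W>"
    show "(\<Sum>g\<in>carrier G. char_on X \<rho> W (inv\<^bsub>G\<^esub> g) * char_on Y \<sigma> U g)
       = (if isomorphic_reps G \<rho> W \<sigma> U then ?N else 0)"
    proof (cases "isomorphic_reps G \<rho> W \<sigma> U")
      case True
      have WX: "W \<subseteq> supported X" using D(2)[OF W] X by blast
      have "(\<Sum>g\<in>carrier G. char_on X \<rho> W (inv\<^bsub>G\<^esub> g) * char_on Y \<sigma> U g)
        = (\<Sum>g\<in>carrier G. char_on Y \<sigma> U (inv\<^bsub>G\<^esub> g) * char_on Y \<sigma> U g)"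
        by (intro sum.cong refl arg_cong2[where f = "(*)"]
            char_on_isomorphic[OF irreducible_repD(1)[OF D(3)[OF W]] X(1) WX U' Y True]) auto
      then show ?thesis
        using True char_norm[OF G U' irreducible_repD(2)[OF U] Y scal] by simp
    next
      case False
      then show ?thesis using char_orthogonal[OF G(1) D(3)[OF W] U] by simp
    qed
  qed
  also have "\<dots> = of_nat (card {W \<in> \<W>. isomorphic_reps G \<rho> W \<sigma> U}) * ?N"
    using D(1) by (simp add: sum.If_cases Int_def)
  finally show ?thesis by simp
qed


section \<open>Complete reducibility\<close>

lemma dim_less_subspace:
  assumes "finite X" "V \<subseteq> supported X" "cfun.subspace V" "cfun.subspace W" "W \<subseteq> V" "W \<noteq> V"
  shows "cfun.dim W < cfun.dim V"
proof -
  obtain B where B: "finite B" "B \<subseteq> W" "cfun.independent B" "cfun.span B = W" "card B = cfun.dim W"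
    using finite_basis_exists[of X W] assms by (metis subset_trans)
  obtain C where C: "B \<subseteq> C" "C \<subseteq> V" "cfun.independent C" "V \<subseteq> cfun.span C"
    using cfun.maximal_independent_subset_extend[of B V] B assms by (metis subset_trans)
  have dC: "card C = cfun.dim V" using C by (intro cfun.basis_card_eq_dim) auto
  obtain D where "finite D" "cfun.span D = V" using finite_basis_exists[OF assms(1-3)] by metis
  then have "finite C" using cfun.independent_span_bound[of D C] C by auto
  moreover have "B \<noteq> C" using B C assms by auto
  ultimately have "card B < card C" using C by (intro psubset_card_mono) auto
  then show ?thesis using B dC by simp
qed

text \<open>A nonzero invariant subspace of least dimension is irreducible, because a smaller
  nonzero invariant subspace inside it would have smaller dimension.\<close>

lemma irreducible_subrep_exists:
  assumes V: "group_rep G \<rho> V" and X: "finite X" "V \<subseteq> supported X" and "V \<noteq> {0}"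
  obtains W where "W \<subseteq> V" "irreducible_rep G \<rho> W"
proof -
  define good where "good W \<longleftrightarrow> W \<subseteq> V \<and> cfun.subspace W \<and> W \<noteq> {0} \<and> (\<forall>g\<in>carrier G. \<rho> g ` W \<subseteq> W)" for W
  have "good V" using assms group_repD[OF V] by (auto simp: good_def)
  define W where "W = arg_min cfun.dim good"
  have W: "good W" unfolding W_def by (rule arg_min_natI) fact
  have least: "cfun.dim W \<le> cfun.dim W'" if "good W'" for W'
    unfolding W_def by (rule arg_min_nat_le) fact
  have WX: "W \<subseteq> supported X" using W X by (auto simp: good_def)
  have "irreducible_rep G \<rho> W"
    unfolding irreducible_rep_def
  proof (intro conjI allI impI)
    show "group_rep G \<rho> W" using W by (intro group_rep_subspace[OF V X]) (auto simp: good_def)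
    show "W \<noteq> {0}" using W by (simp add: good_def)
    fix W' assume W': "W' \<subseteq> W \<and> cfun.subspace W' \<and> (\<forall>g\<in>carrier G. \<rho> g ` W' \<subseteq> W')"
    show "W' = {0} \<or> W' = W"
    proof (rule ccontr)
      assume *: "\<not> (W' = {0} \<or> W' = W)"
      then have "good W'" using W W' by (auto simp: good_def)
      moreover have "cfun.dim W' < cfun.dim W"
        using * W W' by (intro dim_less_subspace[OF X(1) WX]) (auto simp: good_def)
      ultimately show False using least by fastforce
    qed
  qed
  then show ?thesis using that W by (auto simp: good_def)
qed

text \<open>Averaging an arbitrary projection onto \<open>W\<close> makes it equivariant. Its values
  stay in \<open>W\<close>, and after division by the group order it is still the identity on
  \<open>W\<close>.\<close>

lemma equivariant_projection_exists:
  assumes G: "group G" "finite (carrier G)" and V: "group_rep G \<rho> V" and W: "group_rep G \<rho> W" "W \<subseteq> V"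
  obtains P where "intertwiner G \<rho> V \<rho> W P" "\<And>w. w \<in> W \<Longrightarrow> P w = w"
proof -
  interpret group G by fact
  note Vd = group_repD[OF V] and Wd = group_repD[OF W(1)]
  note pd = is_projectionD[OF is_projection_projection[OF Wd(1)]]
  let ?N = "of_nat (card (carrier G)) :: complex"
  have N: "?N \<noteq> 0" using G(2) one_closed by (auto simp: card_eq_0_iff)
  define P0 where "P0 = averaged G \<rho> \<rho> (projection W)"
  define P where "P = (\<lambda>v. cscale (1 / ?N) (P0 v))"
  have P0: "intertwiner G \<rho> V \<rho> W P0"
    unfolding P0_def
    by (intro intertwiner_averaged[OF G(1) V W(1)]) (use pd in \<open>auto simp: linear_map_on_def\<close>)
  have "intertwiner G \<rho> V \<rho> W P"
    unfolding intertwiner_def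
  proof (intro conjI ballI)
    show "linear_map_on V P"
      using P0 unfolding P_def intertwiner_def linear_map_on_def
      by (auto simp: cfun.scale_right_distrib mult.commute)
    show "P ` V \<subseteq> W"
      using P0 Wd(1) unfolding P_def intertwiner_def by (auto intro: cfun.subspace_scale)
    fix g v assume g: "g \<in> carrier G" and v: "v \<in> V"
    have "P0 v \<in> W" "P0 (\<rho> g v) = \<rho> g (P0 v)" using P0 g v by (auto simp: intertwiner_def)
    then show "P (\<rho> g v) = \<rho> g (P v)"
      unfolding P_def using linear_map_onD(2)[OF Wd(2)[OF g]] by simp
  qed
  moreover have "P w = w" if w: "w \<in> W" for w
  proof -
    have "P0 w = (\<Sum>g\<in>carrier G. w)"
      unfolding P0_def averaged_def
    proof (rule sum.cong[OF refl])
      fix g assume g: "g \<in> carrier G"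
      then have "\<rho> g (projection W (\<rho> (inv\<^bsub>G\<^esub> g) w)) = \<rho> g (\<rho> (inv\<^bsub>G\<^esub> g) w)"
        using Wd(4) pd(3) w by simp
      also have "\<dots> = \<rho> (g \<otimes>\<^bsub>G\<^esub> inv\<^bsub>G\<^esub> g) w"
        using Wd(6)[of g "inv\<^bsub>G\<^esub> g" w] g w by simp
      also have "\<dots> = w" using Wd(5) g w by simp
      finally show "\<rho> g (projection W (\<rho> (inv\<^bsub>G\<^esub> g) w)) = w" .
    qed
    also have "\<dots> = cscale ?N w"
      by (simp add: fun_eq_iff cscale_def sum_fun_apply)
    finally show ?thesis using N by (simp add: P_def cscale_def fun_eq_iff)
  qed
  ultimately show ?thesis using that by blast
qed

text \<open>Induction on the dimension: an irreducible \<open>W\<close> is split off, and the kernel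
  of an equivariant projection onto it is decomposed further. Decompositions are sets of subspaces,
  so \<open>W\<close> has to be distinguished from the summands of the kernel; it meets the kernel
  only in 0.\<close>

theorem maschke:
  assumes G: "group G" "finite (carrier G)" and "group_rep G \<rho> V" and X: "finite X" and "V \<subseteq> supported X"
  shows "\<exists>\<W>. irreducible_decomposition G \<rho> V \<W>"
  using assms(3,5)
proof (induction "cfun.dim V" arbitrary: V rule: less_induct)
  case (less V)
  note V = less.prems
  note Vd = group_repD[OF V(1)]
  show ?case
  proof (cases "V = {0}")
    case True
    then have "irreducible_decomposition G \<rho> V {}" by (auto simp: irreducible_decomposition_def)
    then show ?thesis ..
  next
    case False
    obtain W where W: "W \<subseteq> V" "irreducible_rep G \<rho> W"
      using irreducible_subrep_exists[OF V(1) X V(2) False] .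
    note W' = irreducible_repD[OF W(2)]
    obtain P where P: "intertwiner G \<rho> V \<rho> W P" "\<And>w. w \<in> W \<Longrightarrow> P w = w"
      using equivariant_projection_exists[OF G V(1) W'(1) W(1)] by metis
    have linP: "linear_map_on V P" and PW: "\<And>v. v \<in> V \<Longrightarrow> P v \<in> W"
      and Pg: "\<And>g v. g \<in> carrier G \<Longrightarrow> v \<in> V \<Longrightarrow> P (\<rho> g v) = \<rho> g (P v)"
      using P(1) by (auto simp: intertwiner_def)
    define K where "K = {v\<in>V. P v = 0}"
    have KV: "K \<subseteq> V" by (auto simp: K_def)
    have K: "cfun.subspace K"
      using Vd(1) linear_map_on_0[OF linP Vd(1)] linear_map_onD[OF linP]
      by (auto simp: K_def cfun.subspace_def)
    have gK: "group_rep G \<rho> K"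
    proof (rule group_rep_subspace[OF V(1) X V(2) K KV])
      fix g assume "g \<in> carrier G"
      then show "\<rho> g ` K \<subseteq> K"
        using Vd(4) Pg linear_map_on_0[OF Vd(2) Vd(1)] by (auto simp: K_def)
    qed
    have WK: "w = 0" if "w \<in> W" "w \<in> K" for w using that P(2) by (auto simp: K_def)
    have "0 \<in> W" using cfun.subspace_0[OF group_repD(1)[OF W'(1)]] .
    have "K \<noteq> V" using W'(2) W(1) WK \<open>0 \<in> W\<close> by blast
    then have "cfun.dim K < cfun.dim V"
      using X V(2) Vd(1) K KV by (intro dim_less_subspace) auto
    then obtain \<W> where dec: "irreducible_decomposition G \<rho> K \<W>"
      using less.hyps[OF _ gK] V(2) KV by blast
    note D = irreducible_decompositionD[OF dec]
    have notin: "W \<notin> \<W>" using D(2) WK W'(2) \<open>0 \<in> W\<close> by blast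
    have ex1: "\<exists>!w. w \<in> (\<Pi>\<^sub>E U\<in>insert W \<W>. U) \<and> v = (\<Sum>U\<in>insert W \<W>. w U)" if v: "v \<in> V" for v
    proof -
      have PvV: "P v \<in> V" using PW[OF v] W(1) by (rule subsetD[rotated])
      have "P (v - P v) = P v - P (P v)" by (rule linear_map_on_diff[OF linP Vd(1) v PvV])
      then have "P (v - P v) = 0" unfolding P(2)[OF PW[OF v]] by simp
      then have vK: "v - P v \<in> K"
        using cfun.subspace_diff[OF Vd(1) v PvV] unfolding K_def by blast
      define Q where "Q w \<longleftrightarrow> w \<in> (\<Pi>\<^sub>E U\<in>\<W>. U) \<and> v - P v = (\<Sum>U\<in>\<W>. w U)" for w
      have "\<exists>!w. Q w" unfolding Q_def by (rule D(4)[OF vK])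
      then obtain w where Qw: "Q w" and Q_un: "\<And>w'. Q w' \<Longrightarrow> w' = w" by blast
      have w: "w \<in> (\<Pi>\<^sub>E U\<in>\<W>. U)" "v - P v = (\<Sum>U\<in>\<W>. w U)" using Qw by (simp_all only: Q_def)
      have un: "w' = w" if "w' \<in> (\<Pi>\<^sub>E U\<in>\<W>. U)" "v - P v = (\<Sum>U\<in>\<W>. w' U)" for w'
        using Q_un that unfolding Q_def by blast
      define R where "R w \<longleftrightarrow> w \<in> (\<Pi>\<^sub>E U\<in>insert W \<W>. U) \<and> v = (\<Sum>U\<in>insert W \<W>. w U)" for w
      have "R (w(W := P v))"
        unfolding R_def
      proof (rule conjI)
        show "w(W := P v) \<in> (\<Pi>\<^sub>E U\<in>insert W \<W>. U)"
          using PiE_fun_upd[OF PW[OF v] w(1)] .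
        have "(\<Sum>U\<in>insert W \<W>. (w(W := P v)) U) = P v + (\<Sum>U\<in>\<W>. (w(W := P v)) U)"
          by (subst sum.insert[OF D(1) notin]) auto
        also have "(\<Sum>U\<in>\<W>. (w(W := P v)) U) = (\<Sum>U\<in>\<W>. w U)"
          using notin by (intro sum.cong) auto
        also have "P v + (\<Sum>U\<in>\<W>. w U) = v" unfolding w(2)[symmetric] by simp
        finally show "v = (\<Sum>U\<in>insert W \<W>. (w(W := P v)) U)" by simp
      qed
      \<comment> \<open>In any decomposition of \<open>v\<close> the part outside \<open>W\<close>
        lies in the kernel of \<open>P\<close>. So the component in \<open>W\<close> must be
        \<open>P v\<close>, and the others decompose \<open>v - P v\<close> inside the kernel, where
        uniqueness is known.\<close>
      moreover have "w' = w(W := P v)" if "R w'" for w'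
      proof -
        have w': "w' \<in> (\<Pi>\<^sub>E U\<in>insert W \<W>. U) \<and> v = (\<Sum>U\<in>insert W \<W>. w' U)" using that by (simp only: R_def)
        define k where "k = (\<Sum>U\<in>\<W>. w' U)"
        have kK: "k \<in> K" unfolding k_def using w' D(2) by (intro cfun.subspace_sum[OF K]) auto
        have vk: "v = w' W + k" using w' sum.insert[OF D(1) notin, of w'] by (simp add: k_def)
        have wW: "w' W \<in> W" using w' by auto
        have "P v = P (w' W) + P k"
          unfolding vk using wW kK W(1) KV by (intro linear_map_onD(1)[OF linP]) auto
        then have Pv: "P v = w' W" using P(2)[OF wW] kK by (simp add: K_def)
        have rw: "restrict w' \<W> = w"
        proof (rule un)
          show "restrict w' \<W> \<in> (\<Pi>\<^sub>E U\<in>\<W>. U)" using conjunct1[OF w'] by auto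
          have "v - P v = k" using Pv vk by (metis add_diff_cancel_left')
          also have "k = sum (restrict w' \<W>) \<W>" unfolding k_def by (intro sum.cong) auto
          finally show "v - P v = sum (restrict w' \<W>) \<W>" .
        qed
        have "w' U = (w(W := P v)) U" for U
        proof (cases "U \<in> insert W \<W>")
          case True
          then show ?thesis using Pv notin by (auto simp flip: rw)
        next
          case False
          then have "w' U = undefined" by (rule PiE_arb[OF conjunct1[OF w']])
          then show ?thesis using False by (simp flip: rw)
        qed
        then show ?thesis by (rule ext)
      qed
      ultimately have "\<exists>!w. R w" by blast
      then show ?thesis by (simp only: R_def)
    qed
    have "irreducible_decomposition G \<rho> V (insert W \<W>)"
      unfolding irreducible_decomposition_def
    proof (intro conjI ballI)
      show "finite (insert W \<W>)" using D(1) by simp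
      show "U \<subseteq> V" "irreducible_rep G \<rho> U" if "U \<in> insert W \<W>" for U
        using that D(3) W subset_trans[OF D(2) KV] by auto
    qed (rule ex1)
    then show ?thesis ..
  qed
qed

text \<open>This resolves the definite description in \<open>multiplicity_rep\<close>:
  \<open>maschke\<close> provides a decomposition, and the count in any decomposition is determined
  by a character sum in which the decomposition does not occur.\<close>

lemma multiplicity_rep_char:
  assumes G: "group G" "finite (carrier G)" and V: "group_rep G \<rho> V" and X: "finite X" "V \<subseteq> supported X"
    and U: "irreducible_rep G \<sigma> U" and Y: "finite Y" "U \<subseteq> supported Y" and scal: "scalar_endomorphisms G \<sigma> U"
  shows "of_nat (multiplicity_rep G \<sigma> U \<rho> V) * of_nat (card (carrier G))
    = (\<Sum>g\<in>carrier G. char_on X \<rho> V (inv\<^bsub>G\<^esub> g) * char_on Y \<sigma> U g)"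
proof -
  interpret group G by fact
  note card = card_isomorphic_summands[OF G V X _ U Y scal]
  obtain \<W> where \<W>: "irreducible_decomposition G \<rho> V \<W>" using maschke[OF G V X] by blast
  let ?P = "\<lambda>m. \<exists>\<W>. irreducible_decomposition G \<rho> V \<W> \<and> m = card {W \<in> \<W>. isomorphic_reps G \<rho> W \<sigma> U}"
  have N: "of_nat (card (carrier G)) \<noteq> (0 :: complex)"
    using G(2) one_closed by (auto simp: card_eq_0_iff)
  have "multiplicity_rep G \<sigma> U \<rho> V = card {W \<in> \<W>. isomorphic_reps G \<rho> W \<sigma> U}"
    unfolding multiplicity_rep_def
  proof (rule the_equality)
    show "?P (card {W \<in> \<W>. isomorphic_reps G \<rho> W \<sigma> U})"
      by (rule exI[of _ \<W>], rule conjI, rule \<W>, rule refl)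
    fix m assume "?P m"
    then obtain \<W>' where \<W>': "irreducible_decomposition G \<rho> V \<W>' \<and>
        m = card {W \<in> \<W>'. isomorphic_reps G \<rho> W \<sigma> U}" by (rule exE)
    have "(of_nat m :: complex) * of_nat (card (carrier G)) =
        of_nat (card {W \<in> \<W>. isomorphic_reps G \<rho> W \<sigma> U}) * of_nat (card (carrier G))"
      unfolding conjunct2[OF \<W>'] card[OF conjunct1[OF \<W>']] card[OF \<W>] ..
    then have "(of_nat m :: complex) = of_nat (card {W \<in> \<W>. isomorphic_reps G \<rho> W \<sigma> U})"
      using mult_right_cancel[OF N] by (simp only:)
    then show "m = card {W \<in> \<W>. isomorphic_reps G \<rho> W \<sigma> U}" by (simp only: of_nat_eq_iff)
  qed
  then show ?thesis using card[OF \<W>] by (simp only:)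
qed

section \<open>Tableaux and tabloids\<close>

text \<open>Positions are read off from entries, so that equality of tabloids becomes equality of
  row indices and a column permutation is one that preserves column indices.\<close>

definition row_of :: "nat list \<Rightarrow> (nat \<times> nat \<Rightarrow> nat) \<Rightarrow> nat \<Rightarrow> nat" where
  "row_of lam t x = fst (inv_into (diagram lam) t x)"

definition col_of :: "nat list \<Rightarrow> (nat \<times> nat \<Rightarrow> nat) \<Rightarrow> nat \<Rightarrow> nat" where
  "col_of lam t x = snd (inv_into (diagram lam) t x)"

lemma finite_diagram: "finite (diagram lam)"
proof -
  have "diagram lam = (\<Union>i<length lam. Pair i ` {..<lam ! i})" by (auto simp: diagram_def)
  then show ?thesis by simp
qed

lemma card_diagram: "card (diagram lam) = sum_list lam"
proof -
  have "diagram lam = Sigma {..<length lam} (\<lambda>i. {..<lam ! i})" by (auto simp: diagram_def)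
  then show ?thesis by (simp add: sum_list_sum_nth atLeast0LessThan)
qed

lemma tableau_exists: "\<exists>t. is_tableau lam t"
  unfolding is_tableau_def
  by (rule finite_same_card_bij) (auto simp: finite_diagram card_diagram)

lemma tableau_entry:
  assumes "is_tableau lam t" "(i, j) \<in> diagram lam"
  shows "t (i, j) \<in> {1..sum_list lam}" "row_of lam t (t (i, j)) = i" "col_of lam t (t (i, j)) = j"
proof -
  have "inj_on t (diagram lam)" using assms by (simp add: is_tableau_def bij_betw_def)
  then have "inv_into (diagram lam) t (t (i, j)) = (i, j)" using assms(2) by simp
  then show "row_of lam t (t (i, j)) = i" "col_of lam t (t (i, j)) = j"
    by (simp_all add: row_of_def col_of_def)
  show "t (i, j) \<in> {1..sum_list lam}"
    using assms bij_betw_apply unfolding is_tableau_def by fast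
qed

lemma tableau_cell:
  assumes "is_tableau lam t" "x \<in> {1..sum_list lam}"
  shows "(row_of lam t x, col_of lam t x) \<in> diagram lam" "t (row_of lam t x, col_of lam t x) = x"
proof -
  have x: "x \<in> t ` diagram lam" using assms by (simp add: is_tableau_def bij_betw_def)
  show "(row_of lam t x, col_of lam t x) \<in> diagram lam" "t (row_of lam t x, col_of lam t x) = x"
    unfolding row_of_def col_of_def prod.collapse using inv_into_into[OF x] f_inv_into_f[OF x] by auto
qed

lemma tableau_inj_cell:
  assumes "is_tableau lam t" "x \<in> {1..sum_list lam}" "y \<in> {1..sum_list lam}"
    "row_of lam t x = row_of lam t y" "col_of lam t x = col_of lam t y"
  shows "x = y"
  using tableau_cell(2)[OF assms(1,2)] tableau_cell(2)[OF assms(1,3)] assms(4,5) by metis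

lemma tableau_comp:
  assumes "is_tableau lam t" "p permutes {1..sum_list lam}"
  shows "is_tableau lam (p \<circ> t)"
  using assms unfolding is_tableau_def by (metis bij_betw_trans permutes_imp_bij)

lemma row_col_of_comp:
  assumes t: "is_tableau lam t" and p: "p permutes {1..sum_list lam}" and x: "x \<in> {1..sum_list lam}"
  shows "row_of lam (p \<circ> t) (p x) = row_of lam t x" "col_of lam (p \<circ> t) (p x) = col_of lam t x"
  using tableau_entry(2,3)[OF tableau_comp[OF t p] tableau_cell(1)[OF t x]] tableau_cell(2)[OF t x]
  by simp_all

lemma row_lt_length:
  assumes "is_tableau lam t" "x \<in> {1..sum_list lam}"
  shows "row_of lam t x < length lam"
  using tableau_cell(1)[OF assms] by (simp add: diagram_def)

lemma length_tabloid [simp]: "length (tabloid lam t) = length lam"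
  by (simp add: tabloid_def)

lemma tabloid_nth:
  assumes t: "is_tableau lam t" and i: "i < length lam"
  shows "tabloid lam t ! i = {x\<in>{1..sum_list lam}. row_of lam t x = i}"
proof -
  have "{t (i, j) |j. j < lam ! i} = {x\<in>{1..sum_list lam}. row_of lam t x = i}"
  proof (intro equalityI subsetI)
    fix x assume "x \<in> {t (i, j) |j. j < lam ! i}"
    then obtain j where "x = t (i, j)" "(i, j) \<in> diagram lam" using i by (auto simp: diagram_def)
    then show "x \<in> {x\<in>{1..sum_list lam}. row_of lam t x = i}" using tableau_entry[OF t] by simp
  next
    fix x assume x: "x \<in> {x\<in>{1..sum_list lam}. row_of lam t x = i}"
    then have "(i, col_of lam t x) \<in> diagram lam" "t (i, col_of lam t x) = x"
      using tableau_cell[OF t, of x] by auto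
    then show "x \<in> {t (i, j) |j. j < lam ! i}" by (force simp: diagram_def)
  qed
  then show ?thesis using i by (simp add: tabloid_def)
qed

lemma tabloid_eq_iff:
  assumes s: "is_tableau lam s" and t: "is_tableau lam t"
  shows "tabloid lam s = tabloid lam t \<longleftrightarrow> (\<forall>x\<in>{1..sum_list lam}. row_of lam s x = row_of lam t x)"
proof
  assume eq: "tabloid lam s = tabloid lam t"
  show "\<forall>x\<in>{1..sum_list lam}. row_of lam s x = row_of lam t x"
  proof
    fix x assume x: "x \<in> {1..sum_list lam}"
    have i: "row_of lam s x < length lam" using row_lt_length[OF s x] .
    have "x \<in> tabloid lam s ! row_of lam s x" unfolding tabloid_nth[OF s i] using x by simp
    then show "row_of lam s x = row_of lam t x" unfolding eq tabloid_nth[OF t i] by simp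
  qed
next
  assume "\<forall>x\<in>{1..sum_list lam}. row_of lam s x = row_of lam t x"
  then show "tabloid lam s = tabloid lam t"
    by (intro nth_equalityI) (auto simp: tabloid_nth[OF s] tabloid_nth[OF t])
qed

lemma tableau_transitive:
  assumes s: "is_tableau lam s" and t: "is_tableau lam t"
  obtains p where "p permutes {1..sum_list lam}" "\<And>c. c \<in> diagram lam \<Longrightarrow> s c = p (t c)"
proof -
  let ?f = "s \<circ> inv_into (diagram lam) t"
  define p where "p x = (if x \<in> {1..sum_list lam} then ?f x else x)" for x
  have "bij_betw ?f {1..sum_list lam} {1..sum_list lam}"
    using s t unfolding is_tableau_def by (intro bij_betw_trans[OF bij_betw_inv_into])
  then have "bij_betw p {1..sum_list lam} {1..sum_list lam}"
    by (subst bij_betw_cong[of _ _ ?f]) (auto simp: p_def)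
  then have p: "p permutes {1..sum_list lam}" by (rule bij_imp_permutes) (auto simp: p_def)
  have eq: "p x = ?f x" if "x \<in> {1..sum_list lam}" for x using that by (simp add: p_def)
  have "s c = p (t c)" if c: "c \<in> diagram lam" for c
    using c t bij_betw_apply[of t "diagram lam"] bij_betw_inv_into_left[of t "diagram lam"]
    unfolding is_tableau_def by (metis comp_apply eq)
  with p show ?thesis by (rule that)
qed

text \<open>A tableau is a function on all pairs with arbitrary values off the diagram, so whatever
  is built from it must be seen to depend on the cells alone.\<close>

lemma tabloid_cong:
  assumes "\<And>c. c \<in> diagram lam \<Longrightarrow> s c = t c"
  shows "tabloid lam s = tabloid lam t"
  unfolding tabloid_def setcompr_eq_image
  by (intro map_cong image_cong refl assms) (auto simp: diagram_def)

lemma column_stabilizer_cong: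
  assumes "\<And>c. c \<in> diagram lam \<Longrightarrow> s c = t c"
  shows "column_stabilizer lam s = column_stabilizer lam t"
proof -
  have "{s (i, j) |i. (i, j) \<in> diagram lam} = {t (i, j) |i. (i, j) \<in> diagram lam}" for j
    using assms by force
  then show ?thesis by (simp add: column_stabilizer_def)
qed

lemma polytabloid_cong:
  assumes "\<And>c. c \<in> diagram lam \<Longrightarrow> s c = t c"
  shows "polytabloid lam s = polytabloid lam t"
proof -
  have column: "column_stabilizer lam s = column_stabilizer lam t"
    by (rule column_stabilizer_cong) (rule assms)
  have "tabloid lam (p \<circ> s) = tabloid lam (p \<circ> t)" for p
    by (rule tabloid_cong) (use assms in simp)
  then show ?thesis unfolding polytabloid_def column by simp
qed

text \<open>A permutation that maps a finite column into itself maps it onto itself, so it is enough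
  to follow single entries.\<close>

lemma column_stabilizer_iff:
  assumes t: "is_tableau lam t"
  shows "p \<in> column_stabilizer lam t \<longleftrightarrow>
    p permutes {1..sum_list lam} \<and> (\<forall>x\<in>{1..sum_list lam}. col_of lam t (p x) = col_of lam t x)"
proof -
  have col: "{t (i, j) |i. (i, j) \<in> diagram lam} = {x\<in>{1..sum_list lam}. col_of lam t x = j}" for j
    using tableau_entry[OF t] tableau_cell[OF t] by (auto, metis)
  show ?thesis
  proof (intro iffI conjI ballI)
    assume p: "p \<in> column_stabilizer lam t"
    then show "p permutes {1..sum_list lam}" by (simp add: column_stabilizer_def)
    fix x assume "x \<in> {1..sum_list lam}"
    then have "p x \<in> p ` {x'\<in>{1..sum_list lam}. col_of lam t x' = col_of lam t x}" by simp
    also have "\<dots> = {x'\<in>{1..sum_list lam}. col_of lam t x' = col_of lam t x}"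
      using p by (simp only: column_stabilizer_def col mem_Collect_eq)
    finally show "col_of lam t (p x) = col_of lam t x" by simp
  next
    assume p: "p permutes {1..sum_list lam} \<and> (\<forall>x\<in>{1..sum_list lam}. col_of lam t (p x) = col_of lam t x)"
    have "p ` {x\<in>{1..sum_list lam}. col_of lam t x = j} = {x\<in>{1..sum_list lam}. col_of lam t x = j}" for j
    proof (rule endo_inj_surj)
      show "p ` {x\<in>{1..sum_list lam}. col_of lam t x = j} \<subseteq> {x\<in>{1..sum_list lam}. col_of lam t x = j}"
        using p permutes_in_image[of p] by fastforce
      show "inj_on p {x\<in>{1..sum_list lam}. col_of lam t x = j}"
        using p permutes_inj_on by blast
    qed simp
    then show "p \<in> column_stabilizer lam t"
      unfolding column_stabilizer_def col mem_Collect_eq using p by blast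
  qed
qed

lemma column_stabilizer_permutes: "p \<in> column_stabilizer lam t \<Longrightarrow> p permutes {1..sum_list lam}"
  by (simp add: column_stabilizer_def)

lemma finite_column_stabilizer: "finite (column_stabilizer lam t)"
  by (rule finite_subset[OF _ finite_permutations[of "{1..sum_list lam}"]])
    (auto simp: column_stabilizer_def)

lemma column_stabilizer_id: "id \<in> column_stabilizer lam t"
  by (simp add: column_stabilizer_def permutes_id)

lemma column_stabilizer_comp:
  assumes "p \<in> column_stabilizer lam t" "q \<in> column_stabilizer lam t"
  shows "p \<circ> q \<in> column_stabilizer lam t"
proof -
  have "(p \<circ> q) ` A = A" if "p ` A = A" "q ` A = A" for A using that unfolding image_comp[symmetric] by simp
  then show ?thesis
    using assms unfolding column_stabilizer_def mem_Collect_eq by (intro conjI allI permutes_compose) auto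
qed

lemma column_stabilizer_inv:
  assumes "p \<in> column_stabilizer lam t"
  shows "inv' p \<in> column_stabilizer lam t"
proof -
  have p: "p permutes {1..sum_list lam}" using assms by (rule column_stabilizer_permutes)
  have "inv' p ` A = A" if "p ` A = A" for A
    using that permutes_inj[OF p] by (metis image_inv_f_f)
  then show ?thesis using assms permutes_inv[OF p] by (simp add: column_stabilizer_def)
qed


section \<open>Comparing tableaux of two shapes by row sums\<close>

lemma sum_nat_set_ge:
  assumes "finite (R :: nat set)"
  shows "\<Sum>{..<card R} \<le> \<Sum>R" "\<Sum>R \<le> \<Sum>{..<card R} \<Longrightarrow> R = {..<card R}"
proof -
  let ?m = "card R"
  let ?I = "R \<inter> {..<?m}" and ?A = "R - {..<?m}" and ?B = "{..<?m} - R"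
  have cA: "card ?A = ?m - card ?I" by (subst card_Diff_subset_Int) (use assms in auto)
  have cB: "card ?B = ?m - card ?I" by (subst card_Diff_subset_Int) (use assms in \<open>auto simp: Int_commute\<close>)
  have R: "\<Sum>R = \<Sum>?I + \<Sum>?A" using sum.Int_Diff[OF assms] by blast
  have M: "\<Sum>{..<?m} = \<Sum>?I + \<Sum>?B" using sum.Int_Diff[of "{..<?m}"  "\<lambda>x. x" R] by (simp add: Int_commute)
  \<comment> \<open>As many elements of \<open>R\<close> lie outside the initial segment as numbers
    of the segment are missing from \<open>R\<close>. The former are at least \<open>?m\<close>, the
    latter are smaller.\<close>
  have A: "?m * card ?A \<le> \<Sum>?A" using sum_bounded_below[of ?A ?m "\<lambda>x. x"] by (simp add: mult.commute)
  have B: "\<Sum>?B \<le> ?m * card ?B" using sum_bounded_above[of ?B "\<lambda>x. x" ?m] by (simp add: mult.commute less_imp_le)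
  have AB: "?m * card ?A = ?m * card ?B" by (simp only: cA cB)
  show "\<Sum>{..<card R} \<le> \<Sum>R" using R M A B AB by linarith
  assume le: "\<Sum>R \<le> \<Sum>{..<card R}"
  have "?B = {}"
  proof (rule ccontr)
    assume "?B \<noteq> {}"
    then have "\<Sum>?B < (\<Sum>x\<in>?B. ?m)" by (intro sum_strict_mono) auto
    then have "\<Sum>?B < ?m * card ?B" by (simp add: mult.commute)
    then show False using R M A AB le by linarith
  qed
  then have "{..<?m} \<subseteq> R" by blast
  then show "R = {..<card R}" using card_subset_eq[of R "{..<?m}"] assms by simp
qed

lemma diagram_row_le:
  assumes "is_partition lam n" "(i, j) \<in> diagram lam" "i' \<le> i"
  shows "(i', j) \<in> diagram lam"
proof (cases "i' = i")
  case False
  then have "lam ! i \<le> lam ! i'"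
    using assms by (auto simp: is_partition_def diagram_def sorted_wrt_iff_nth_less)
  then show ?thesis using assms by (auto simp: diagram_def)
qed (use assms in simp)

text \<open>This statistic takes the place of the dominance order on partitions.\<close>

definition row_sum :: "nat list \<Rightarrow> nat" where
  "row_sum lam = (\<Sum>c\<in>diagram lam. fst c)"

lemma sum_row_of:
  assumes "is_tableau lam t"
  shows "(\<Sum>x\<in>{1..sum_list lam}. row_of lam t x) = row_sum lam"
proof -
  have "row_sum lam = (\<Sum>c\<in>diagram lam. row_of lam t (t c))"
    unfolding row_sum_def using tableau_entry(2)[OF assms] by (intro sum.cong) auto
  also have "\<dots> = (\<Sum>x\<in>{1..sum_list lam}. row_of lam t x)"
    using assms unfolding is_tableau_def by (rule sum.reindex_bij_betw)
  finally show ?thesis ..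
qed

lemma downset_nat_eq:
  assumes "finite R" "\<And>i i' :: nat. i \<in> R \<Longrightarrow> i' \<le> i \<Longrightarrow> i' \<in> R"
  shows "R = {..<card R}"
proof (cases "R = {}")
  case False
  have "R = {..Max R}"
    using assms(2)[OF Max_in[OF assms(1) False]] Max_ge[OF assms(1)] by auto
  then show ?thesis by (metis card_atMost lessThan_Suc_atMost)
qed simp

text \<open>
  The entries of a column of \<open>t\<close> lie in distinct rows of \<open>s\<close>, so the sum of their row indices in
  \<open>s\<close> is at least the sum \<open>0 + 1 + 2 + \<dots>\<close> of their row indices in \<open>t\<close>.
\<close>

lemma row_sum_le:
  assumes lam: "is_partition lam n" and t: "is_tableau lam t" and s: "is_tableau mu s" and mu: "sum_list mu = n"
    and inj: "inj_on (\<lambda>x. (row_of mu s x, col_of lam t x)) {1..n}"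
  shows "row_sum lam \<le> row_sum mu"
    and "row_sum mu \<le> row_sum lam \<Longrightarrow> (\<lambda>x. (row_of mu s x, col_of lam t x)) ` {1..n} = diagram lam"
proof -
  have n: "sum_list lam = n" using lam by (simp add: is_partition_def)
  define S where "S j = {x\<in>{1..n}. col_of lam t x = j}" for j
  define J where "J = col_of lam t ` {1..n}"
  have fS: "finite (S j)" for j by (simp add: S_def)
  have colrows: "row_of lam t ` S j = {i. (i, j) \<in> diagram lam}" for j
  proof (intro equalityI subsetI)
    fix i assume "i \<in> row_of lam t ` S j"
    then show "i \<in> {i. (i, j) \<in> diagram lam}" using tableau_cell(1)[OF t] by (auto simp: S_def n)
  next
    fix i assume "i \<in> {i. (i, j) \<in> diagram lam}"
    then have "t (i, j) \<in> S j" "row_of lam t (t (i, j)) = i"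
      using tableau_entry[OF t, of i j] by (auto simp: S_def n)
    then show "i \<in> row_of lam t ` S j" by force
  qed
  have injt: "inj_on (row_of lam t) (S j)" for j
    using tableau_inj_cell[OF t] by (auto simp: inj_on_def S_def n)
  have injs: "inj_on (row_of mu s) (S j)" for j
  proof (rule inj_onI)
    fix x y assume xy: "x \<in> S j" "y \<in> S j" "row_of mu s x = row_of mu s y"
    show "x = y" by (rule inj_onD[OF inj]) (use xy in \<open>auto simp: S_def\<close>)
  qed
  have ct: "row_of lam t ` S j = {..<card (S j)}" for j
  proof -
    have "row_of lam t ` S j = {..<card (row_of lam t ` S j)}"
    proof (rule downset_nat_eq)
      show "finite (row_of lam t ` S j)" using fS by simp
    qed (use diagram_row_le[OF lam] in \<open>auto simp: colrows\<close>)
    then show ?thesis by (simp add: card_image[OF injt])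
  qed
  have cs: "card (row_of mu s ` S j) = card (S j)" for j by (rule card_image[OF injs])
  have sumt: "(\<Sum>x\<in>S j. row_of lam t x) = \<Sum>{..<card (S j)}" for j
    using sum.reindex[OF injt, of "\<lambda>i. i" j] by (simp add: ct)
  have sums: "(\<Sum>x\<in>S j. row_of mu s x) = \<Sum>(row_of mu s ` S j)" for j
    using sum.reindex[OF injs, of "\<lambda>i. i" j] by simp
  have le: "(\<Sum>x\<in>S j. row_of lam t x) \<le> (\<Sum>x\<in>S j. row_of mu s x)" for j
    unfolding sumt sums using sum_nat_set_ge(1)[of "row_of mu s ` S j"] fS by (simp add: cs)
  have total_t: "row_sum lam = (\<Sum>j\<in>J. \<Sum>x\<in>S j. row_of lam t x)"
    unfolding sum_row_of[OF t, symmetric] n J_def S_def by (rule sum.image_gen) simp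
  have total_s: "row_sum mu = (\<Sum>j\<in>J. \<Sum>x\<in>S j. row_of mu s x)"
    unfolding sum_row_of[OF s, symmetric] mu J_def S_def by (rule sum.image_gen) simp
  show "row_sum lam \<le> row_sum mu" unfolding total_t total_s by (intro sum_mono le)
  assume "row_sum mu \<le> row_sum lam"
  then have eq: "(\<Sum>j\<in>J. \<Sum>x\<in>S j. row_of lam t x) = (\<Sum>j\<in>J. \<Sum>x\<in>S j. row_of mu s x)"
    unfolding total_t[symmetric] total_s[symmetric]
    using \<open>row_sum lam \<le> row_sum mu\<close> by simp
  \<comment> \<open>Equal totals force equality in every column, and there the minimal sum is
    reached only by an initial segment of rows, which is the column of \<open>lam\<close>.\<close>
  have rows: "row_of mu s ` S j = {i. (i, j) \<in> diagram lam}" for j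
  proof (cases "j \<in> J")
    case True
    have "(\<Sum>x\<in>S j. row_of lam t x) = (\<Sum>x\<in>S j. row_of mu s x)"
      by (rule sum_mono_inv[OF eq le True]) (simp add: J_def)
    then have "row_of mu s ` S j = {..<card (row_of mu s ` S j)}"
      unfolding sumt sums by (intro sum_nat_set_ge(2)) (use fS in \<open>auto simp: cs\<close>)
    then show ?thesis using ct[of j] colrows[of j] by (simp add: cs)
  next
    case False
    then have "S j = {}" by (auto simp: S_def J_def)
    then show ?thesis using colrows[of j] by simp
  qed
  show "(\<lambda>x. (row_of mu s x, col_of lam t x)) ` {1..n} = diagram lam"
  proof (intro equalityI subsetI)
    fix c assume "c \<in> (\<lambda>x. (row_of mu s x, col_of lam t x)) ` {1..n}"
    then obtain x where x: "x \<in> {1..n}" "c = (row_of mu s x, col_of lam t x)" by blast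
    then have "row_of mu s x \<in> row_of mu s ` S (col_of lam t x)" by (simp add: S_def)
    then show "c \<in> diagram lam" using x unfolding rows by simp
  next
    fix c assume "c \<in> diagram lam"
    then have "fst c \<in> row_of mu s ` S (snd c)" unfolding rows by simp
    then show "c \<in> (\<lambda>x. (row_of mu s x, col_of lam t x)) ` {1..n}"
      by (auto simp: S_def image_iff prod_eq_iff)
  qed
qed

lemma card_row:
  assumes "is_tableau lam t"
  shows "card {x\<in>{1..sum_list lam}. row_of lam t x = i} = nth_default 0 lam i"
proof -
  have "bij_betw t {c\<in>diagram lam. fst c = i} {x\<in>{1..sum_list lam}. row_of lam t x = i}"
  proof (rule bij_betw_subset[of t "diagram lam" "{1..sum_list lam}"])
    show "t ` {c \<in> diagram lam. fst c = i} = {x \<in> {1..sum_list lam}. row_of lam t x = i}"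
    proof (intro equalityI subsetI)
      fix x assume "x \<in> {x \<in> {1..sum_list lam}. row_of lam t x = i}"
      then show "x \<in> t ` {c \<in> diagram lam. fst c = i}"
        using tableau_cell[OF assms, of x] by (intro image_eqI[of _ t "(row_of lam t x, col_of lam t x)"]) auto
    qed (use tableau_entry[OF assms] in auto)
  qed (use assms in \<open>auto simp: is_tableau_def\<close>)
  then have "card {x\<in>{1..sum_list lam}. row_of lam t x = i} = card {c\<in>diagram lam. fst c = i}"
    by (simp add: bij_betw_same_card)
  also have "{c\<in>diagram lam. fst c = i} = Pair i ` {..<nth_default 0 lam i}"
    by (auto simp: diagram_def nth_default_def)
  also have "card \<dots> = nth_default 0 lam i" by (simp add: card_image inj_on_def)
  finally show ?thesis .
qed

text \<open>Without zero parts, the length of the list can be recovered from the sequence padded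
  with zeros.\<close>

lemma nth_default_0_inject:
  assumes "0 \<notin> set xs" "0 \<notin> set ys" "\<And>i. nth_default 0 xs i = nth_default (0 :: nat) ys i"
  shows "xs = ys"
proof -
  have *: "length ys \<le> length xs" if "0 \<notin> set ys" "\<And>i. nth_default 0 xs i = nth_default (0 :: nat) ys i" for xs ys
  proof (rule ccontr)
    assume "\<not> length ys \<le> length xs"
    then have "ys ! length xs = 0" using that(2)[of "length xs"] by (simp add: nth_default_def)
    then show False using that(1) \<open>\<not> length ys \<le> length xs\<close> by (metis not_le nth_mem)
  qed
  have "length xs = length ys" using *[of xs ys] *[of ys xs] assms by simp
  then show ?thesis
  proof (rule nth_equalityI)
    fix i assume "i < length xs"
    then show "xs ! i = ys ! i"
      using assms(3)[of i] \<open>length xs = length ys\<close> by (simp add: nth_default_nth)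
  qed
qed

text \<open>In the equality case the pairs of row in \<open>s\<close> and column in \<open>t\<close>
  fill the diagram of \<open>lam\<close> bijectively, so the rows of \<open>s\<close> have the
  lengths of the rows of \<open>lam\<close>.\<close>

lemma partition_eq_of_row_sum_le:
  assumes lam: "is_partition lam n" and t: "is_tableau lam t" and mu: "is_partition mu n" and s: "is_tableau mu s"
    and inj: "inj_on (\<lambda>x. (row_of mu s x, col_of lam t x)) {1..n}"
    and le: "row_sum mu \<le> row_sum lam"
  shows "lam = mu"
proof (rule nth_default_0_inject)
  have n: "sum_list lam = n" "sum_list mu = n" using lam mu by (auto simp: is_partition_def)
  let ?g = "\<lambda>x. (row_of mu s x, col_of lam t x)"
  have im: "?g ` {1..n} = diagram lam" by (rule row_sum_le(2)[OF lam t s n(2) inj le])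
  fix i
  have "nth_default 0 mu i = card {x\<in>{1..n}. row_of mu s x = i}" using card_row[OF s] n by simp
  also have "\<dots> = card (?g ` {x\<in>{1..n}. row_of mu s x = i})"
    by (rule card_image[symmetric]) (rule inj_on_subset[OF inj], auto)
  also have "?g ` {x\<in>{1..n}. row_of mu s x = i} = {c\<in>diagram lam. fst c = i}"
    unfolding im[symmetric] by auto
  also have "\<dots> = Pair i ` {..<nth_default 0 lam i}"
    by (auto simp: diagram_def nth_default_def)
  also have "card \<dots> = nth_default 0 lam i" by (simp add: card_image inj_on_def)
  finally show "nth_default 0 lam i = nth_default 0 mu i" by simp
qed (use lam mu in \<open>auto simp: is_partition_def\<close>)

text \<open>The inverse of the bijection onto the diagram is a tableau \<open>u\<close> with the
  rows of \<open>s\<close> and the columns of \<open>t\<close>. The permutation that carries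
  \<open>t\<close> to \<open>u\<close> therefore preserves the columns of \<open>t\<close>.\<close>

lemma tabloid_in_column_orbit:
  assumes lam: "is_partition lam n" and t: "is_tableau lam t" and s: "is_tableau lam s"
    and inj: "inj_on (\<lambda>x. (row_of lam s x, col_of lam t x)) {1..n}"
  obtains p where "p \<in> column_stabilizer lam t" "tabloid lam s = tabloid lam (p \<circ> t)"
proof -
  have n: "sum_list lam = n" using lam by (auto simp: is_partition_def)
  let ?g = "\<lambda>x. (row_of lam s x, col_of lam t x)"
  have im: "?g ` {1..n} = diagram lam" by (rule row_sum_le(2)[OF lam t s n inj]) simp
  define u where "u = inv_into {1..n} ?g"
  have bij: "bij_betw ?g {1..n} (diagram lam)" using inj im by (simp add: bij_betw_def)
  have u: "is_tableau lam u" unfolding is_tableau_def u_def n by (rule bij_betw_inv_into[OF bij])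
  have ux: "u (row_of lam s x, col_of lam t x) = x" "(row_of lam s x, col_of lam t x) \<in> diagram lam"
    if "x \<in> {1..n}" for x
    using bij_betw_inv_into_left[OF bij that] im that by (auto simp: u_def)
  have rc: "row_of lam u x = row_of lam s x" "col_of lam u x = col_of lam t x" if "x \<in> {1..n}" for x
    using tableau_entry(2,3)[OF u ux(2)[OF that]] ux(1)[OF that] by simp_all
  obtain p where p: "p permutes {1..sum_list lam}" "\<And>c. c \<in> diagram lam \<Longrightarrow> u c = p (t c)"
    using tableau_transitive[OF u t] by blast
  have "p \<in> column_stabilizer lam t"
    unfolding column_stabilizer_iff[OF t] n
  proof (intro conjI ballI)
    fix x assume x: "x \<in> {1..n}"
    have c: "(row_of lam t x, col_of lam t x) \<in> diagram lam" "t (row_of lam t x, col_of lam t x) = x"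
      using tableau_cell[OF t, of x] x n by auto
    have "p x = u (row_of lam t x, col_of lam t x)" using p(2)[OF c(1)] c(2) by simp
    then have "col_of lam u (p x) = col_of lam t x" using tableau_entry(3)[OF u c(1)] by simp
    moreover have "p x \<in> {1..n}" using permutes_in_image[OF p(1)] x n by simp
    ultimately show "col_of lam t (p x) = col_of lam t x" using rc(2) by simp
  qed (use p n in simp)
  moreover have "tabloid lam s = tabloid lam (p \<circ> t)"
  proof -
    have "tabloid lam s = tabloid lam u" using tabloid_eq_iff[OF s u] rc(1) n by simp
    also have "\<dots> = tabloid lam (p \<circ> t)" by (rule tabloid_cong) (simp add: p(2))
    finally show ?thesis .
  qed
  ultimately show ?thesis by (rule that)
qed

section \<open>Specht modules\<close>

lemma fun_action_lin: "lin (fun_action \<phi> p)"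
  by (auto simp: linear_map_on_def fun_action_def cscale_def fun_eq_iff)

lemma fun_action_comp:
  assumes "p permutes S" "q permutes S" "\<And>p q x. \<phi> (p \<circ> q) x = \<phi> p (\<phi> q x)"
  shows "fun_action \<phi> (p \<circ> q) f = fun_action \<phi> p (fun_action \<phi> q f)"
  using assms by (simp add: fun_action_def o_inv_distrib permutes_bij)

lemma tabloid_action_comp:
  "p permutes S \<Longrightarrow> q permutes S \<Longrightarrow> tabloid_action (p \<circ> q) f = tabloid_action p (tabloid_action q f)"
  by (rule fun_action_comp) (auto simp: image_comp)

lemma tabloid_action_unit_fun:
  assumes p: "p permutes S"
  shows "tabloid_action p (unit_fun (tabloid lam s)) = unit_fun (tabloid lam (p \<circ> s))"
proof
  fix T
  have "map ((`) (inv' p)) T = tabloid lam s \<longleftrightarrow> T = tabloid lam (p \<circ> s)"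
  proof
    assume "map ((`) (inv' p)) T = tabloid lam s"
    then have "tabloid lam (p \<circ> s) = map ((`) p) (map ((`) (inv' p)) T)" by (simp add: tabloid_comp)
    also have "\<dots> = T" using permutes_surj[OF p] by (simp add: o_def image_f_inv_f)
    finally show "T = tabloid lam (p \<circ> s)" ..
  next
    assume "T = tabloid lam (p \<circ> s)"
    then have "map ((`) (inv' p)) T = tabloid lam (inv' p \<circ> (p \<circ> s))" by (simp only: tabloid_comp)
    also have "inv' p \<circ> (p \<circ> s) = s" using permutes_inv_o(2)[OF p] by (simp add: o_assoc)
    finally show "map ((`) (inv' p)) T = tabloid lam s" .
  qed
  then show "tabloid_action p (unit_fun (tabloid lam s)) T = unit_fun (tabloid lam (p \<circ> s)) T"
    by (auto simp: fun_action_def unit_fun_def)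
qed

text \<open>The signed column sum of the classical theory, acting as an operator on all functions of
  tabloids.\<close>

definition column_antisym ::
    "nat list \<Rightarrow> (nat \<times> nat \<Rightarrow> nat) \<Rightarrow> (nat set list \<Rightarrow> complex) \<Rightarrow> nat set list \<Rightarrow> complex" where
  "column_antisym lam t f = (\<Sum>p\<in>column_stabilizer lam t. cscale (of_int (sign p)) (tabloid_action p f))"

lemma column_antisym_lin: "lin (column_antisym lam t)"
  unfolding column_antisym_def
proof (rule linear_map_on_sum_ops)
  fix p
  show "lin (\<lambda>f. cscale (of_int (sign p)) (tabloid_action p f))"
    using linear_map_onD[OF fun_action_lin[of "\<lambda>p. map ((`) p)" p]]
    by (auto simp: linear_map_on_def cfun.scale_right_distrib mult.commute)
qed

lemma column_antisym_tabloid: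
  "column_antisym lam t (unit_fun (tabloid lam t)) = polytabloid lam t"
proof
  fix T
  have "column_antisym lam t (unit_fun (tabloid lam t)) T =
     (\<Sum>p\<in>column_stabilizer lam t. cscale (of_int (sign p)) (unit_fun (tabloid lam (p \<circ> t))) T)"
    unfolding column_antisym_def sum_fun_apply
    by (intro sum.cong refl) (simp add: tabloid_action_unit_fun[OF column_stabilizer_permutes])
  then show "column_antisym lam t (unit_fun (tabloid lam t)) T = polytabloid lam t T"
    by (simp add: polytabloid_def unit_fun_def cscale_def if_distrib cong: if_cong)
qed

lemma sign_comp_column:
  assumes "p permutes {1..n}" "q permutes {1..n}"
  shows "sign (p \<circ> q) = sign p * sign (q :: nat \<Rightarrow> nat)"
  using assms by (intro sign_compose) (auto simp: permutation_permutes)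

lemma of_int_sign_sq: "of_int (sign p) * (of_int (sign p) * c) = (c :: complex)"
  by (simp add: sign_def)

text \<open>Right multiplication by \<open>q\<close> permutes the column stabilizer; the resulting
  sign squares to 1 and can be moved to the other side.\<close>

lemma column_antisym_action:
  assumes q: "q \<in> column_stabilizer lam t"
  shows "column_antisym lam t (tabloid_action q f) = cscale (of_int (sign q)) (column_antisym lam t f)"
proof -
  let ?C = "column_stabilizer lam t"
  note C = column_stabilizer_permutes
  have "column_antisym lam t f = (\<Sum>p\<in>?C. cscale (of_int (sign (p \<circ> q))) (tabloid_action (p \<circ> q) f))"
    unfolding column_antisym_def
  proof (rule sum.reindex_bij_witness[where i = "\<lambda>p. p \<circ> q" and j = "\<lambda>p. p \<circ> inv' q"])
    fix p assume p: "p \<in> ?C"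
    show "(p \<circ> inv' q) \<circ> q = p" "(p \<circ> q) \<circ> inv' q = p"
      using permutes_inv_o[OF C[OF q]] by (simp_all add: o_assoc[symmetric])
    then show "cscale (of_int (sign (p \<circ> inv' q \<circ> q))) (tabloid_action (p \<circ> inv' q \<circ> q) f)
      = cscale (of_int (sign p)) (tabloid_action p f)" by simp
    show "p \<circ> inv' q \<in> ?C" "p \<circ> q \<in> ?C"
      using p q by (auto intro: column_stabilizer_comp column_stabilizer_inv)
  qed
  also have "\<dots> = cscale (of_int (sign q)) (column_antisym lam t (tabloid_action q f))"
    unfolding column_antisym_def cfun.scale_sum_right
  proof (rule sum.cong[OF refl])
    fix p assume p: "p \<in> ?C"
    show "cscale (of_int (sign (p \<circ> q))) (tabloid_action (p \<circ> q) f)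
        = cscale (of_int (sign q)) (cscale (of_int (sign p)) (tabloid_action p (tabloid_action q f)))"
      unfolding sign_comp_column[OF C[OF p] C[OF q]] tabloid_action_comp[OF C[OF p] C[OF q]]
      by (simp add: cscale_def fun_eq_iff)
  qed
  finally have "cscale (of_int (sign q)) (column_antisym lam t f)
      = cscale (of_int (sign q)) (cscale (of_int (sign q)) (column_antisym lam t (tabloid_action q f)))"
    by (rule arg_cong)
  then show ?thesis by (simp add: cscale_def of_int_sign_sq)
qed

lemma action_column_antisym:
  assumes q: "q \<in> column_stabilizer lam t"
  shows "tabloid_action q (column_antisym lam t f) = cscale (of_int (sign q)) (column_antisym lam t f)"
proof -
  let ?C = "column_stabilizer lam t"
  note C = column_stabilizer_permutes
  have "column_antisym lam t f = (\<Sum>p\<in>?C. cscale (of_int (sign (q \<circ> p))) (tabloid_action (q \<circ> p) f))"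
    unfolding column_antisym_def
  proof (rule sum.reindex_bij_witness[where i = "\<lambda>p. q \<circ> p" and j = "\<lambda>p. inv' q \<circ> p"])
    fix p assume p: "p \<in> ?C"
    show "q \<circ> (inv' q \<circ> p) = p" "inv' q \<circ> (q \<circ> p) = p"
      using permutes_inv_o[OF C[OF q]] by (simp_all add: o_assoc)
    then show "cscale (of_int (sign (q \<circ> (inv' q \<circ> p)))) (tabloid_action (q \<circ> (inv' q \<circ> p)) f)
      = cscale (of_int (sign p)) (tabloid_action p f)" by simp
    show "inv' q \<circ> p \<in> ?C" "q \<circ> p \<in> ?C"
      using p q by (auto intro: column_stabilizer_comp column_stabilizer_inv)
  qed
  also have "\<dots> = cscale (of_int (sign q)) (tabloid_action q (column_antisym lam t f))"
    unfolding column_antisym_def lin_sum[OF fun_action_lin] cfun.scale_sum_right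
  proof (rule sum.cong[OF refl])
    fix p assume p: "p \<in> ?C"
    show "cscale (of_int (sign (q \<circ> p))) (tabloid_action (q \<circ> p) f)
        = cscale (of_int (sign q)) (tabloid_action q (cscale (of_int (sign p)) (tabloid_action p f)))"
      unfolding sign_comp_column[OF C[OF q] C[OF p]] tabloid_action_comp[OF C[OF q] C[OF p]]
        linear_map_onD(2)[OF fun_action_lin UNIV_I]
      by (simp add: cscale_def fun_eq_iff)
  qed
  finally have "cscale (of_int (sign q)) (column_antisym lam t f)
      = cscale (of_int (sign q)) (cscale (of_int (sign q)) (tabloid_action q (column_antisym lam t f)))"
    by (rule arg_cong)
  then show ?thesis by (simp add: cscale_def of_int_sign_sq)
qed

text \<open>By \<open>action_column_antisym\<close> all terms of the outer sum are equal, since the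
  two signs cancel.\<close>

lemma column_antisym_idem:
  "column_antisym lam t (column_antisym lam t f)
     = cscale (of_nat (card (column_stabilizer lam t))) (column_antisym lam t f)"
proof -
  let ?C = "column_stabilizer lam t"
  have "column_antisym lam t (column_antisym lam t f) = (\<Sum>p\<in>?C. column_antisym lam t f)"
    unfolding column_antisym_def[of _ _ "column_antisym lam t f"]
    by (intro sum.cong refl, subst action_column_antisym) (simp_all add: cscale_def of_int_sign_sq)
  also have "\<dots> = cscale (of_nat (card ?C)) (column_antisym lam t f)"
    by (simp add: fun_eq_iff cscale_def sum_fun_apply)
  finally show ?thesis .
qed

text \<open>Take two entries in one row of \<open>s\<close> and one column of \<open>t\<close>.
  Their transposition fixes the tabloid of \<open>s\<close> and lies in the column stabilizer of
  \<open>t\<close> with sign -1, so the value equals its own negative.\<close>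

lemma column_antisym_zero:
  assumes lam: "is_partition lam n" and t: "is_tableau lam t" and s: "is_tableau mu s" and mu: "sum_list mu = n"
    and not_inj: "\<not> inj_on (\<lambda>x. (row_of mu s x, col_of lam t x)) {1..n}"
  shows "column_antisym lam t (unit_fun (tabloid mu s)) = 0"
proof -
  have n: "sum_list lam = n" using lam by (simp add: is_partition_def)
  obtain a b where ab: "a \<in> {1..n}" "b \<in> {1..n}" "a \<noteq> b" "row_of mu s a = row_of mu s b"
    "col_of lam t a = col_of lam t b"
    using not_inj unfolding inj_on_def by auto
  define q where "q = transpose a b"
  have q: "q permutes {1..n}" unfolding q_def using ab by (intro permutes_swap_id)
  have qx: "q x = x \<or> q x = a \<and> x = b \<or> q x = b \<and> x = a" for x by (auto simp: q_def transpose_def)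
  have qC: "q \<in> column_stabilizer lam t"
    unfolding column_stabilizer_iff[OF t] n using q qx ab(5) by metis
  have "is_tableau mu (q \<circ> s)" by (rule tableau_comp[OF s]) (use q mu in simp)
  moreover have "row_of mu (q \<circ> s) x = row_of mu s x" if "x \<in> {1..n}" for x
  proof -
    have "q x \<in> {1..n}" using permutes_in_image[OF q] that by simp
    then have "row_of mu (q \<circ> s) (q (q x)) = row_of mu s (q x)"
      using row_col_of_comp(1)[OF s] q mu by simp
    moreover have "q (q x) = x" by (simp add: q_def)
    moreover have "row_of mu s (q x) = row_of mu s x" using qx[of x] ab(4) by auto
    ultimately show ?thesis by simp
  qed
  ultimately have "tabloid mu (q \<circ> s) = tabloid mu s"
    using tabloid_eq_iff[of mu "q \<circ> s" s] s mu by simp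
  then have "tabloid_action q (unit_fun (tabloid mu s)) = unit_fun (tabloid mu s)"
    by (simp add: tabloid_action_unit_fun[OF q])
  then have "column_antisym lam t (unit_fun (tabloid mu s))
      = cscale (of_int (sign q)) (column_antisym lam t (unit_fun (tabloid mu s)))"
    using column_antisym_action[OF qC] by metis
  moreover have "sign q = -1" using ab(3) by (simp add: q_def sign_swap_id)
  ultimately show ?thesis by (auto simp: cscale_def fun_eq_iff)
qed

definition tabloid_module :: "nat list \<Rightarrow> (nat set list \<Rightarrow> complex) set" where
  "tabloid_module lam = cfun.span {unit_fun (tabloid lam s) |s. is_tableau lam s}"

lemma polytabloid_in_tabloid_module:
  assumes "is_tableau lam t"
  shows "polytabloid lam t \<in> tabloid_module lam"
  unfolding column_antisym_tabloid[symmetric] column_antisym_def tabloid_module_def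
proof (intro cfun.span_sum cfun.span_scale cfun.span_base)
  fix p assume p: "p \<in> column_stabilizer lam t"
  have "tabloid_action p (unit_fun (tabloid lam t)) = unit_fun (tabloid lam (p \<circ> t))"
    by (rule tabloid_action_unit_fun[OF column_stabilizer_permutes[OF p]])
  moreover have "is_tableau lam (p \<circ> t)"
    using tableau_comp[OF assms column_stabilizer_permutes[OF p]] .
  ultimately show "tabloid_action p (unit_fun (tabloid lam t)) \<in> {unit_fun (tabloid lam s) |s. is_tableau lam s}"
    by blast
qed

lemma specht_subset_tabloid_module: "specht lam \<subseteq> tabloid_module lam"
  unfolding specht_def
  by (rule cfun.span_minimal) (auto simp: polytabloid_in_tabloid_module, simp add: tabloid_module_def)

text \<open>For a single tabloid of \<open>s\<close> there are two cases. If a row of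
  \<open>s\<close> meets a column of \<open>t\<close> twice, the result is 0; otherwise the tabloid
  lies in the column orbit of \<open>t\<close>, and the result is the polytabloid up to
  sign.\<close>

lemma column_antisym_tabloid_module_multiple:
  assumes lam: "is_partition lam n" and t: "is_tableau lam t" and f: "f \<in> tabloid_module lam"
  shows "\<exists>c. column_antisym lam t f = cscale c (polytabloid lam t)"
  using f unfolding tabloid_module_def
proof (induction rule: cfun.span_induct_alt)
  case base
  have "column_antisym lam t 0 = cscale 0 (polytabloid lam t)"
    using linear_map_on_0[OF column_antisym_lin, of lam t] by simp
  then show ?case ..
next
  case (step c x y)
  have n: "sum_list lam = n" using lam by (simp add: is_partition_def)
  obtain s where s: "is_tableau lam s" "x = unit_fun (tabloid lam s)" using step.hyps by blast
  obtain d where d: "column_antisym lam t y = cscale d (polytabloid lam t)" using step.IH by blast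
  have "\<exists>e. column_antisym lam t x = cscale e (polytabloid lam t)"
  proof (cases "inj_on (\<lambda>x. (row_of lam s x, col_of lam t x)) {1..n}")
    case True
    obtain p where p: "p \<in> column_stabilizer lam t" "tabloid lam s = tabloid lam (p \<circ> t)"
      using tabloid_in_column_orbit[OF lam t s(1) True] .
    have "x = tabloid_action p (unit_fun (tabloid lam t))"
      unfolding s(2) p(2) by (rule tabloid_action_unit_fun[symmetric, OF column_stabilizer_permutes[OF p(1)]])
    then show ?thesis by (auto simp: column_antisym_action[OF p(1)] column_antisym_tabloid)
  next
    case False
    then have "column_antisym lam t x = cscale 0 (polytabloid lam t)"
      unfolding s(2) using column_antisym_zero[OF lam t s(1) n] by simp
    then show ?thesis ..
  qed
  then obtain e where e: "column_antisym lam t x = cscale e (polytabloid lam t)" ..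
  have "column_antisym lam t (cscale c x + y) = cscale c (column_antisym lam t x) + column_antisym lam t y"
    using linear_map_onD[OF column_antisym_lin] by simp
  also have "\<dots> = cscale (c * e + d) (polytabloid lam t)"
    unfolding d e by (simp add: cscale_def fun_eq_iff algebra_simps)
  finally show ?case ..
qed

text \<open>If the antisymmetrizer does not kill \<open>f\<close>, some tabloid of shape
  \<open>mu\<close> survives it. The rows of that tabloid meet each column of \<open>t\<close> at
  most once, so the row sums can be compared.\<close>

lemma column_antisym_nonzero_row_sum:
  assumes lam: "is_partition lam n" and t: "is_tableau lam t" and mu: "is_partition mu n"
    and f: "f \<in> tabloid_module mu" "column_antisym lam t f \<noteq> 0"
  shows "row_sum lam \<le> row_sum mu \<and> (row_sum mu \<le> row_sum lam \<longrightarrow> lam = mu)"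
proof -
  have n: "sum_list mu = n" using mu by (simp add: is_partition_def)
  have "\<exists>s. is_tableau mu s \<and> column_antisym lam t (unit_fun (tabloid mu s)) \<noteq> 0"
  proof (rule ccontr)
    assume *: "\<not> ?thesis"
    have "column_antisym lam t f = 0"
      using f(1) unfolding tabloid_module_def
    proof (induction rule: cfun.span_induct_alt)
      case base
      show ?case by (rule linear_map_on_0[OF column_antisym_lin cfun.subspace_UNIV])
    next
      case (step c x y)
      then have "column_antisym lam t x = 0" using * by blast
      then have "column_antisym lam t (cscale c x + y) = cscale c 0 + 0"
        using step.IH linear_map_onD[OF column_antisym_lin[of lam t]] by (simp only: UNIV_I)
      also have "\<dots> = (0 :: nat set list \<Rightarrow> complex)" by simp
      finally show ?case .
    qed
    then show False using f(2) by contradiction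
  qed
  then obtain s where s: "is_tableau mu s" "column_antisym lam t (unit_fun (tabloid mu s)) \<noteq> 0" by blast
  then have inj: "inj_on (\<lambda>x. (row_of mu s x, col_of lam t x)) {1..n}"
    using column_antisym_zero[OF lam t s(1) n] by blast
  show ?thesis
    using row_sum_le(1)[OF lam t s(1) n inj] partition_eq_of_row_sum_le[OF lam t mu s(1) inj] by blast
qed

text \<open>A column permutation that also keeps every entry in its row is the identity, so just one
  term contributes.\<close>

lemma polytabloid_at_self:
  assumes t: "is_tableau lam t"
  shows "polytabloid lam t (tabloid lam t) = 1"
proof -
  have id: "p = id" if p: "p \<in> column_stabilizer lam t" "tabloid lam t = tabloid lam (p \<circ> t)" for p
  proof
    fix x
    have pp: "p permutes {1..sum_list lam}" using column_stabilizer_permutes[OF p(1)] .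
    show "p x = id x"
    proof (cases "x \<in> {1..sum_list lam}")
      case True
      have px: "p x \<in> {1..sum_list lam}" using permutes_in_image[OF pp] True by simp
      have "row_of lam t (p x) = row_of lam (p \<circ> t) (p x)"
        using tabloid_eq_iff[OF t tableau_comp[OF t pp]] p(2) px by simp
      also have "\<dots> = row_of lam t x" by (rule row_col_of_comp(1)[OF t pp True])
      finally have "row_of lam t (p x) = row_of lam t x" .
      moreover have "col_of lam t (p x) = col_of lam t x"
        using p(1) True column_stabilizer_iff[OF t] by simp
      ultimately show ?thesis using tableau_inj_cell[OF t px True] by simp
    qed (use permutes_not_in[OF pp] in simp)
  qed
  have "polytabloid lam t (tabloid lam t) = (\<Sum>p\<in>column_stabilizer lam t. if p = id then 1 else 0)"
    unfolding polytabloid_def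
  proof (rule sum.cong[OF refl])
    fix p assume "p \<in> column_stabilizer lam t"
    then show "(if tabloid lam t = tabloid lam (p \<circ> t) then of_int (sign p) else 0) = (if p = id then 1 else 0 :: complex)"
      using id[of p] by (auto simp: sign_id)
  qed
  also have "\<dots> = 1" using column_stabilizer_id finite_column_stabilizer by (simp add: sum.delta)
  finally show ?thesis .
qed

section \<open>Irreducibility, endomorphisms and distinctness of Specht modules\<close>

lemma polytabloid_in_specht: "is_tableau lam t \<Longrightarrow> polytabloid lam t \<in> specht lam"
  unfolding specht_def by (rule cfun.span_base) blast

lemma subspace_specht: "cfun.subspace (specht lam)"
  by (simp add: specht_def)

lemma specht_neq_0: "specht lam \<noteq> {0}"
proof
  assume *: "specht lam = {0}"
  obtain t where t: "is_tableau lam t" using tableau_exists by blast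
  then have "polytabloid lam t = 0" using * polytabloid_in_specht by blast
  then show False using polytabloid_at_self[OF t] by simp
qed

definition tabloid_space :: "nat \<Rightarrow> nat list \<Rightarrow> nat set list set" where
  "tabloid_space n lam = {T. set T \<subseteq> Pow {1..n} \<and> length T = length lam}"

lemma finite_tabloid_space: "finite (tabloid_space n lam)"
  unfolding tabloid_space_def by (rule finite_lists_length_eq) simp

lemma tabloid_in_space:
  assumes "is_tableau lam t" "sum_list lam = n"
  shows "tabloid lam t \<in> tabloid_space n lam"
  using bij_betwE[OF assms(1)[unfolded is_tableau_def]] assms(2)
  by (fastforce simp: tabloid_def diagram_def tabloid_space_def)

lemma specht_supported:
  assumes "sum_list lam = n"
  shows "specht lam \<subseteq> supported (tabloid_space n lam)"
proof -
  have "tabloid_module lam \<subseteq> supported (tabloid_space n lam)"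
    unfolding tabloid_module_def
  proof (rule cfun.span_minimal[OF _ subspace_supported], safe)
    fix s assume "is_tableau lam s"
    then show "unit_fun (tabloid lam s) \<in> supported (tabloid_space n lam)"
      using tabloid_in_space[of lam s n] assms by (auto simp: supported_def unit_fun_def)
  qed
  then show ?thesis using specht_subset_tabloid_module by blast
qed

text \<open>The polytabloids form one orbit, so any one of them generates the Specht module, and an
  intertwiner on it is determined by a single value.\<close>

lemma polytabloid_orbit:
  assumes "is_tableau lam s" "is_tableau lam t"
  obtains q where "q permutes {1..sum_list lam}" "polytabloid lam s = tabloid_action q (polytabloid lam t)"
proof -
  obtain q where q: "q permutes {1..sum_list lam}" "\<And>c. c \<in> diagram lam \<Longrightarrow> s c = q (t c)"
    using tableau_transitive[OF assms] by blast
  have "polytabloid lam s = polytabloid lam (q \<circ> t)"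
    by (rule polytabloid_cong) (simp add: q(2))
  then have "polytabloid lam s = tabloid_action q (polytabloid lam t)"
    by (simp only: action_polytabloid[OF q(1)])
  with q(1) show ?thesis by (rule that)
qed

text \<open>The antisymmetrizer is self-adjoint for the bilinear form \<open>\<Sum>\<^sub>T f T g T\<close>.\<close>

lemma column_antisym_at_tabloid:
  assumes t: "is_tableau lam t" and n: "sum_list lam = n"
  shows "column_antisym lam t w (tabloid lam t) = (\<Sum>T\<in>tabloid_space n lam. w T * polytabloid lam t T)"
proof -
  let ?C = "column_stabilizer lam t"
  note C = column_stabilizer_permutes
  have "(\<Sum>T\<in>tabloid_space n lam. w T * polytabloid lam t T)
     = (\<Sum>p\<in>?C. \<Sum>T\<in>tabloid_space n lam. if T = tabloid lam (p \<circ> t) then w T * of_int (sign p) else 0)"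
    unfolding polytabloid_def sum_distrib_left
    by (subst sum.swap) (intro sum.cong refl, simp)
  also have "\<dots> = (\<Sum>p\<in>?C. w (tabloid lam (p \<circ> t)) * of_int (sign p))"
  proof (rule sum.cong[OF refl])
    fix p assume p: "p \<in> ?C"
    have "tabloid lam (p \<circ> t) \<in> tabloid_space n lam"
      by (rule tabloid_in_space[OF tableau_comp[OF t C[OF p]] n])
    then show "(\<Sum>T\<in>tabloid_space n lam. if T = tabloid lam (p \<circ> t) then w T * of_int (sign p) else 0)
      = w (tabloid lam (p \<circ> t)) * of_int (sign p)"
      using finite_tabloid_space by (simp add: sum.delta)
  qed
  also have "\<dots> = (\<Sum>p\<in>?C. of_int (sign p) * w (tabloid lam (inv' p \<circ> t)))"
  proof (rule sum.reindex_bij_witness[where i = inv' and j = inv'])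
    fix p assume p: "p \<in> ?C"
    show "inv' (inv' p) = p" using permutes_inv_inv[OF C[OF p]] .
    then show "inv' (inv' p) = p" .
    show "inv' p \<in> ?C" using column_stabilizer_inv[OF p] .
    then show "inv' p \<in> ?C" .
    have "sign (inv' p) = sign p" using C[OF p] by (intro sign_inverse) (auto simp: permutation_permutes)
    then show "of_int (sign (inv' p)) * w (tabloid lam (inv' (inv' p) \<circ> t)) = w (tabloid lam (p \<circ> t)) * of_int (sign p)"
      using permutes_inv_inv[OF C[OF p]] by (simp add: mult.commute)
  qed
  also have "\<dots> = column_antisym lam t w (tabloid lam t)"
    by (simp add: column_antisym_def sum_fun_apply cscale_def fun_action_def tabloid_comp)
  finally show ?thesis ..
qed

lemma column_antisym_in_subrep:
  assumes "cfun.subspace W" "\<And>g. g permutes {1..sum_list lam} \<Longrightarrow> tabloid_action g ` W \<subseteq> W" "w \<in> W"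
  shows "column_antisym lam t w \<in> W"
  unfolding column_antisym_def
  using assms column_stabilizer_permutes
  by (intro cfun.subspace_sum cfun.subspace_scale) blast+

text \<open>James' submodule argument. If some antisymmetrizer is nonzero on \<open>W\<close>, then
  \<open>W\<close> contains a multiple of a polytabloid and hence all of them. Otherwise
  \<open>W\<close> is orthogonal to all polytabloids, hence to the Specht module that contains
  it.\<close>

theorem irreducible_specht:
  assumes lam: "is_partition lam n"
  shows "irreducible_rep (sym_group n) tabloid_action (specht lam)"
  unfolding irreducible_rep_def
proof (intro conjI allI impI)
  have n: "sum_list lam = n" using lam by (simp add: is_partition_def)
  show "group_rep (sym_group n) tabloid_action (specht lam)" by (rule group_rep_specht[OF lam])
  show "specht lam \<noteq> {0}" by (rule specht_neq_0)
  fix W assume "W \<subseteq> specht lam \<and> cfun.subspace W \<and> (\<forall>g\<in>carrier (sym_group n). tabloid_action g ` W \<subseteq> W)"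
  then have WS: "W \<subseteq> specht lam" and W: "cfun.subspace W"
    and gW: "\<And>g. g permutes {1..sum_list lam} \<Longrightarrow> tabloid_action g ` W \<subseteq> W"
    by (auto simp: sym_group_carrier n)
  show "W = {0} \<or> W = specht lam"
  proof (cases "\<exists>t w. is_tableau lam t \<and> w \<in> W \<and> column_antisym lam t w \<noteq> 0")
    case True
    then obtain t w where t: "is_tableau lam t" and w: "w \<in> W" "column_antisym lam t w \<noteq> 0" by blast
    have "w \<in> tabloid_module lam" using w(1) WS specht_subset_tabloid_module by blast
    then obtain c where c: "column_antisym lam t w = cscale c (polytabloid lam t)"
      using column_antisym_tabloid_module_multiple[OF lam t] by blast
    have "c \<noteq> 0" using c w(2) by auto
    have "cscale c (polytabloid lam t) \<in> W" using column_antisym_in_subrep[OF W gW w(1), of lam t] c by simp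
    then have "cscale (1 / c) (cscale c (polytabloid lam t)) \<in> W" by (rule cfun.subspace_scale[OF W])
    then have tW: "polytabloid lam t \<in> W" using \<open>c \<noteq> 0\<close> by (simp add: cscale_def)
    have "polytabloid lam s \<in> W" if "is_tableau lam s" for s
      using polytabloid_orbit[OF that t] gW tW by (metis image_subset_iff)
    then have "specht lam \<subseteq> W" unfolding specht_def by (intro cfun.span_minimal W) blast
    then show ?thesis using WS by blast
  next
    case False
    have "w = 0" if w: "w \<in> W" for w
    proof
      fix T
      let ?Y = "tabloid_space n lam"
      \<comment> \<open>The bilinear form is not definite over the complex numbers. Polytabloids
        have real coefficients, so orthogonality passes to the Hermitian form by
        conjugation.\<close>
      have poly: "(\<Sum>T\<in>?Y. cnj (w T) * polytabloid lam t T) = 0" if t: "is_tableau lam t" for t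
      proof -
        have "column_antisym lam t w = 0" using False t w by blast
        then have "(\<Sum>T\<in>?Y. w T * polytabloid lam t T) = 0"
          using column_antisym_at_tabloid[OF t n, of w] by simp
        then have "cnj (\<Sum>T\<in>?Y. w T * polytabloid lam t T) = 0" by simp
        moreover have "cnj (polytabloid lam t T) = polytabloid lam t T" for T
          by (auto simp: polytabloid_def cnj_sum intro!: sum.cong)
        ultimately show ?thesis by (simp add: cnj_sum)
      qed
      have orth: "(\<Sum>T\<in>?Y. cnj (w T) * u T) = 0" if "u \<in> specht lam" for u
        using that unfolding specht_def
      proof (induction rule: cfun.span_induct_alt)
        case (step c x y)
        then have "(\<Sum>T\<in>?Y. cnj (w T) * x T) = 0" using poly by blast
        moreover have "(\<Sum>T\<in>?Y. cnj (w T) * (cscale c x + y) T)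
          = c * (\<Sum>T\<in>?Y. cnj (w T) * x T) + (\<Sum>T\<in>?Y. cnj (w T) * y T)"
          by (simp add: cscale_def sum.distrib sum_distrib_left algebra_simps)
        ultimately show ?case using step.IH by simp
      qed simp
      \<comment> \<open>Since \<open>w\<close> itself lies in the Specht module, it is orthogonal to
        itself.\<close>
      have "(\<Sum>T\<in>?Y. of_real ((cmod (w T))\<^sup>2)) = (0 :: complex)"
        unfolding complex_norm_square using orth[of w] w WS by (auto simp: mult.commute)
      then have "(\<Sum>T\<in>?Y. (cmod (w T))\<^sup>2) = 0" by (metis of_real_sum of_real_eq_0_iff)
      then have "\<forall>T\<in>?Y. (cmod (w T))\<^sup>2 = 0"
        using finite_tabloid_space by (subst (asm) sum_nonneg_eq_0_iff) auto
      moreover have "w T = 0" if "T \<notin> ?Y"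
        using specht_supported[OF n] w WS that by (auto simp: supported_def subset_iff)
      ultimately show "w T = 0 T" by (cases "T \<in> ?Y") auto
    qed
    then show ?thesis using cfun.subspace_0[OF W] by auto
  qed
qed

lemma column_antisym_intertwiner:
  assumes lam: "is_partition lam n" and T: "intertwiner (sym_group n) tabloid_action (specht lam) tabloid_action W T"
    and W: "group_rep (sym_group n) tabloid_action W" and f: "f \<in> specht lam"
  shows "T (column_antisym lam t f) = column_antisym lam t (T f)"
proof -
  have n: "sum_list lam = n" using lam by (simp add: is_partition_def)
  note S = group_repD[OF group_rep_specht[OF lam]]
  have lin: "linear_map_on (specht lam) T" using T by (simp add: intertwiner_def)
  have g: "tabloid_action p f \<in> specht lam" "T (tabloid_action p f) = tabloid_action p (T f)"
    if "p \<in> column_stabilizer lam t" for p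
    using column_stabilizer_permutes[OF that] S(4) f T by (auto simp: n sym_group_carrier intertwiner_def)
  show ?thesis unfolding column_antisym_def
    by (subst linear_map_on_sum[OF lin S(1)])
      (auto intro!: sum.cong cfun.subspace_scale[OF S(1)] simp: g linear_map_onD(2)[OF lin])
qed

text \<open>\<open>T\<close> commutes with the antisymmetrizer, and a polytabloid is an eigenvector
  of it whose eigenvalue is the order of the column stabilizer.\<close>

lemma intertwiner_polytabloid:
  assumes lam: "is_partition lam n" and T: "intertwiner (sym_group n) tabloid_action (specht lam) tabloid_action W T"
    and W: "group_rep (sym_group n) tabloid_action W" and t: "is_tableau lam t"
  shows "column_antisym lam t (T (polytabloid lam t))
    = cscale (of_nat (card (column_stabilizer lam t))) (T (polytabloid lam t))"
proof -
  have lin: "linear_map_on (specht lam) T" using T by (simp add: intertwiner_def)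
  note e = polytabloid_in_specht[OF t]
  have "column_antisym lam t (T (polytabloid lam t)) = T (column_antisym lam t (polytabloid lam t))"
    by (rule column_antisym_intertwiner[OF lam T W e, symmetric])
  also have "\<dots> = T (cscale (of_nat (card (column_stabilizer lam t))) (polytabloid lam t))"
    using column_antisym_idem[of lam t "unit_fun (tabloid lam t)"] by (simp add: column_antisym_tabloid)
  also have "\<dots> = cscale (of_nat (card (column_stabilizer lam t))) (T (polytabloid lam t))"
    by (rule linear_map_onD(2)[OF lin e])
  finally show ?thesis .
qed

lemma card_column_stabilizer_pos: "card (column_stabilizer lam t) > 0"
  using column_stabilizer_id[of lam t] finite_column_stabilizer[of lam t] by (auto simp: card_gt_0_iff)

text \<open>The antisymmetrizer multiplies \<open>T (polytabloid lam t)\<close> by a nonzero number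
  and sends it to a multiple of \<open>polytabloid lam t\<close>. So \<open>T\<close> scales this
  vector, and equivariance carries the same scalar to all other polytabloids.\<close>

theorem scalar_endomorphisms_specht:
  assumes lam: "is_partition lam n"
  shows "scalar_endomorphisms (sym_group n) tabloid_action (specht lam)"
  unfolding scalar_endomorphisms_def
proof (intro allI impI)
  fix T assume T: "intertwiner (sym_group n) tabloid_action (specht lam) tabloid_action (specht lam) T"
  have n: "sum_list lam = n" using lam by (simp add: is_partition_def)
  note S = group_rep_specht[OF lam]
  have lin: "linear_map_on (specht lam) T" using T by (simp add: intertwiner_def)
  obtain t where t: "is_tableau lam t" using tableau_exists by blast
  note e = polytabloid_in_specht[OF t]
  let ?N = "of_nat (card (column_stabilizer lam t)) :: complex"
  have "T (polytabloid lam t) \<in> tabloid_module lam"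
    using T e specht_subset_tabloid_module by (auto simp: intertwiner_def)
  then obtain c where "column_antisym lam t (T (polytabloid lam t)) = cscale c (polytabloid lam t)"
    using column_antisym_tabloid_module_multiple[OF lam t] by blast
  then have "cscale (1 / ?N) (cscale ?N (T (polytabloid lam t))) = cscale (1 / ?N) (cscale c (polytabloid lam t))"
    using intertwiner_polytabloid[OF lam T S t] by simp
  then have Tt: "T (polytabloid lam t) = cscale (c / ?N) (polytabloid lam t)"
    using card_column_stabilizer_pos[of lam t] by (simp add: cscale_def)
  have Ts: "T (polytabloid lam s) = cscale (c / ?N) (polytabloid lam s)" if s: "is_tableau lam s" for s
  proof -
    obtain q where q: "q permutes {1..sum_list lam}" "polytabloid lam s = tabloid_action q (polytabloid lam t)"
      using polytabloid_orbit[OF s t] .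
    have "T (polytabloid lam s) = tabloid_action q (T (polytabloid lam t))"
      using T q e unfolding intertwiner_def by (simp add: n sym_group_carrier)
    also have "\<dots> = cscale (c / ?N) (tabloid_action q (polytabloid lam t))"
      unfolding Tt by (rule linear_map_onD(2)[OF fun_action_lin UNIV_I])
    finally show ?thesis by (simp only: q(2))
  qed
  \<comment> \<open>Membership is carried along in the induction because \<open>T\<close> is known
    to be linear only on the Specht module.\<close>
  have "v \<in> specht lam \<and> T v = cscale (c / ?N) v" if "v \<in> specht lam" for v
    using that unfolding specht_def
  proof (induction rule: cfun.span_induct_alt)
    case base
    have "T 0 = cscale (c / ?N) 0" using linear_map_on_0[OF lin subspace_specht] by simp
    then show ?case by (rule conjI[OF cfun.span_zero])
  next
    case (step b x y)
    then obtain s where s: "is_tableau lam s" "x = polytabloid lam s" by blast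
    note x = polytabloid_in_specht[OF s(1), folded s(2)]
    have y: "y \<in> specht lam" using step.IH by (simp add: specht_def)
    have bx: "cscale b x \<in> specht lam" using x by (rule cfun.subspace_scale[OF subspace_specht])
    have "T (cscale b x + y) = cscale b (T x) + T y"
      using linear_map_onD(1)[OF lin bx y] linear_map_onD(2)[OF lin x] by simp
    also have "\<dots> = cscale (c / ?N) (cscale b x + y)"
      unfolding Ts[OF s(1), folded s(2)] using conjunct2[OF step.IH] by (simp add: cscale_def fun_eq_iff algebra_simps add_divide_distrib)
    finally show ?case
      by (rule conjI[OF cfun.subspace_add[OF subspace_specht bx y, unfolded specht_def]])
  qed
  then show "\<exists>c. \<forall>v\<in>specht lam. T v = cscale c v" by blast
qed

text \<open>The image of a polytabloid is nonzero and is multiplied by a nonzero number, so the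
  antisymmetrizer of shape \<open>lam\<close> does not vanish on the tabloid module of shape
  \<open>mu\<close>.\<close>

lemma isomorphic_specht_row_sum:
  assumes lam: "is_partition lam n" and mu: "is_partition mu n"
    and iso: "isomorphic_reps (sym_group n) tabloid_action (specht lam) tabloid_action (specht mu)"
  shows "row_sum lam \<le> row_sum mu \<and> (row_sum mu \<le> row_sum lam \<longrightarrow> lam = mu)"
proof -
  obtain T where T: "linear_map_on (specht lam) T" "bij_betw T (specht lam) (specht mu)"
    "\<forall>g\<in>carrier (sym_group n). \<forall>v\<in>specht lam. T (tabloid_action g v) = tabloid_action g (T v)"
    using iso unfolding isomorphic_reps_def by blast
  then have inter: "intertwiner (sym_group n) tabloid_action (specht lam) tabloid_action (specht mu) T"
    by (auto simp: intertwiner_def dest: bij_betwE)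
  obtain t where t: "is_tableau lam t" using tableau_exists by blast
  note e = polytabloid_in_specht[OF t]
  have "polytabloid lam t \<noteq> 0" using polytabloid_at_self[OF t] by auto
  then have "T (polytabloid lam t) \<noteq> 0"
    using linear_map_on_0[OF T(1) subspace_specht] T(2) e cfun.subspace_0[OF subspace_specht]
    by (metis bij_betw_def inj_onD)
  then have "column_antisym lam t (T (polytabloid lam t)) \<noteq> 0"
    unfolding intertwiner_polytabloid[OF lam inter group_rep_specht[OF mu] t]
    using card_column_stabilizer_pos[of lam t] by (simp add: cfun.scale_eq_0_iff)
  moreover have "T (polytabloid lam t) \<in> tabloid_module mu"
    using inter e specht_subset_tabloid_module by (auto simp: intertwiner_def)
  ultimately show ?thesis using column_antisym_nonzero_row_sum[OF lam t mu] by blast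
qed

lemma isomorphic_specht_imp_eq:
  assumes "is_partition lam n" "is_partition mu n"
    and "isomorphic_reps (sym_group n) tabloid_action (specht lam) tabloid_action (specht mu)"
    and "isomorphic_reps (sym_group n) tabloid_action (specht mu) tabloid_action (specht lam)"
  shows "lam = mu"
  using isomorphic_specht_row_sum[OF assms(1,2,3)] isomorphic_specht_row_sum[OF assms(2,1,4)] by blast

section \<open>Fixed vectors of Young subgroups\<close>

definition fixed_space ::
    "('g, 'm) monoid_scheme \<Rightarrow> ('g \<Rightarrow> ('x \<Rightarrow> complex) \<Rightarrow> ('x \<Rightarrow> complex)) \<Rightarrow> ('x \<Rightarrow> complex) set \<Rightarrow>
     ('x \<Rightarrow> complex) set" where
  "fixed_space G \<rho> V = {v\<in>V. \<forall>g\<in>carrier G. \<rho> g v = v}"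

lemma subspace_fixed_space:
  assumes "group_rep G \<rho> V"
  shows "cfun.subspace (fixed_space G \<rho> V)"
proof (rule cfun.subspaceI)
  note Vd = group_repD[OF assms]
  show "0 \<in> fixed_space G \<rho> V"
    using cfun.subspace_0[OF Vd(1)] linear_map_on_0[OF Vd(2) Vd(1)] unfolding fixed_space_def by blast
  show "x + y \<in> fixed_space G \<rho> V" if "x \<in> fixed_space G \<rho> V" "y \<in> fixed_space G \<rho> V" for x y
    using that cfun.subspace_add[OF Vd(1)] linear_map_onD(1)[OF Vd(2)] by (auto simp: fixed_space_def)
  show "cscale c x \<in> fixed_space G \<rho> V" if "x \<in> fixed_space G \<rho> V" for c x
    using that cfun.subspace_scale[OF Vd(1)] linear_map_onD(2)[OF Vd(2)] by (auto simp: fixed_space_def)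
qed

lemma orbit_sum_fixed:
  assumes G: "group G" and V: "group_rep G \<rho> V" and v: "v \<in> V"
  shows "(\<Sum>g\<in>carrier G. \<rho> g v) \<in> fixed_space G \<rho> V"
proof -
  note Vd = group_repD[OF V]
  have "\<rho> h (\<Sum>g\<in>carrier G. \<rho> g v) = (\<Sum>g\<in>carrier G. \<rho> g v)" if h: "h \<in> carrier G" for h
  proof -
    have "\<rho> h (\<Sum>g\<in>carrier G. \<rho> g v) = (\<Sum>g\<in>carrier G. \<rho> h (\<rho> g v))"
      using Vd(4) v by (intro linear_map_on_sum[OF Vd(2)[OF h] Vd(1)])
    also have "\<dots> = (\<Sum>g\<in>carrier G. \<rho> (h \<otimes>\<^bsub>G\<^esub> g) v)"
      using Vd(6)[OF h] v by (intro sum.cong) auto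
    also have "\<dots> = (\<Sum>g\<in>carrier G. \<rho> g v)"
      by (rule sum_group_left_mult[OF G h])
    finally show ?thesis .
  qed
  moreover have "(\<Sum>g\<in>carrier G. \<rho> g v) \<in> V"
    using Vd(4) v by (intro cfun.subspace_sum[OF Vd(1)])
  ultimately show ?thesis by (simp add: fixed_space_def)
qed

text \<open>The average of the group operators is a projection onto the fixed vectors, and the trace
  of a projection is the dimension of its image.\<close>

lemma sum_char_on:
  assumes G: "group G" "finite (carrier G)" and V: "group_rep G \<rho> V" and X: "finite X" "V \<subseteq> supported X"
  shows "(\<Sum>g\<in>carrier G. char_on X \<rho> V g) = of_nat (card (carrier G)) * of_nat (cfun.dim (fixed_space G \<rho> V))"
proof -
  interpret group G by fact
  note Vd = group_repD[OF V]
  note P = is_projection_projection[OF Vd(1)]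
  note Pd = is_projectionD[OF P]
  let ?N = "of_nat (card (carrier G)) :: complex"
  have N: "?N \<noteq> 0" using G(2) one_closed by (auto simp: card_eq_0_iff)
  let ?S = "\<lambda>f. \<Sum>g\<in>carrier G. (\<rho> g \<circ> projection V) f"
  have linS: "lin ?S"
    by (rule linear_map_on_sum_ops) (rule lin_compose_projection[OF Vd(2) P])
  have "is_projection (fixed_space G \<rho> V) (\<lambda>f. cscale (1 / ?N) (?S f))"
    unfolding is_projection_def
  proof (intro conjI ballI)
    show "lin (\<lambda>f. cscale (1 / ?N) (?S f))"
      using linS unfolding linear_map_on_def by (auto simp: cfun.scale_right_distrib mult.commute)
    show "range (\<lambda>f. cscale (1 / ?N) (?S f)) \<subseteq> fixed_space G \<rho> V"
      using orbit_sum_fixed[OF G(1) V] Pd(2) subspace_fixed_space[OF V]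
      by (auto intro!: cfun.subspace_scale)
    fix v assume v: "v \<in> fixed_space G \<rho> V"
    have "?S v = (\<Sum>g\<in>carrier G. v)"
      using v Pd(3) by (intro sum.cong refl) (auto simp: fixed_space_def)
    then show "cscale (1 / ?N) (?S v) = v"
      using N by (simp add: fun_eq_iff cscale_def sum_fun_apply)
  qed
  moreover have "fixed_space G \<rho> V \<subseteq> supported X" using X(2) by (auto simp: fixed_space_def)
  ultimately have "of_nat (cfun.dim (fixed_space G \<rho> V)) = trace_on X (\<lambda>f. cscale (1 / ?N) (?S f))"
    using X(1) subspace_fixed_space[OF V] by (intro trace_on_projection[symmetric])
  also have "\<dots> = (1 / ?N) * trace_on X ?S"
    by (simp add: trace_on_def cscale_def sum_distrib_left)
  also have "trace_on X ?S = (\<Sum>g\<in>carrier G. char_on X \<rho> V g)"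
    unfolding trace_on_sum char_on_def ..
  finally show ?thesis using N by simp
qed

lemma char_on_conj:
  assumes G: "group G" and V: "group_rep G \<rho> V" and X: "finite X" "V \<subseteq> supported X"
    and g: "g \<in> carrier G" and h: "h \<in> carrier G"
  shows "char_on X \<rho> V (h \<otimes>\<^bsub>G\<^esub> g \<otimes>\<^bsub>G\<^esub> inv\<^bsub>G\<^esub> h) = char_on X \<rho> V g"
proof -
  interpret group G by fact
  note Vd = group_repD[OF V]
  note P = is_projection_projection[OF Vd(1)]
  have inv: "\<rho> (inv\<^bsub>G\<^esub> h) (\<rho> h v) = v" "\<rho> h (\<rho> (inv\<^bsub>G\<^esub> h) v) = v" if "v \<in> V" for v
    using that h Vd(5) Vd(6)[of "inv\<^bsub>G\<^esub> h" h v] Vd(6)[of h "inv\<^bsub>G\<^esub> h" v] by simp_all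
  have k: "h \<otimes>\<^bsub>G\<^esub> g \<otimes>\<^bsub>G\<^esub> inv\<^bsub>G\<^esub> h \<in> carrier G" using g h by simp
  have "trace_on X (\<rho> g \<circ> projection V) = trace_on X (\<rho> (h \<otimes>\<^bsub>G\<^esub> g \<otimes>\<^bsub>G\<^esub> inv\<^bsub>G\<^esub> h) \<circ> projection V)"
  proof (rule trace_on_transport[where T = "\<rho> h", OF X(1) X(1) X(2) X(2) Vd(1) Vd(1) P P])
    show "bij_betw (\<rho> h) V V"
      by (rule bij_betw_byWitness[where f' = "\<rho> (inv\<^bsub>G\<^esub> h)"]) (use inv h Vd(4) in auto)
    fix v assume v: "v \<in> V"
    have "\<rho> (h \<otimes>\<^bsub>G\<^esub> g \<otimes>\<^bsub>G\<^esub> inv\<^bsub>G\<^esub> h) (\<rho> h v) = \<rho> (h \<otimes>\<^bsub>G\<^esub> g \<otimes>\<^bsub>G\<^esub> inv\<^bsub>G\<^esub> h \<otimes>\<^bsub>G\<^esub> h) v"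
      using v h k by (intro Vd(6)[symmetric])
    also have "h \<otimes>\<^bsub>G\<^esub> g \<otimes>\<^bsub>G\<^esub> inv\<^bsub>G\<^esub> h \<otimes>\<^bsub>G\<^esub> h = h \<otimes>\<^bsub>G\<^esub> g"
      using g h by (simp add: m_assoc)
    finally show "\<rho> h (\<rho> g v) = \<rho> (h \<otimes>\<^bsub>G\<^esub> g \<otimes>\<^bsub>G\<^esub> inv\<^bsub>G\<^esub> h) (\<rho> h v)"
      using Vd(6)[OF h g v] by simp
  qed (use Vd g h k in auto)
  then show ?thesis by (simp add: char_on_def)
qed

text \<open>In a linear relation choose an index \<open>s\<close> of largest weight among those with
  nonzero coefficient. Evaluation at \<open>T s\<close> kills every other term, which contradicts
  the diagonal condition.\<close>

lemma card_le_dim_triangular: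
  assumes X: "finite X" "V \<subseteq> supported X" and V: "cfun.subspace V"
    and K: "finite K" "f ` K \<subseteq> V" and diag: "\<And>s. s \<in> K \<Longrightarrow> f s (T s) \<noteq> 0"
    and tri: "\<And>s t. s \<in> K \<Longrightarrow> t \<in> K \<Longrightarrow> f t (T s) \<noteq> 0 \<Longrightarrow> s = t \<or> w s < (w t :: nat)"
  shows "card K \<le> cfun.dim V"
proof -
  have inj: "inj_on f K"
  proof (rule inj_onI, rule ccontr)
    fix s t assume st: "s \<in> K" "t \<in> K" "f s = f t" "s \<noteq> t"
    have "w s < w t" using tri[of s t] diag[of s] st by simp
    moreover have "w t < w s" using tri[of t s] diag[of t] st by simp
    ultimately show False by simp
  qed
  have "\<not> cfun.dependent (f ` K)"
  proof
    assume "cfun.dependent (f ` K)"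
    then obtain u v where v: "v \<in> f ` K" "u v \<noteq> 0" and sum: "(\<Sum>v\<in>f ` K. cscale (u v) v) = 0"
      unfolding cfun.dependent_finite[OF finite_imageI[OF K(1)]] by blast
    define L where "L = {t\<in>K. u (f t) \<noteq> 0}"
    have L: "finite L" "L \<noteq> {}" using K(1) v by (auto simp: L_def)
    then obtain s where s: "s \<in> L" "\<And>t. t \<in> L \<Longrightarrow> w t \<le> w s"
      using Max_in[of "w ` L"] Max_ge[of "w ` L"] by (smt (verit) finite_imageI image_iff image_is_empty)
    have sK: "s \<in> K" using s(1) by (simp add: L_def)
    have "0 = (\<Sum>v\<in>f ` K. cscale (u v) v) (T s)" by (simp add: sum)
    also have "\<dots> = (\<Sum>t\<in>K. u (f t) * f t (T s))"
      unfolding sum.reindex[OF inj] sum_fun_apply by (simp add: cscale_def)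
    also have "\<dots> = (\<Sum>t\<in>K. if t = s then u (f s) * f s (T s) else 0)"
    proof (rule sum.cong[OF refl])
      fix t assume t: "t \<in> K"
      show "u (f t) * f t (T s) = (if t = s then u (f s) * f s (T s) else 0)"
      proof (cases "u (f t) = 0 \<or> f t (T s) = 0 \<or> t = s")
        case False
        then have "w s < w t" using tri[OF sK t] by auto
        moreover have "w t \<le> w s" using False t by (intro s(2)) (simp add: L_def)
        ultimately show ?thesis by simp
      qed (use s(1) in \<open>auto simp: L_def\<close>)
    qed
    also have "\<dots> = u (f s) * f s (T s)" using K(1) sK by simp
    finally show False using s(1) diag[OF sK] by (simp add: L_def)
  qed
  moreover obtain B where B: "finite B" "cfun.span B = V" "card B = cfun.dim V"
    using finite_basis_exists[OF X V] by metis
  ultimately have "card (f ` K) \<le> card B"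
    using cfun.independent_span_bound[of B "f ` K"] K(2) by blast
  then show ?thesis using B card_image[OF inj] by simp
qed

lemma sum_digits_less:
  fixes N :: nat
  assumes "\<And>x. x < a \<Longrightarrow> d x < N"
  shows "(\<Sum>x<a. d x * N ^ x) < N ^ (a :: nat)"
  using assms
proof (induction a)
  case (Suc a)
  have "(\<Sum>x<Suc a. d x * N ^ x) < N ^ a + d a * N ^ a" using Suc by simp
  also have "\<dots> = (d a + 1) * N ^ a" by simp
  also have "\<dots> \<le> N * N ^ a" using Suc.prems[of a] by (intro mult_right_mono) auto
  finally show ?case by simp
qed simp

text \<open>Numerals in base \<open>N\<close> are compared from the top digit: the gain at position
  \<open>a\<close> outweighs everything below it.\<close>

lemma sum_digits_mono:
  assumes d: "\<And>x. x \<in> {1..n} \<Longrightarrow> d x < N" and a: "a \<in> {1..n}" "d a < d' a"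
    and eq: "\<And>x. x \<in> {1..n} \<Longrightarrow> a < x \<Longrightarrow> d x = d' x"
  shows "(\<Sum>x\<in>{1..n}. d x * N ^ x) < (\<Sum>x\<in>{1..n}. d' x * N ^ (x :: nat) :: nat)"
proof -
  have split: "(\<Sum>x\<in>{1..n}. e x * N ^ x) = (\<Sum>x\<in>{1..<a}. e x * N ^ x) + e a * N ^ a + (\<Sum>x\<in>{a<..n}. e x * N ^ x)"
    for e :: "nat \<Rightarrow> nat"
  proof -
    have "{1..n} = {1..<a} \<union> ({a} \<union> {a<..n})" using a(1) by auto
    moreover have "(\<Sum>x\<in>{1..<a} \<union> ({a} \<union> {a<..n}). e x * N ^ x)
        = (\<Sum>x\<in>{1..<a}. e x * N ^ x) + ((\<Sum>x\<in>{a}. e x * N ^ x) + (\<Sum>x\<in>{a<..n}. e x * N ^ x))"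
      by (subst sum.union_disjoint; (subst sum.union_disjoint)?) auto
    ultimately show ?thesis by simp
  qed
  \<comment> \<open>Entries start at 1, so position 0 is filled with the digit 0 to fit
    \<open>sum_digits_less\<close>.\<close>
  have "(\<Sum>x\<in>{1..<a}. d x * N ^ x) \<le> (\<Sum>x<a. (if x = 0 then 0 else d x) * N ^ x)"
    by (rule order_trans[OF eq_refl sum_mono2[of _ "{1..<a}"]]) (auto intro: sum.cong)
  also have "\<dots> < N ^ a"
  proof (rule sum_digits_less)
    fix x assume "x < a"
    then show "(if x = 0 then 0 else d x) < N" using d[of x] d[OF a(1)] a(1) by auto
  qed
  finally have "(\<Sum>x\<in>{1..<a}. d x * N ^ x) + d a * N ^ a < (d a + 1) * N ^ a" by simp
  also have "\<dots> \<le> d' a * N ^ a" using a(2) by (intro mult_right_mono) auto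
  finally have "(\<Sum>x\<in>{1..<a}. d x * N ^ x) + d a * N ^ a < (\<Sum>x\<in>{1..<a}. d' x * N ^ x) + d' a * N ^ a" by simp
  moreover have "(\<Sum>x\<in>{a<..n}. d x * N ^ x) = (\<Sum>x\<in>{a<..n}. d' x * N ^ x)"
    using eq a(1) by (intro sum.cong) auto
  ultimately show ?thesis unfolding split by simp
qed

section \<open>Standard tableaux and the independence of symmetrized polytabloids\<close>

lemma standard_tableauxD:
  assumes "t \<in> standard_tableaux lam"
  shows "is_tableau lam t" "t \<in> extensional (diagram lam)"
    "\<And>i j j'. (i, j) \<in> diagram lam \<Longrightarrow> (i, j') \<in> diagram lam \<Longrightarrow> j < j' \<Longrightarrow> t (i, j) < t (i, j')"
    "\<And>i i' j. (i, j) \<in> diagram lam \<Longrightarrow> (i', j) \<in> diagram lam \<Longrightarrow> i < i' \<Longrightarrow> t (i, j) < t (i', j)"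
  using assms unfolding standard_tableaux_def is_tableau_def by blast+

lemma finite_standard_tableaux: "finite (standard_tableaux lam)"
proof (rule finite_subset)
  show "standard_tableaux lam \<subseteq> diagram lam \<rightarrow>\<^sub>E {1..sum_list lam}"
    by (auto simp: standard_tableaux_def PiE_def dest: bij_betwE)
  show "finite (diagram lam \<rightarrow>\<^sub>E {1..sum_list lam})" by (intro finite_PiE finite_diagram) auto
qed

text \<open>Rows increase, so the entries to the left of \<open>x\<close> are exactly the smaller
  ones in its row.\<close>

lemma col_of_standard:
  assumes t: "t \<in> standard_tableaux lam" and x: "x \<in> {1..sum_list lam}"
  shows "col_of lam t x = card {y\<in>{1..sum_list lam}. row_of lam t y = row_of lam t x \<and> y < x}"
proof -
  note T = standard_tableauxD[OF t]
  let ?i = "row_of lam t x" and ?j = "col_of lam t x"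
  note c = tableau_cell[OF T(1) x]
  have dj: "(?i, j) \<in> diagram lam" if "j < ?j" for j using c(1) that by (auto simp: diagram_def)
  have "{y\<in>{1..sum_list lam}. row_of lam t y = ?i \<and> y < x} = (\<lambda>j. t (?i, j)) ` {..<?j}"
  proof (intro equalityI subsetI)
    fix y assume y: "y \<in> {y\<in>{1..sum_list lam}. row_of lam t y = ?i \<and> y < x}"
    then have y': "(?i, col_of lam t y) \<in> diagram lam" "t (?i, col_of lam t y) = y"
      using tableau_cell[OF T(1), of y] by auto
    have "col_of lam t y < ?j"
    proof (rule ccontr)
      assume "\<not> ?thesis"
      then have "x \<le> y" using T(3)[OF c(1) y'(1)] c(2) y'(2) by (cases "col_of lam t y = ?j") auto
      then show False using y by simp
    qed
    then show "y \<in> (\<lambda>j. t (?i, j)) ` {..<?j}" using y'(2) by (intro image_eqI[of _ _ "col_of lam t y"]) auto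
  next
    fix y assume "y \<in> (\<lambda>j. t (?i, j)) ` {..<?j}"
    then obtain j where j: "j < ?j" "y = t (?i, j)" by blast
    have "t (?i, j) < t (?i, ?j)" by (rule T(3)[OF dj[OF j(1)] c(1) j(1)])
    then show "y \<in> {y\<in>{1..sum_list lam}. row_of lam t y = ?i \<and> y < x}"
      using tableau_entry[OF T(1) dj[OF j(1)]] c(2) j(2) by simp
  qed
  moreover have "inj_on (\<lambda>j. t (?i, j)) {..<?j}"
  proof (rule inj_onI)
    fix j j' assume "j \<in> {..<?j}" "j' \<in> {..<?j}" "t (?i, j) = t (?i, j')"
    then show "j = j'" using tableau_entry(3)[OF T(1) dj] by (metis lessThan_iff)
  qed
  ultimately show ?thesis by (simp add: card_image)
qed

text \<open>\<open>col_of_standard\<close> recovers the column indices from the row indices; off the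
  diagram both tableaux are undefined.\<close>

lemma standard_tableau_eqI:
  assumes s: "s \<in> standard_tableaux lam" and t: "t \<in> standard_tableaux lam"
    and eq: "\<And>x. x \<in> {1..sum_list lam} \<Longrightarrow> row_of lam s x = row_of lam t x"
  shows "s = t"
proof (rule extensionalityI[OF standard_tableauxD(2)[OF s] standard_tableauxD(2)[OF t]])
  note S = standard_tableauxD(1)[OF s] and T = standard_tableauxD(1)[OF t]
  fix c assume c: "c \<in> diagram lam"
  obtain i j where ij: "c = (i, j)" by (cases c)
  let ?x = "s (i, j)"
  have x: "?x \<in> {1..sum_list lam}" "row_of lam s ?x = i" "col_of lam s ?x = j"
    using tableau_entry[OF S, of i j] c ij by auto
  have "{y\<in>{1..sum_list lam}. row_of lam s y = row_of lam s ?x \<and> y < ?x}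
      = {y\<in>{1..sum_list lam}. row_of lam t y = row_of lam t ?x \<and> y < ?x}"
    using eq x(1) by auto
  then have "col_of lam t ?x = j"
    using col_of_standard[OF s x(1)] col_of_standard[OF t x(1)] x(3) by simp
  then have "t (i, j) = ?x" using tableau_cell(2)[OF T x(1)] eq[OF x(1)] x(2) by simp
  then show "s c = t c" using ij by simp
qed

text \<open>The numeral in base \<open>length lam\<close> whose digit at position \<open>x\<close>
  is the row of the entry \<open>x\<close>. Comparing two weights thus looks at the largest entry
  that lies in different rows.\<close>

definition row_weight :: "nat list \<Rightarrow> (nat \<times> nat \<Rightarrow> nat) \<Rightarrow> nat" where
  "row_weight lam t = (\<Sum>x\<in>{1..sum_list lam}. row_of lam t x * (length lam) ^ x)"

text \<open>The largest entry moved by a column permutation of a standard tableau moves up.\<close>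

lemma row_weight_column_perm:
  assumes t: "t \<in> standard_tableaux lam" and p: "p \<in> column_stabilizer lam t" "p \<noteq> id"
  shows "row_weight lam (p \<circ> t) < row_weight lam t"
proof -
  note T = standard_tableauxD[OF t]
  have pp: "p permutes {1..sum_list lam}" using column_stabilizer_permutes[OF p(1)] .
  have pT: "is_tableau lam (p \<circ> t)" by (rule tableau_comp[OF T(1) pp])
  define M where "M = {x. p x \<noteq> x}"
  have M: "M \<subseteq> {1..sum_list lam}" using permutes_not_in[OF pp] unfolding M_def by blast
  then have finM: "finite M" by (rule finite_subset) simp
  have "M \<noteq> {}" using p(2) by (auto simp: M_def)
  define a where "a = Max M"
  have aM: "a \<in> M" unfolding a_def by (rule Max_in[OF finM \<open>M \<noteq> {}\<close>])
  have a: "a \<in> {1..sum_list lam}" using aM M by blast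
  \<comment> \<open>In \<open>p \<circ> t\<close> the entry \<open>a\<close> takes the place of
    \<open>b\<close>. As \<open>b\<close> is moved too, it is smaller than \<open>a\<close>, and in
    a column of a standard tableau the smaller entry stands higher.\<close>
  define b where "b = inv' p a"
  have pb: "p b = a" unfolding b_def using permutes_inverses(1)[OF pp] .
  have "b \<noteq> a" using aM pb by (auto simp: M_def)
  then have bM: "b \<in> M" using pb by (auto simp: M_def)
  have b: "b \<in> {1..sum_list lam}" using bM M by blast
  have "b < a" using Max_ge[OF finM bM] \<open>b \<noteq> a\<close> by (simp add: a_def)
  have col: "col_of lam t a = col_of lam t b" using p(1) b pb column_stabilizer_iff[OF T(1)] by auto
  have ra: "row_of lam (p \<circ> t) a = row_of lam t b" using row_col_of_comp(1)[OF T(1) pp b] pb by simp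
  have "row_of lam t b < row_of lam t a"
  proof (rule ccontr)
    assume "\<not> ?thesis"
    then consider "row_of lam t b = row_of lam t a" | "row_of lam t a < row_of lam t b" by linarith
    then show False
    proof cases
      case 1
      then show False using tableau_inj_cell[OF T(1) b a] col \<open>b \<noteq> a\<close> by simp
    next
      case 2
      have "t (row_of lam t a, col_of lam t a) < t (row_of lam t b, col_of lam t a)"
        using tableau_cell(1)[OF T(1)] a b 2 col by (intro T(4)) metis+
      then have "a < b"
        using tableau_cell(2)[OF T(1) a] tableau_cell(2)[OF T(1) b] col by metis
      then show False using \<open>b < a\<close> by simp
    qed
  qed
  then show ?thesis
    unfolding row_weight_def
  proof (intro sum_digits_mono[where a = a])
    show "row_of lam (p \<circ> t) x < length lam" if "x \<in> {1..sum_list lam}" for x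
      by (rule row_lt_length[OF pT that])
    show "row_of lam (p \<circ> t) x = row_of lam t x" if x: "x \<in> {1..sum_list lam}" "a < x" for x
    proof -
      have "x \<notin> M" using Max_ge[OF finM, of x] x(2) by (auto simp: a_def)
      then show ?thesis using row_col_of_comp(1)[OF T(1) pp x(1)] by (simp add: M_def)
    qed
  qed (use a ra in auto)
qed

lemma row_weight_cong:
  assumes "is_tableau lam s" "is_tableau lam t" "tabloid lam s = tabloid lam t"
  shows "row_weight lam s = row_weight lam t"
  unfolding row_weight_def using tabloid_eq_iff[OF assms(1,2)] assms(3) by (intro sum.cong) auto

lemma polytabloid_standard_triangular:
  assumes s: "s \<in> standard_tableaux lam" and t: "t \<in> standard_tableaux lam"
    and nz: "polytabloid lam t (tabloid lam s) \<noteq> 0"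
  shows "s = t \<or> row_weight lam s < row_weight lam t"
proof -
  note S = standard_tableauxD(1)[OF s] and T = standard_tableauxD(1)[OF t]
  have "\<exists>p\<in>column_stabilizer lam t. tabloid lam s = tabloid lam (p \<circ> t)"
  proof (rule ccontr)
    assume "\<not> ?thesis"
    then have "polytabloid lam t (tabloid lam s) = 0"
      unfolding polytabloid_def by (intro sum.neutral ballI) simp
    then show False using nz by contradiction
  qed
  then obtain p where p: "p \<in> column_stabilizer lam t" "tabloid lam s = tabloid lam (p \<circ> t)" ..
  have pT: "is_tableau lam (p \<circ> t)" by (rule tableau_comp[OF T column_stabilizer_permutes[OF p(1)]])
  show ?thesis
  proof (cases "p = id")
    case True
    then have "s = t" using p(2) tabloid_eq_iff[OF S T] by (intro standard_tableau_eqI[OF s t]) simp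
    then show ?thesis ..
  next
    case False
    then show ?thesis
      using row_weight_cong[OF S pT p(2)] row_weight_column_perm[OF t p(1) False] by simp
  qed
qed

lemma group_rep_specht_le:
  assumes lam: "is_partition lam n" and "m \<le> n"
  shows "group_rep (sym_group m) tabloid_action (specht lam)"
proof -
  have perm: "g \<in> carrier (sym_group n)" if "g \<in> carrier (sym_group m)" for g
    using that \<open>m \<le> n\<close> permutes_subset[of g "{1..m}" "{1..n}"] by (simp add: sym_group_carrier)
  note S = group_rep_specht[OF lam]
  show ?thesis
    using S perm unfolding group_rep_def sym_group_mult sym_group_one by blast
qed

text \<open>If \<open>1, ..., m\<close> are in the first row of \<open>s\<close>, its tabloid is
  fixed by the permutations of these letters. At such a tabloid, symmetrizing only multiplies a
  polytabloid by the group order, so the triangularity of polytabloids survives.\<close>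

theorem dim_fixed_space_ge:
  assumes lam: "is_partition lam n" and "m \<le> n"
  shows "card {t\<in>standard_tableaux lam. \<forall>c\<in>diagram lam. t c \<le> m \<longrightarrow> fst c = 0}
    \<le> cfun.dim (fixed_space (sym_group m) tabloid_action (specht lam))"
    (is "card ?K \<le> cfun.dim ?F")
proof -
  have n: "sum_list lam = n" using lam by (simp add: is_partition_def)
  let ?Y = "tabloid_space n lam" and ?G = "carrier (sym_group m)"
  note rep = group_rep_specht_le[OF lam \<open>m \<le> n\<close>]
  define v where "v t = (\<Sum>g\<in>?G. tabloid_action g (polytabloid lam t))" for t
  have finG: "finite ?G" by (simp add: sym_group_def finite_permutations)
  have "id \<in> ?G" by (simp add: sym_group_carrier permutes_id)
  then have G: "?G \<noteq> {}" by blast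
  have val: "v t (tabloid lam s) = of_nat (card ?G) * polytabloid lam t (tabloid lam s)"
    if s: "s \<in> ?K" for s t
  proof -
    have S: "is_tableau lam s" using s standard_tableauxD(1) by blast
    have row0: "row_of lam s x = 0" if "x \<in> {1..n}" "x \<le> m" for x
    proof -
      note c = tableau_cell[OF S, unfolded n, OF that(1)]
      have "fst (row_of lam s x, col_of lam s x) = 0" using s c that(2) by auto
      then show ?thesis by simp
    qed
    have "tabloid_action g (polytabloid lam t) (tabloid lam s) = polytabloid lam t (tabloid lam s)"
      if g: "g \<in> ?G" for g
    proof -
      define q where "q = inv' g"
      have qm: "q permutes {1..m}" using g permutes_inv by (auto simp: q_def sym_group_carrier)
      have q: "q permutes {1..sum_list lam}"
        unfolding n by (rule permutes_subset[OF qm]) (use \<open>m \<le> n\<close> in auto)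
      have "row_of lam (q \<circ> s) x = row_of lam s x" if x: "x \<in> {1..sum_list lam}" for x
      proof -
        obtain y where y: "y \<in> {1..sum_list lam}" "x = q y"
          using permutes_image[OF q] x by blast
        have "row_of lam (q \<circ> s) x = row_of lam s y" using row_col_of_comp(1)[OF S q y(1)] y(2) by simp
        also have "\<dots> = row_of lam s (q y)"
        proof (cases "y \<le> m")
          case True
          then have "q y \<in> {1..m}" using permutes_in_image[OF qm, of y] y(1) by simp
          then show ?thesis using row0 True y(1) \<open>m \<le> n\<close> n by simp
        next
          case False
          then show ?thesis using permutes_not_in[OF qm, of y] by simp
        qed
        finally show ?thesis using y(2) by simp
      qed
      then have "tabloid lam (q \<circ> s) = tabloid lam s"
        using tabloid_eq_iff[OF tableau_comp[OF S q] S] by simp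
      then show ?thesis by (simp add: fun_action_def q_def tabloid_comp)
    qed
    then have "v t (tabloid lam s) = (\<Sum>g\<in>?G. polytabloid lam t (tabloid lam s))"
      unfolding v_def sum_fun_apply by (rule sum.cong[OF refl])
    then show ?thesis by simp
  qed
  show ?thesis
  proof (rule card_le_dim_triangular[where X = ?Y and f = v and T = "tabloid lam" and w = "row_weight lam"])
    show "?F \<subseteq> supported ?Y" using specht_supported[OF n] by (auto simp: fixed_space_def)
    show "cfun.subspace ?F" by (rule subspace_fixed_space[OF rep])
    show "finite ?K" using finite_standard_tableaux by simp
    show "v ` ?K \<subseteq> ?F"
      unfolding v_def
      using orbit_sum_fixed[OF sym_group_is_group rep] polytabloid_in_specht standard_tableauxD(1) by blast
    show "v s (tabloid lam s) \<noteq> 0" if "s \<in> ?K" for s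
      unfolding val[OF that] using polytabloid_at_self[of lam s] standard_tableauxD(1)[of s] that finG G by auto
    show "s = t \<or> row_weight lam s < row_weight lam t"
      if "s \<in> ?K" "t \<in> ?K" "v t (tabloid lam s) \<noteq> 0" for s t
      using that polytabloid_standard_triangular[of s lam t] val[OF that(1)] by auto
  qed (rule finite_tabloid_space)
qed

section \<open>Counting in Young's lattice\<close>

text \<open>Diagrams are handled as finite down-sets of cells, which turns adding and removing a
  cell into set operations; \<open>diagram_bij\<close> gives the link to partitions.\<close>

definition young :: "(nat \<times> nat) set \<Rightarrow> bool" where
  "young D \<longleftrightarrow> finite D \<and> (\<forall>i j i' j'. (i, j) \<in> D \<and> i' \<le> i \<and> j' \<le> j \<longrightarrow> (i', j') \<in> D)"

definition row_len :: "(nat \<times> nat) set \<Rightarrow> nat \<Rightarrow> nat" where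
  "row_len D i = card {j. (i, j) \<in> D}"

definition removable :: "(nat \<times> nat) set \<Rightarrow> (nat \<times> nat) set" where
  "removable D = {c\<in>D. young (D - {c})}"

definition addable :: "(nat \<times> nat) set \<Rightarrow> (nat \<times> nat) set" where
  "addable D = {c. c \<notin> D \<and> young (insert c D)}"

text \<open>For \<open>m = 0\<close> the last condition is void since entries start at 1. When row 0
  has at least \<open>m\<close> cells, the fillings correspond to the standard tableaux of the skew
  shape without the first \<open>m\<close> cells of that row.\<close>

definition fillings :: "nat \<Rightarrow> (nat \<times> nat) set \<Rightarrow> (nat \<times> nat \<Rightarrow> nat) set" where
  "fillings m D = {t \<in> extensional D. bij_betw t D {1..card D} \<and>
     (\<forall>i j j'. (i, j) \<in> D \<and> (i, j') \<in> D \<and> j < j' \<longrightarrow> t (i, j) < t (i, j')) \<and>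
     (\<forall>i i' j. (i, j) \<in> D \<and> (i', j) \<in> D \<and> i < i' \<longrightarrow> t (i, j) < t (i', j)) \<and>
     (\<forall>c\<in>D. t c \<le> m \<longrightarrow> fst c = 0)}"

definition num_fillings :: "nat \<Rightarrow> (nat \<times> nat) set \<Rightarrow> nat" where
  "num_fillings m D = card (fillings m D)"

lemma young_finite: "young D \<Longrightarrow> finite D"
  by (simp add: young_def)

lemma young_down: "young D \<Longrightarrow> (i, j) \<in> D \<Longrightarrow> i' \<le> i \<Longrightarrow> j' \<le> j \<Longrightarrow> (i', j') \<in> D"
  unfolding young_def by blast

lemma young_row:
  assumes "young D"
  shows "(i, j) \<in> D \<longleftrightarrow> j < row_len D i"
proof -
  have fin: "finite {j. (i, j) \<in> D}"
    using finite_imageI[OF young_finite[OF assms], of snd] by (rule finite_subset[rotated]) force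
  have "{j. (i, j) \<in> D} = {..<card {j. (i, j) \<in> D}}"
    by (rule downset_nat_eq[OF fin]) (use young_down[OF assms] in blast)
  then show ?thesis by (auto simp: row_len_def)
qed

lemma row_len_antimono:
  assumes "young D" "i \<le> i'"
  shows "row_len D i' \<le> row_len D i"
proof (rule ccontr)
  assume "\<not> ?thesis"
  then have "(i', row_len D i) \<in> D" using young_row[OF assms(1)] by simp
  then have "(i, row_len D i) \<in> D" using young_down[OF assms(1) _ assms(2)] by blast
  then show False using young_row[OF assms(1)] by simp
qed

lemma removable_eq:
  assumes D: "young D"
  shows "removable D = (\<lambda>i. (i, row_len D i - 1)) ` {i. row_len D (Suc i) < row_len D i}"
proof (intro equalityI subsetI)
  fix c assume c: "c \<in> removable D"
  obtain i j where ij: "c = (i, j)" by (cases c)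
  have D': "young (D - {(i, j)})" and inD: "(i, j) \<in> D" using c ij by (auto simp: removable_def)
  have "(i, Suc j) \<notin> D" using young_down[OF D', of i "Suc j" i j] by auto
  then have j: "j = row_len D i - 1" using inD by (auto simp: young_row[OF D])
  have "(Suc i, j) \<notin> D" using young_down[OF D', of "Suc i" j i j] by auto
  then have "row_len D (Suc i) < row_len D i" using inD by (auto simp: young_row[OF D])
  then show "c \<in> (\<lambda>i. (i, row_len D i - 1)) ` {i. row_len D (Suc i) < row_len D i}"
    using ij j by auto
next
  fix c assume "c \<in> (\<lambda>i. (i, row_len D i - 1)) ` {i. row_len D (Suc i) < row_len D i}"
  then obtain i where i: "c = (i, row_len D i - 1)" "row_len D (Suc i) < row_len D i" by auto
  have cD: "c \<in> D" using i young_row[OF D] by simp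
  have "(a', b') \<in> D - {c}" if ab: "(a, b) \<in> D - {c}" "a' \<le> a" "b' \<le> b" for a b a' b'
  proof -
    have abD: "b < row_len D a" using ab young_row[OF D] by simp
    have "(a', b') \<in> D" using young_down[OF D] ab by blast
    moreover have "(a', b') \<noteq> c"
    proof
      assume eq: "(a', b') = c"
      show False
      proof (cases "a = i")
        case True
        then have "b = row_len D i - 1" using abD ab(3) i(1) eq by auto
        then show False using ab(1) i(1) True by simp
      next
        case False
        then have "Suc i \<le> a" using ab(2) i(1) eq by auto
        then have "row_len D a \<le> row_len D (Suc i)" by (rule row_len_antimono[OF D])
        then show False using abD ab(3) i eq by auto
      qed
    qed
    ultimately show ?thesis by blast
  qed
  then have "young (D - {c})" using young_finite[OF D] unfolding young_def by blast
  then show "c \<in> removable D" using cD by (simp add: removable_def)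
qed

lemma addable_eq:
  assumes D: "young D"
  shows "addable D = (\<lambda>i. (i, row_len D i)) ` {i. i = 0 \<or> row_len D i < row_len D (i - 1)}"
proof (intro equalityI subsetI)
  fix c assume c: "c \<in> addable D"
  obtain i j where ij: "c = (i, j)" by (cases c)
  have D': "young (insert (i, j) D)" and nD: "(i, j) \<notin> D" using c ij by (auto simp: addable_def)
  have ge: "row_len D i \<le> j" using nD young_row[OF D] by simp
  have j: "j = row_len D i"
  proof (rule ccontr)
    assume "j \<noteq> row_len D i"
    then have "(i, row_len D i) \<in> D" using young_down[OF D', of i j i "row_len D i"] ge by auto
    then show False using young_row[OF D] by simp
  qed
  have "row_len D i < row_len D (i - 1)" if "i \<noteq> 0"
  proof -
    have "(i - 1, j) \<in> D" using young_down[OF D', of i j "i - 1" j] that by auto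
    then show ?thesis using young_row[OF D] j by simp
  qed
  then show "c \<in> (\<lambda>i. (i, row_len D i)) ` {i. i = 0 \<or> row_len D i < row_len D (i - 1)}"
    using ij j by auto
next
  fix c assume "c \<in> (\<lambda>i. (i, row_len D i)) ` {i. i = 0 \<or> row_len D i < row_len D (i - 1)}"
  then obtain i where i: "c = (i, row_len D i)" "i = 0 \<or> row_len D i < row_len D (i - 1)" by auto
  have cD: "c \<notin> D" using i young_row[OF D] by simp
  have below: "(a', b') \<in> insert c D" if "a' \<le> i" "b' \<le> row_len D i" for a' b'
  proof (cases "a' = i")
    case True
    then show ?thesis using that i(1) young_row[OF D] by auto
  next
    case False
    then have "a' \<le> i - 1" "i \<noteq> 0" using that by auto
    then have "row_len D i < row_len D a'" using i(2) row_len_antimono[OF D, of a' "i - 1"] by auto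
    then show ?thesis using that(2) young_row[OF D] by simp
  qed
  have "(a', b') \<in> insert c D" if ab: "(a, b) \<in> insert c D" "a' \<le> a" "b' \<le> b" for a b a' b'
  proof (cases "(a, b) = c")
    case True
    then show ?thesis using below ab i(1) by auto
  next
    case False
    then show ?thesis using young_down[OF D] ab by blast
  qed
  then have "young (insert c D)" using young_finite[OF D] unfolding young_def by blast
  then show "c \<in> addable D" using cD by (simp add: addable_def)
qed

lemma finite_removable: "young D \<Longrightarrow> finite (removable D)"
  by (auto simp: removable_def young_def)

text \<open>A cell can be added in row 0 and directly below each row from which one can be removed.
  This surplus of one is the constant in the commutation relation of the up and down
  operators.\<close>

lemma card_addable:
  assumes D: "young D"
  shows "finite (addable D)" "card (addable D) = Suc (card (removable D))"
proof -
  let ?R = "{i. row_len D (Suc i) < row_len D i}"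
  have inj1: "inj_on (\<lambda>i. (i, row_len D i - 1)) ?R" and inj2: "inj_on (\<lambda>i. (i, row_len D i)) A" for A
    by (auto simp: inj_on_def)
  have finR: "finite ?R"
    using finite_removable[OF D] unfolding removable_eq[OF D] by (rule finite_imageD[OF _ inj1])
  have A: "{i. i = 0 \<or> row_len D i < row_len D (i - 1)} = insert 0 (Suc ` ?R)" (is "?A = _")
  proof (intro equalityI subsetI)
    fix i assume "i \<in> ?A"
    then show "i \<in> insert 0 (Suc ` ?R)" by (cases i) auto
  qed auto
  show "finite (addable D)" unfolding addable_eq[OF D] A using finR by simp
  have "card (addable D) = card (insert 0 (Suc ` ?R))"
    unfolding addable_eq[OF D] A by (rule card_image[OF inj2])
  also have "\<dots> = Suc (card ?R)" using finR by (simp add: card_image)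
  also have "card ?R = card (removable D)"
    unfolding removable_eq[OF D] by (rule card_image[OF inj1, symmetric])
  finally show "card (addable D) = Suc (card (removable D))" .
qed

section \<open>Recursion over the cell of the largest entry\<close>

lemma fillingsD:
  assumes "t \<in> fillings m D"
  shows "t \<in> extensional D" "bij_betw t D {1..card D}"
    "\<And>i j j'. (i, j) \<in> D \<Longrightarrow> (i, j') \<in> D \<Longrightarrow> j < j' \<Longrightarrow> t (i, j) < t (i, j')"
    "\<And>i i' j. (i, j) \<in> D \<Longrightarrow> (i', j) \<in> D \<Longrightarrow> i < i' \<Longrightarrow> t (i, j) < t (i', j)"
    "\<And>c. c \<in> D \<Longrightarrow> t c \<le> m \<Longrightarrow> fst c = 0"
  using assms unfolding fillings_def by blast+

lemma finite_fillings:
  assumes "finite D"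
  shows "finite (fillings m D)"
proof (rule finite_subset)
  show "fillings m D \<subseteq> D \<rightarrow>\<^sub>E {1..card D}"
    by (auto simp: fillings_def PiE_def dest: bij_betwE)
  show "finite (D \<rightarrow>\<^sub>E {1..card D})" using assms by (intro finite_PiE) auto
qed

lemma max_entry_removable:
  assumes D: "young D" and t: "t \<in> fillings m D" and c: "c \<in> D" "t c = card D"
  shows "c \<in> removable D"
proof -
  note T = fillingsD[OF t]
  have le: "t d \<le> card D" if "d \<in> D" for d using bij_betw_apply[OF T(2) that] by simp
  obtain i j where ij: "c = (i, j)" by (cases c)
  have "(a', b') \<in> D - {c}" if ab: "(a, b) \<in> D - {c}" "a' \<le> a" "b' \<le> b" for a b a' b'
  proof -
    have "(a', b') \<noteq> c"
    proof
      assume eq: "(a', b') = c"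
      have aD: "(a, b) \<in> D" "(a', b) \<in> D" "(a', b') \<in> D" using ab young_down[OF D] by blast+
      have "t (a', b') \<le> t (a', b)" using T(3)[OF aD(3,2)] ab(3) by (cases "b' = b") auto
      moreover have "t (a', b) \<le> t (a, b)" using T(4)[OF aD(2,1)] ab(2) by (cases "a' = a") auto
      ultimately have "t (a, b) = card D" using le[OF aD(1)] c eq by simp
      then have "(a, b) = c" using T(2) aD(1) c by (metis bij_betw_def inj_onD)
      then show False using ab(1) by simp
    qed
    then show ?thesis using young_down[OF D] ab by blast
  qed
  then have "young (D - {c})" using young_finite[OF D] unfolding young_def by blast
  then show ?thesis using c by (simp add: removable_def)
qed

lemma fillings_extend:
  assumes D: "young D" and c: "c \<in> removable D" and u: "u \<in> fillings m (D - {c})" and m: "m < card D"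
  shows "u(c := card D) \<in> fillings m D"
proof -
  note U = fillingsD[OF u]
  have cD: "c \<in> D" and D': "young (D - {c})" using c by (auto simp: removable_def)
  have card: "card D = Suc (card (D - {c}))" using card.remove[OF young_finite[OF D] cD] .
  have lt: "u d < card D" if "d \<in> D" "d \<noteq> c" for d
    using bij_betw_apply[OF U(2), of d] that card by simp
  have last: "d = c" if "c = (i, j)" "d = (i', j')" "i \<le> i'" "j \<le> j'" "d \<in> D" for d i j i' j'
  proof (rule ccontr)
    assume "d \<noteq> c"
    then have "(i, j) \<in> D - {c}" using young_down[OF D', of i' j' i j] that by auto
    then show False using that by simp
  qed
  have "bij_betw (u(c := card D)) D {1..card D}"
  proof -
    have "bij_betw (u(c := card D)) (D - {c}) {1..card (D - {c})}"
      using U(2) by (subst bij_betw_cong[of _ _ u]) auto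
    then have "bij_betw (u(c := card D)) (D - {c} \<union> {c}) ({1..card (D - {c})} \<union> {card D})"
      by (rule bij_betw_combine) (auto simp: bij_betw_def card)
    moreover have "D - {c} \<union> {c} = D" "{1..card (D - {c})} \<union> {card D} = {1..card D}"
      using cD card by auto
    ultimately show ?thesis by simp
  qed
  moreover have "u(c := card D) \<in> extensional D"
    using U(1) cD by (auto simp: extensional_def)
  moreover have "(u(c := card D)) (i, j) < (u(c := card D)) (i, j')"
    if "(i, j) \<in> D" "(i, j') \<in> D" "j < j'" for i j j'
  proof (cases "c = (i, j)")
    case True
    then show ?thesis using last[OF True, of "(i, j')" i j'] that by auto
  next
    case False
    then show ?thesis using U(3)[of i j j'] lt[of "(i, j)"] that by auto
  qed
  moreover have "(u(c := card D)) (i, j) < (u(c := card D)) (i', j)"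
    if "(i, j) \<in> D" "(i', j) \<in> D" "i < i'" for i i' j
  proof (cases "c = (i, j)")
    case True
    then show ?thesis using last[OF True, of "(i', j)" i' j] that by auto
  next
    case False
    then show ?thesis using U(4)[of i j i'] lt[of "(i, j)"] that by auto
  qed
  moreover have "fst d = 0" if "d \<in> D" "(u(c := card D)) d \<le> m" for d
    using that m U(5)[of d] by (cases "d = c") auto
  ultimately show ?thesis unfolding fillings_def by blast
qed

lemma fillings_restrict:
  assumes D: "young D" and c: "c \<in> removable D" and t: "t \<in> fillings m D" "t c = card D"
  shows "restrict t (D - {c}) \<in> fillings m (D - {c})"
proof -
  note T = fillingsD[OF t(1)]
  have cD: "c \<in> D" using c by (auto simp: removable_def)
  have card: "card D = Suc (card (D - {c}))" using card.remove[OF young_finite[OF D] cD] .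
  have "bij_betw t (D - {c}) ({1..card D} - {t c})" 
    by (rule bij_betw_DiffI[OF T(2)]) (use cD bij_betw_apply[OF T(2) cD] in \<open>auto simp: bij_betw_def\<close>)
  moreover have "{1..card D} - {t c} = {1..card (D - {c})}" using t(2) card by auto
  ultimately have "bij_betw t (D - {c}) {1..card (D - {c})}" by simp
  then have "bij_betw (restrict t (D - {c})) (D - {c}) {1..card (D - {c})}"
    by (subst bij_betw_cong[of _ _ t]) auto
  then show ?thesis
    unfolding fillings_def using T(3-5) by auto
qed

text \<open>The fillings are sorted by the cell of the largest entry \<open>card D\<close>, which is
  removable. The hypothesis \<open>m < card D\<close> exempts this entry from the first-row
  condition.\<close>

lemma num_fillings_rec:
  assumes D: "young D" and m: "m < card D"
  shows "num_fillings m D = (\<Sum>c\<in>removable D. num_fillings m (D - {c}))"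
proof -
  have eq: "fillings m D = (\<Union>c\<in>removable D. {t\<in>fillings m D. t c = card D})"
  proof (intro equalityI subsetI)
    fix t assume t: "t \<in> fillings m D"
    have "card D \<in> t ` D" using fillingsD(2)[OF t] m by (auto simp: bij_betw_def)
    then obtain c where c: "c \<in> D" "t c = card D" by auto
    then show "t \<in> (\<Union>c\<in>removable D. {t\<in>fillings m D. t c = card D})"
      using max_entry_removable[OF D t c] t by blast
  qed auto
  have "num_fillings m D = (\<Sum>c\<in>removable D. card {t\<in>fillings m D. t c = card D})"
    unfolding num_fillings_def
  proof (subst eq, rule card_UN_disjoint[OF finite_removable[OF D]])
    show "\<forall>c\<in>removable D. finite {t \<in> fillings m D. t c = card D}"
      using finite_fillings[OF young_finite[OF D]] by simp
    show "\<forall>c\<in>removable D. \<forall>d\<in>removable D. c \<noteq> d \<longrightarrow>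
       {t \<in> fillings m D. t c = card D} \<inter> {t \<in> fillings m D. t d = card D} = {}"
    proof (intro ballI impI equals0I)
      fix c d t assume cd: "c \<in> removable D" "d \<in> removable D" "c \<noteq> d"
        and t: "t \<in> {t \<in> fillings m D. t c = card D} \<inter> {t \<in> fillings m D. t d = card D}"
      have "inj_on t D" using t fillingsD(2) by (blast intro: bij_betw_imp_inj_on)
      moreover have "t c = t d" "c \<in> D" "d \<in> D" using cd t by (auto simp: removable_def)
      ultimately show False using cd(3) by (auto dest: inj_onD)
    qed
  qed
  also have "\<dots> = (\<Sum>c\<in>removable D. num_fillings m (D - {c}))"
  proof (rule sum.cong[OF refl])
    fix c assume c: "c \<in> removable D"
    then have cD: "c \<in> D" by (simp add: removable_def)
    have "bij_betw (\<lambda>t. restrict t (D - {c})) {t\<in>fillings m D. t c = card D} (fillings m (D - {c}))"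
    proof (rule bij_betw_byWitness[where f' = "\<lambda>u. u(c := card D)"])
      show "\<forall>t\<in>{t \<in> fillings m D. t c = card D}. (restrict t (D - {c}))(c := card D) = t"
        using cD by (auto simp: fun_eq_iff restrict_def extensional_def dest: fillingsD(1))
      show "\<forall>u\<in>fillings m (D - {c}). restrict (u(c := card D)) (D - {c}) = u"
        by (auto simp: fun_eq_iff restrict_def extensional_def dest: fillingsD(1))
      show "(\<lambda>t. restrict t (D - {c})) ` {t \<in> fillings m D. t c = card D} \<subseteq> fillings m (D - {c})"
        using fillings_restrict[OF D c] by blast
      show "(\<lambda>u. u(c := card D)) ` fillings m (D - {c}) \<subseteq> {t \<in> fillings m D. t c = card D}"
        using fillings_extend[OF D c _ m] by auto
    qed
    then show "card {t\<in>fillings m D. t c = card D} = num_fillings m (D - {c})"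
      by (simp add: num_fillings_def bij_betw_same_card)
  qed
  finally show ?thesis .
qed

lemma num_fillings_empty: "num_fillings m {} = 1"
proof -
  have "fillings m {} = {\<lambda>_. undefined}" by (auto simp: fillings_def bij_betw_def)
  then show ?thesis by (simp add: num_fillings_def)
qed

lemma young_Int: "young D \<Longrightarrow> young E \<Longrightarrow> young (D \<inter> E)"
  unfolding young_def by blast

lemma young_Un: "young D \<Longrightarrow> young E \<Longrightarrow> young (D \<union> E)"
  unfolding young_def by blast

text \<open>Adding and removing commute for different cells. The diagram missing on either side is
  the intersection or the union of \<open>D\<close> with the other one.\<close>

lemma add_remove_swap:
  assumes D: "young D"
  shows "c \<in> addable D \<and> c' \<in> removable (insert c D) - {c} \<longleftrightarrow>
    c' \<in> removable D \<and> c \<in> addable (D - {c'}) - {c'}"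
proof
  assume *: "c \<in> addable D \<and> c' \<in> removable (insert c D) - {c}"
  then have "young (D \<inter> (insert c D - {c'}))" using young_Int[OF D] by (auto simp: removable_def)
  moreover have "D \<inter> (insert c D - {c'}) = D - {c'}" by auto
  moreover have "insert c D - {c'} = insert c (D - {c'})" using * by auto
  ultimately show "c' \<in> removable D \<and> c \<in> addable (D - {c'}) - {c'}"
    using * by (auto simp: removable_def addable_def)
next
  assume *: "c' \<in> removable D \<and> c \<in> addable (D - {c'}) - {c'}"
  then have "young (D \<union> insert c (D - {c'}))" by (intro young_Un[OF D]) (simp add: addable_def)
  also have "D \<union> insert c (D - {c'}) = insert c D" by auto
  finally have "young (insert c D)" .
  moreover have "insert c D - {c'} = insert c (D - {c'})" using * by auto
  ultimately show "c \<in> addable D \<and> c' \<in> removable (insert c D) - {c}"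
    using * by (auto simp: removable_def addable_def)
qed

text \<open>
  The relation \<open>D U - U D = 1\<close> between the up and down operators of Young's lattice, applied
  inductively to the eigenvector of \<open>D\<close> given by the numbers of standard tableaux.
\<close>

lemma sum_addable:
  assumes "young D"
  shows "(\<Sum>c\<in>addable D. num_fillings 0 (insert c D)) = Suc (card D) * num_fillings 0 D"
  using assms
proof (induction "card D" arbitrary: D rule: less_induct)
  case (less D)
  note D = less.prems
  let ?f = "num_fillings 0" and ?A = "addable D" and ?R = "removable D"
  have finA: "finite ?A" and cardA: "card ?A = Suc (card ?R)" using card_addable[OF D] by auto
  have cA: "young (insert c D)" "c \<notin> D" if "c \<in> ?A" for c using that by (auto simp: addable_def)
  have cR: "young (D - {c})" "c \<in> D" if "c \<in> ?R" for c using that by (auto simp: removable_def)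
  \<comment> \<open>In \<open>up\<close> and in \<open>down\<close> the move that undoes the
    previous one is split off; it leads back to \<open>D\<close>. The remaining terms are matched by
    \<open>swap\<close>.\<close>
  have up: "?f (insert c D) = ?f D + (\<Sum>c'\<in>removable (insert c D) - {c}. ?f (insert c D - {c'}))" if c: "c \<in> ?A" for c
  proof -
    have "c \<in> removable (insert c D)" using cA[OF c] D by (simp add: removable_def)
    then have "(\<Sum>c'\<in>removable (insert c D). ?f (insert c D - {c'}))
        = ?f (insert c D - {c}) + (\<Sum>c'\<in>removable (insert c D) - {c}. ?f (insert c D - {c'}))"
      by (rule sum.remove[OF finite_removable[OF cA(1)[OF c]]])
    then show ?thesis
      using num_fillings_rec[OF cA(1)[OF c], of 0] cA(2)[OF c] young_finite[OF D] by simp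
  qed
  have swap: "(\<Sum>c\<in>?A. \<Sum>c'\<in>removable (insert c D) - {c}. ?f (insert c D - {c'}))
      = (\<Sum>c'\<in>?R. \<Sum>c\<in>addable (D - {c'}) - {c'}. ?f (insert c (D - {c'})))"
  proof -
    have "(\<Sum>c\<in>?A. \<Sum>c'\<in>removable (insert c D) - {c}. ?f (insert c D - {c'}))
      = (\<Sum>(c, c')\<in>(SIGMA c:?A. removable (insert c D) - {c}). ?f (insert c D - {c'}))"
      using finA finite_removable cA by (intro sum.Sigma) auto
    also have "\<dots> = (\<Sum>(c', c)\<in>(SIGMA c':?R. addable (D - {c'}) - {c'}). ?f (insert c (D - {c'})))"
    proof (rule sum.reindex_bij_witness[where i = "\<lambda>(c', c). (c, c')" and j = "\<lambda>(c, c'). (c', c)"])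
      fix a assume a: "a \<in> (SIGMA c:?A. removable (insert c D) - {c})"
      then show "(case a of (c, c') \<Rightarrow> (c', c)) \<in> (SIGMA c':?R. addable (D - {c'}) - {c'})"
        using add_remove_swap[OF D, of "fst a" "snd a"] by (auto simp: split_beta)
      have "insert (fst a) (D - {snd a}) = insert (fst a) D - {snd a}" using a by auto
      then show "(case case a of (c, c') \<Rightarrow> (c', c) of (c', c) \<Rightarrow> ?f (insert c (D - {c'})))
          = (case a of (c, c') \<Rightarrow> ?f (insert c D - {c'}))"
        by (simp add: split_beta)
    next
      fix b assume b: "b \<in> (SIGMA c':?R. addable (D - {c'}) - {c'})"
      then show "(case b of (c', c) \<Rightarrow> (c, c')) \<in> (SIGMA c:?A. removable (insert c D) - {c})"
        using add_remove_swap[OF D, of "snd b" "fst b"] by (auto simp: split_beta)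
    qed auto
    also have "\<dots> = (\<Sum>c'\<in>?R. \<Sum>c\<in>addable (D - {c'}) - {c'}. ?f (insert c (D - {c'})))"
      using finite_removable[OF D] card_addable(1) cR by (intro sum.Sigma[symmetric]) auto
    finally show ?thesis .
  qed
  have down: "(\<Sum>c\<in>addable (D - {c'}) - {c'}. ?f (insert c (D - {c'}))) + ?f D = card D * ?f (D - {c'})"
    if c': "c' \<in> ?R" for c'
  proof -
    have card: "card D = Suc (card (D - {c'}))" using card.remove[OF young_finite[OF D] cR(2)[OF c']] .
    have ins: "insert c' (D - {c'}) = D" using cR(2)[OF c'] by auto
    have "c' \<in> addable (D - {c'})" unfolding addable_def mem_Collect_eq ins using D by simp
    then have "(\<Sum>c\<in>addable (D - {c'}). ?f (insert c (D - {c'})))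
        = ?f D + (\<Sum>c\<in>addable (D - {c'}) - {c'}. ?f (insert c (D - {c'})))"
      using sum.remove[OF card_addable(1)[OF cR(1)[OF c']], of c' "\<lambda>c. ?f (insert c (D - {c'}))"]
      by (simp only: ins)
    moreover have "(\<Sum>c\<in>addable (D - {c'}). ?f (insert c (D - {c'}))) = card D * ?f (D - {c'})"
      using less.hyps[OF _ cR(1)[OF c']] card by simp
    ultimately show ?thesis by simp
  qed
  \<comment> \<open>The factor \<open>card D\<close> covers the empty diagram, where the recursion
    does not apply.\<close>
  have rec: "card D * (\<Sum>c'\<in>?R. ?f (D - {c'})) = card D * ?f D"
    using num_fillings_rec[OF D, of 0] by (cases "card D = 0") auto
  \<comment> \<open>The summand \<open>card ?R * ?f D\<close> is added on both sides to stay clear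
    of subtraction of natural numbers.\<close>
  have "(\<Sum>c\<in>?A. ?f (insert c D)) + card ?R * ?f D
      = card ?A * ?f D + ((\<Sum>c'\<in>?R. \<Sum>c\<in>addable (D - {c'}) - {c'}. ?f (insert c (D - {c'}))) + card ?R * ?f D)"
    using up by (simp add: sum.distrib swap)
  also have "(\<Sum>c'\<in>?R. \<Sum>c\<in>addable (D - {c'}) - {c'}. ?f (insert c (D - {c'}))) + card ?R * ?f D
     = (\<Sum>c'\<in>?R. card D * ?f (D - {c'}))"
    using down by (simp flip: down add: sum.distrib)
  also have "\<dots> = card D * ?f D" using rec by (simp add: sum_distrib_left)
  finally show ?case by (simp add: cardA)
qed

section \<open>Sums over all diagrams of a given size\<close>

definition young_of_size :: "nat \<Rightarrow> (nat \<times> nat) set set" where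
  "young_of_size n = {D. young D \<and> card D = n}"

lemma young_subset_square:
  assumes D: "young D" and ij: "(i, j) \<in> D"
  shows "i < card D" "j < card D"
proof -
  have "(\<lambda>a. (a, j)) ` {..i} \<subseteq> D" "Pair i ` {..j} \<subseteq> D" using young_down[OF D ij] by auto
  then have "card ((\<lambda>a. (a, j)) ` {..i}) \<le> card D" "card (Pair i ` {..j}) \<le> card D"
    using young_finite[OF D] by (auto intro: card_mono)
  then show "i < card D" "j < card D" by (auto simp: card_image inj_on_def)
qed

lemma finite_young_of_size: "finite (young_of_size n)"
proof (rule finite_subset)
  show "young_of_size n \<subseteq> Pow ({..<n} \<times> {..<n})"
    using young_subset_square by (force simp: young_of_size_def)
qed simp

lemma young_row_zero: "young ({0} \<times> {..<m})"
  by (auto simp: young_def)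

lemma removable_row_zero: "removable ({0} \<times> {..<Suc m}) = {(0, m)}"
proof -
  have r: "row_len ({0} \<times> {..<Suc m}) i = (if i = 0 then Suc m else 0)" for i
    by (auto simp: row_len_def)
  have "{i. row_len ({0} \<times> {..<Suc m}) (Suc i) < row_len ({0} \<times> {..<Suc m}) i} = {0}"
    by (auto simp: r)
  then show ?thesis by (simp add: removable_eq[OF young_row_zero] r)
qed

lemma num_fillings_row_zero: "num_fillings 0 ({0} \<times> {..<m}) = 1"
proof (induction m)
  case (Suc m)
  have "{0::nat} \<times> {..<Suc m} - {(0, m)} = {0} \<times> {..<m}" by auto
  then show ?case
    using num_fillings_rec[OF young_row_zero, of 0 "Suc m"] Suc
    by (simp add: removable_row_zero)
qed (simp add: num_fillings_empty)

text \<open>The starting point of the recursion: all entries are at most \<open>m\<close>, so all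
  cells lie in row 0.\<close>

lemma num_fillings_same_size:
  assumes D: "young D" and m: "card D = m"
  shows "num_fillings m D = (if D = {0} \<times> {..<m} then 1 else 0)"
proof (cases "D = {0} \<times> {..<m}")
  case True
  then have "fillings m D = fillings 0 D" by (auto simp: fillings_def)
  then have "num_fillings m D = num_fillings 0 D" by (simp add: num_fillings_def)
  then show ?thesis using True by (simp add: num_fillings_row_zero)
next
  case False
  have "fillings m D = {}"
  proof (rule equals0I)
    fix t assume t: "t \<in> fillings m D"
    have "fst c = 0" if "c \<in> D" for c
      using fillingsD(5)[OF t that] bij_betw_apply[OF fillingsD(2)[OF t] that] m by simp
    then have "D \<subseteq> {0} \<times> {..<m}" using young_subset_square(2)[OF D] m by force
    then have "D = {0} \<times> {..<m}" by (rule card_subset_eq[rotated]) (auto simp: m)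
    then show False using False by contradiction
  qed
  then show ?thesis using False by (simp add: num_fillings_def)
qed

text \<open>In the induction step only \<open>num_fillings m\<close> is expanded by the recursion.
  Exchanging the sums turns the other factor into a sum over addable cells, which
  \<open>sum_addable\<close> evaluates to the factor \<open>Suc (m + d)\<close>.\<close>

lemma sum_num_fillings:
  "(\<Sum>D\<in>young_of_size (m + d). num_fillings m D * num_fillings 0 D) * fact m = fact (m + d)"
proof (induction d)
  case 0
  have "(\<Sum>D\<in>young_of_size m. num_fillings m D * num_fillings 0 D)
      = (\<Sum>D\<in>young_of_size m. if D = {0} \<times> {..<m} then 1 else 0)"
    by (intro sum.cong) (auto simp: young_of_size_def num_fillings_same_size num_fillings_row_zero)
  also have "\<dots> = 1"
    using finite_young_of_size[of m] young_row_zero[of m] by (simp add: young_of_size_def)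
  finally show ?case by simp
next
  case (Suc d)
  let ?n = "m + d"
  have "(\<Sum>D\<in>young_of_size (Suc ?n). num_fillings m D * num_fillings 0 D)
     = (\<Sum>D\<in>young_of_size (Suc ?n). \<Sum>c\<in>removable D. num_fillings m (D - {c}) * num_fillings 0 D)"
    by (intro sum.cong refl) (auto simp: young_of_size_def num_fillings_rec[of _ m] sum_distrib_right)
  also have "\<dots> = (\<Sum>(D, c)\<in>(SIGMA D:young_of_size (Suc ?n). removable D). num_fillings m (D - {c}) * num_fillings 0 D)"
    using finite_young_of_size by (intro sum.Sigma) (auto simp: young_of_size_def finite_removable)
  also have "\<dots> = (\<Sum>(E, c)\<in>(SIGMA E:young_of_size ?n. addable E). num_fillings m E * num_fillings 0 (insert c E))"
  proof (rule sum.reindex_bij_witness[where i = "\<lambda>(E, c). (insert c E, c)" and j = "\<lambda>(D, c). (D - {c}, c)"])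
    fix a assume "a \<in> (SIGMA D:young_of_size (Suc ?n). removable D)"
    then obtain D c where a: "a = (D, c)" "young D" "card D = Suc ?n" "c \<in> D" "young (D - {c})"
      by (auto simp: young_of_size_def removable_def)
    have "card (D - {c}) = ?n" using card.remove[OF young_finite[OF a(2)] a(4)] a(3) by simp
    moreover have ins: "insert c (D - {c}) = D" using a(4) by auto
    ultimately show "(case a of (D, c) \<Rightarrow> (D - {c}, c)) \<in> (SIGMA E:young_of_size ?n. addable E)"
      using a by (auto simp: young_of_size_def addable_def)
    show "(case case a of (D, c) \<Rightarrow> (D - {c}, c) of (E, c) \<Rightarrow> (insert c E, c)) = a"
      using a ins by simp
    show "(case case a of (D, c) \<Rightarrow> (D - {c}, c) of (E, c) \<Rightarrow> num_fillings m E * num_fillings 0 (insert c E))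
        = (case a of (D, c) \<Rightarrow> num_fillings m (D - {c}) * num_fillings 0 D)"
      using a ins by simp
  next
    fix b assume "b \<in> (SIGMA E:young_of_size ?n. addable E)"
    then obtain E c where b: "b = (E, c)" "young E" "card E = ?n" "c \<notin> E" "young (insert c E)"
      by (auto simp: young_of_size_def addable_def)
    then show "(case b of (E, c) \<Rightarrow> (insert c E, c)) \<in> (SIGMA D:young_of_size (Suc ?n). removable D)"
      using young_finite[OF b(2)] by (auto simp: young_of_size_def removable_def)
    show "(case case b of (E, c) \<Rightarrow> (insert c E, c) of (D, c) \<Rightarrow> (D - {c}, c)) = b"
      using b by simp
  qed
  also have "\<dots> = (\<Sum>E\<in>young_of_size ?n. \<Sum>c\<in>addable E. num_fillings m E * num_fillings 0 (insert c E))"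
    using finite_young_of_size by (intro sum.Sigma[symmetric]) (auto simp: young_of_size_def card_addable(1))
  also have "\<dots> = (\<Sum>E\<in>young_of_size ?n. Suc ?n * (num_fillings m E * num_fillings 0 E))"
    by (intro sum.cong refl) (auto simp: young_of_size_def sum_addable algebra_simps simp flip: sum_distrib_left)
  also have "\<dots> = Suc ?n * (\<Sum>E\<in>young_of_size ?n. num_fillings m E * num_fillings 0 E)"
    by (simp only: sum_distrib_left)
  finally show ?case using Suc by (simp add: algebra_simps)
qed

section \<open>Separating the first row from the lower rows\<close>

definition lower_rows :: "(nat \<times> nat) set \<Rightarrow> (nat \<times> nat) set" where
  "lower_rows D = {(i, j). (Suc i, j) \<in> D}"

lemma young_lower_rows:
  assumes "young D"
  shows "young (lower_rows D)"
proof -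
  have "finite (lower_rows D)"
  proof (rule finite_subset)
    show "lower_rows D \<subseteq> (\<lambda>(i, j). (i - 1, j)) ` D" by (force simp: lower_rows_def)
  qed (use young_finite[OF assms] in simp)
  then show ?thesis
    using young_down[OF assms] unfolding young_def lower_rows_def by (auto intro: Suc_le_mono[THEN iffD2])
qed

lemma card_row_zero_lower:
  assumes D: "young D"
  shows "card D = row_len D 0 + card (lower_rows D)"
proof -
  have "D = Pair 0 ` {..<row_len D 0} \<union> (\<lambda>(i, j). (Suc i, j)) ` lower_rows D"
  proof (intro equalityI subsetI)
    fix c assume "c \<in> D"
    moreover obtain i j where "c = (i, j)" by (cases c)
    ultimately show "c \<in> Pair 0 ` {..<row_len D 0} \<union> (\<lambda>(i, j). (Suc i, j)) ` lower_rows D"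
      using young_row[OF D] by (cases i) (auto simp: lower_rows_def image_iff)
  qed (auto simp: lower_rows_def young_row[OF D])
  then have "card D = card (Pair 0 ` {..<row_len D 0} \<union> (\<lambda>(i, j). (Suc i, j)) ` lower_rows D)" by simp
  also have "\<dots> = card (Pair (0::nat) ` {..<row_len D 0}) + card ((\<lambda>(i, j). (Suc i, j)) ` lower_rows D)"
    using young_finite[OF young_lower_rows[OF D]] by (intro card_Un_disjoint) auto
  also have "\<dots> = row_len D 0 + card (lower_rows D)"
    by (simp add: card_image inj_on_def split_beta prod_eq_iff)
  finally show ?thesis .
qed

lemma row_len_lower_rows: "row_len (lower_rows D) i = row_len D (Suc i)"
  by (simp add: row_len_def lower_rows_def)

lemma removable_split:
  assumes D: "young D"
  shows "removable D = (if row_len D 1 < row_len D 0 then {(0, row_len D 0 - 1)} else {})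
    \<union> (\<lambda>(i, j). (Suc i, j)) ` removable (lower_rows D)"
proof -
  let ?r = "row_len D"
  have "{i. ?r (Suc i) < ?r i} = (if ?r 1 < ?r 0 then {0} else {}) \<union> Suc ` {i. ?r (Suc (Suc i)) < ?r (Suc i)}"
  proof (intro equalityI subsetI)
    fix i assume "i \<in> {i. ?r (Suc i) < ?r i}"
    then show "i \<in> (if ?r 1 < ?r 0 then {0} else {}) \<union> Suc ` {i. ?r (Suc (Suc i)) < ?r (Suc i)}"
      by (cases i) auto
  qed (auto split: if_splits)
  then show ?thesis
    unfolding removable_eq[OF D] removable_eq[OF young_lower_rows[OF D]] row_len_lower_rows
    by (simp add: image_Un image_image)
qed

text \<open>Pascal's rule: the largest entry either ends row 0, which leaves the lower rows intact,
  or ends one of the lower rows, which become smaller by one cell.\<close>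

lemma num_fillings_first_row:
  assumes "young D" "row_len D 1 \<le> m" "card D = m + d"
  shows "num_fillings m D = (d choose card (lower_rows D)) * num_fillings 0 (lower_rows D)"
  using assms
proof (induction d arbitrary: D)
  case 0
  note D = "0.prems"(1)
  have c: "card D = m" using "0.prems"(3) by simp
  have "D = {0} \<times> {..<m} \<longleftrightarrow> lower_rows D = {}"
  proof
    assume *: "lower_rows D = {}"
    have "fst c = 0" if "c \<in> D" for c
      using * that by (cases c; cases "fst c") (auto simp: lower_rows_def)
    then have "D \<subseteq> {0} \<times> {..<m}" using young_subset_square(2)[OF D] c by force
    then show "D = {0} \<times> {..<m}" by (rule card_subset_eq[rotated]) (auto simp: c)
  qed (auto simp: lower_rows_def)
  then show ?case
    using num_fillings_same_size[OF D c] young_finite[OF young_lower_rows[OF D]]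
    by (auto simp: num_fillings_empty card_gt_0_iff)
next
  case (Suc d)
  note D = Suc.prems(1)
  let ?B = "lower_rows D" and ?r = "row_len D"
  let ?k = "card ?B"
  have fin: "finite (removable ?B)" by (rule finite_removable[OF young_lower_rows[OF D]])
  have sub: "row_len (D - {c}) 1 \<le> m" for c
  proof -
    have "row_len (D - {c}) 1 \<le> row_len D 1"
      unfolding row_len_def
    proof (rule card_mono)
      show "finite {j. (1, j) \<in> D}" by (simp add: young_row[OF D])
    qed auto
    then show ?thesis using Suc.prems(2) by simp
  qed
  have IH: "num_fillings m (D - {c}) = (d choose card (lower_rows (D - {c}))) * num_fillings 0 (lower_rows (D - {c}))"
    if c: "c \<in> removable D" for c
  proof (rule Suc.IH[OF _ sub])
    show "young (D - {c})" using c by (simp add: removable_def)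
    show "card (D - {c}) = m + d"
      using c Suc.prems(3) by (simp add: removable_def)
  qed
  have "num_fillings m D = (\<Sum>c\<in>removable D. num_fillings m (D - {c}))"
    by (rule num_fillings_rec[OF D]) (simp add: Suc.prems(3))
  also have "\<dots> = (\<Sum>c\<in>(if ?r 1 < ?r 0 then {(0, ?r 0 - 1)} else {}). num_fillings m (D - {c}))
     + (\<Sum>c\<in>(\<lambda>(i, j). (Suc i, j)) ` removable ?B. num_fillings m (D - {c}))"
    unfolding removable_split[OF D] by (rule sum.union_disjoint) (auto simp: fin)
  also have "(\<Sum>c\<in>(if ?r 1 < ?r 0 then {(0, ?r 0 - 1)} else {}). num_fillings m (D - {c}))
      = (d choose ?k) * num_fillings 0 ?B"
  proof (cases "?r 1 < ?r 0")
    case True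
    then have "(0, ?r 0 - 1) \<in> removable D" by (subst removable_split[OF D]) simp
    moreover have "lower_rows (D - {(0, ?r 0 - 1)}) = ?B" by (auto simp: lower_rows_def)
    ultimately show ?thesis using IH True by simp
  next
    case False
    \<comment> \<open>Row 0 is no longer than row 1 and so has at most \<open>m\<close> cells. The
      lower rows then hold more than \<open>d\<close> cells, and the binomial coefficient vanishes
      just as the empty sum does.\<close>
    then have "d < ?k" using card_row_zero_lower[OF D] Suc.prems(2,3) by simp
    then show ?thesis using False by (simp add: binomial_eq_0)
  qed
  also have "(\<Sum>c\<in>(\<lambda>(i, j). (Suc i, j)) ` removable ?B. num_fillings m (D - {c}))
     = (\<Sum>c\<in>removable ?B. (d choose (?k - 1)) * num_fillings 0 (?B - {c}))"
  proof (subst sum.reindex)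
    show "inj_on (\<lambda>(i, j). (Suc i, j)) (removable ?B)" by (auto simp: inj_on_def)
    show "sum ((\<lambda>c. num_fillings m (D - {c})) \<circ> (\<lambda>(i, j). (Suc i, j))) (removable ?B)
        = (\<Sum>c\<in>removable ?B. (d choose (?k - 1)) * num_fillings 0 (?B - {c}))"
    proof (rule sum.cong[OF refl])
      fix c assume c: "c \<in> removable ?B"
      obtain i j where ij: "c = (i, j)" by (cases c)
      have "(Suc i, j) \<in> (\<lambda>(i, j). (Suc i, j)) ` removable ?B"
        using c ij by (intro image_eqI[of _ _ c]) auto
      then have "(Suc i, j) \<in> removable D" by (subst removable_split[OF D]) blast
      moreover have "lower_rows (D - {(Suc i, j)}) = ?B - {c}" by (auto simp: lower_rows_def ij)
      moreover have "card (?B - {c}) = ?k - 1" using c by (simp add: removable_def)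
      ultimately show "((\<lambda>c. num_fillings m (D - {c})) \<circ> (\<lambda>(i, j). (Suc i, j))) c
          = (d choose (?k - 1)) * num_fillings 0 (?B - {c})"
        using IH ij by simp
    qed
  qed
  also have "\<dots> = (d choose (?k - 1)) * (\<Sum>c\<in>removable ?B. num_fillings 0 (?B - {c}))"
    by (simp only: sum_distrib_left)
  finally have main: "num_fillings m D = (d choose ?k) * num_fillings 0 ?B
      + (d choose (?k - 1)) * (\<Sum>c\<in>removable ?B. num_fillings 0 (?B - {c}))" .
  show ?case
  proof (cases ?k)
    \<comment> \<open>Here \<open>?k - 1\<close> is truncated, but its term carries an empty
      sum.\<close>
    case 0
    then have "?B = {}" using young_finite[OF young_lower_rows[OF D]] by simp
    then show ?thesis using main 0 by (simp add: removable_def)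
  next
    case (Suc k)
    then have "(\<Sum>c\<in>removable ?B. num_fillings 0 (?B - {c})) = num_fillings 0 ?B"
      using num_fillings_rec[OF young_lower_rows[OF D], of 0] by simp
    then show ?thesis using main Suc by (simp add: algebra_simps)
  qed
qed

section \<open>Partitions as diagrams\<close>

lemma fillings_diagram:
  "fillings m (diagram lam) = {t\<in>standard_tableaux lam. \<forall>c\<in>diagram lam. t c \<le> m \<longrightarrow> fst c = 0}"
  unfolding fillings_def standard_tableaux_def card_diagram by blast

lemma num_SYT_eq: "num_SYT lam = num_fillings 0 (diagram lam)"
proof -
  have "fillings 0 (diagram lam) = standard_tableaux lam"
  proof (intro equalityI subsetI)
    fix t assume t: "t \<in> standard_tableaux lam"
    have "\<not> t c \<le> 0" if "c \<in> diagram lam" for c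
      using tableau_entry(1)[OF standard_tableauxD(1)[OF t], of "fst c" "snd c"] that by simp
    then show "t \<in> fillings 0 (diagram lam)" using t unfolding fillings_diagram by blast
  qed (simp add: fillings_diagram)
  then show ?thesis by (simp add: num_SYT_def num_fillings_def)
qed

lemma young_diagram:
  assumes "is_partition lam n"
  shows "young (diagram lam)"
  using diagram_row_le[OF assms] finite_diagram
  by (auto simp: young_def diagram_def) (meson le_less_trans)+

lemma row_len_diagram: "row_len (diagram lam) i = nth_default 0 lam i"
proof -
  have "{j. (i, j) \<in> diagram lam} = {..<nth_default 0 lam i}"
    by (auto simp: diagram_def nth_default_def)
  then show ?thesis by (simp add: row_len_def)
qed

lemma lower_rows_diagram: "lower_rows (diagram lam) = diagram (tl lam)"
  by (cases lam) (auto simp: lower_rows_def diagram_def)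

lemma diagram_bij: "bij_betw diagram {lam. is_partition lam n} (young_of_size n)"
proof (rule bij_betwI')
  fix lam mu assume lam: "lam \<in> {lam. is_partition lam n}" and mu: "mu \<in> {lam. is_partition lam n}"
  show "(diagram lam = diagram mu) = (lam = mu)"
  proof
    assume "diagram lam = diagram mu"
    then have "nth_default 0 lam i = nth_default 0 mu i" for i by (simp flip: row_len_diagram)
    then show "lam = mu" using lam mu by (intro nth_default_0_inject) (auto simp: is_partition_def)
  qed simp
next
  fix lam assume "lam \<in> {lam. is_partition lam n}"
  then show "diagram lam \<in> young_of_size n"
    using young_diagram[of lam n] card_diagram[of lam] by (simp add: young_of_size_def is_partition_def)
next
  fix D assume "D \<in> young_of_size n"
  then have D: "young D" "card D = n" by (auto simp: young_of_size_def)
  \<comment> \<open>The nonempty rows form an initial segment, whose length is the number of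
    parts.\<close>
  define R where "R = {i. 0 < row_len D i}"
  have "R \<subseteq> {..<n}" using young_subset_square(1)[OF D(1)] D(2) young_row[OF D(1)] by (force simp: R_def)
  then have "finite R" by (rule finite_subset) simp
  then have R: "R = {..<card R}"
    by (rule downset_nat_eq) (use row_len_antimono[OF D(1)] in \<open>auto simp: R_def intro: less_le_trans\<close>)
  define lam where "lam = map (row_len D) [0..<card R]"
  have pos: "0 < row_len D i \<longleftrightarrow> i < card R" for i using R by (auto simp: R_def)
  have eq: "diagram lam = D"
  proof (rule Set.set_eqI)
    fix c :: "nat \<times> nat"
    obtain i j where c: "c = (i, j)" by (cases c)
    show "c \<in> diagram lam \<longleftrightarrow> c \<in> D"
      using pos[of i] young_row[OF D(1)] by (auto simp: c diagram_def lam_def)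
  qed
  have "is_partition lam n"
    unfolding is_partition_def
  proof (intro conjI)
    show "sorted_wrt (\<ge>) lam"
      using row_len_antimono[OF D(1)] by (simp add: lam_def sorted_wrt_iff_nth_less)
    show "0 \<notin> set lam" using pos unfolding lam_def by (auto simp: image_iff)
    show "sum_list lam = n" using card_diagram[of lam] eq D(2) by simp
  qed
  then show "\<exists>lam\<in>{lam. is_partition lam n}. D = diagram lam" using eq by blast
qed

lemma sum_partitions:
  assumes "m \<le> n"
  shows "(\<Sum>lam | is_partition lam n. num_fillings m (diagram lam) * num_fillings 0 (diagram lam)) * fact m = fact n"
proof -
  have "(\<Sum>lam | is_partition lam n. num_fillings m (diagram lam) * num_fillings 0 (diagram lam))
      = (\<Sum>D\<in>young_of_size n. num_fillings m D * num_fillings 0 D)"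
    by (rule sum.reindex_bij_betw[OF diagram_bij])
  then show ?thesis using sum_num_fillings[of m "n - m"] assms by simp
qed

lemma finite_partitions: "finite {lam. is_partition lam n}"
  using bij_betw_finite[OF diagram_bij] finite_young_of_size by blast

section \<open>Characters of tensor powers and of tuples\<close>

definition num_fixed :: "nat \<Rightarrow> (nat \<Rightarrow> nat) \<Rightarrow> nat" where
  "num_fixed n g = card {x\<in>{1..n}. g x = x}"

lemma inv_fixed_iff:
  assumes "g permutes S"
  shows "inv' g x = x \<longleftrightarrow> g x = x"
  using permutes_inverses[OF assms] by metis

lemma num_fixed_inv:
  assumes "g permutes {1..n}"
  shows "num_fixed n (inv' g) = num_fixed n g"
  by (simp add: num_fixed_def inv_fixed_iff[OF assms])

section \<open>The character of the tensor power\<close>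

definition tuples :: "nat \<Rightarrow> nat \<Rightarrow> nat list set" where
  "tuples n r = {xs. set xs \<subseteq> {1..n} \<and> length xs = r}"

lemma finite_tuples: "finite (tuples n r)"
  unfolding tuples_def by (rule finite_lists_length_eq) simp

lemma tuples_Suc: "tuples n (Suc r) = (\<lambda>(x, xs). x # xs) ` ({1..n} \<times> tuples n r)"
proof (intro equalityI subsetI)
  fix xs assume "xs \<in> tuples n (Suc r)"
  then show "xs \<in> (\<lambda>(x, xs). x # xs) ` ({1..n} \<times> tuples n r)"
    by (cases xs) (auto simp: tuples_def)
qed (auto simp: tuples_def)

lemma sum_tuples_prod:
  fixes F :: "nat \<Rightarrow> nat \<Rightarrow> complex"
  shows "(\<Sum>xs\<in>tuples n r. \<Prod>j<r. F j (xs ! j)) = (\<Prod>j<r. \<Sum>x\<in>{1..n}. F j x)"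
proof (induction r arbitrary: F)
  case 0
  have "tuples n 0 = {[]}" by (auto simp: tuples_def)
  then show ?case by simp
next
  case (Suc r)
  have inj: "inj_on (\<lambda>(x, xs). x # xs) ({1..n} \<times> tuples n r)" by (auto simp: inj_on_def)
  have "(\<Sum>xs\<in>tuples n (Suc r). \<Prod>j<Suc r. F j (xs ! j))
      = (\<Sum>(x, xs)\<in>{1..n} \<times> tuples n r. F 0 x * (\<Prod>j<r. F (Suc j) (xs ! j)))"
    unfolding tuples_Suc sum.reindex[OF inj]
    by (intro sum.cong refl) (auto simp: prod.lessThan_Suc_shift simp del: prod.lessThan_Suc)
  also have "\<dots> = (\<Sum>x\<in>{1..n}. F 0 x) * (\<Sum>xs\<in>tuples n r. \<Prod>j<r. F (Suc j) (xs ! j))"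
    by (simp add: sum.cartesian_product[symmetric] sum_product)
  also have "\<dots> = (\<Prod>j<Suc r. \<Sum>x\<in>{1..n}. F j x)"
    using Suc[of "\<lambda>j. F (Suc j)"] by (simp add: prod.lessThan_Suc_shift del: prod.lessThan_Suc)
  finally show ?case .
qed

text \<open>The unit function at \<open>y\<close> minus its mean, that is, its orthogonal projection
  onto \<open>standard_rep n\<close>.\<close>

definition centered :: "nat \<Rightarrow> nat \<Rightarrow> nat \<Rightarrow> complex" where
  "centered n y = (\<lambda>x. if x \<in> {1..n} then (if x = y then 1 else 0) - 1 / of_nat n else 0)"

lemma centered_standard:
  assumes "y \<in> {1..n}"
  shows "centered n y \<in> standard_rep n"
  using assms by (auto simp: standard_rep_def centered_def sum_subtractf)

lemma sum_centered:
  assumes v: "v \<in> standard_rep n"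
  shows "(\<Sum>y\<in>{1..n}. v y * centered n y x) = v x"
proof (cases "x \<in> {1..n}")
  case True
  have "(\<Sum>y\<in>{1..n}. v y * centered n y x) = (\<Sum>y\<in>{1..n}. (if x = y then v y else 0) - v y / of_nat n)"
    using True by (intro sum.cong) (auto simp: centered_def algebra_simps)
  also have "\<dots> = v x - (\<Sum>y\<in>{1..n}. v y) / of_nat n"
    using True by (simp add: sum_subtractf sum_divide_distrib)
  finally show ?thesis using v by (simp add: standard_rep_def)
next
  case False
  then show ?thesis using v by (auto simp: centered_def standard_rep_def)
qed

text \<open>The \<open>r\<close>-fold tensor power of the orthogonal projection onto
  \<open>standard_rep n\<close>. Unlike the arbitrary choice \<open>projection\<close>, it is
  explicit enough for its trace to be computed.\<close>

definition tensor_projection :: "nat \<Rightarrow> nat \<Rightarrow> (nat list \<Rightarrow> complex) \<Rightarrow> nat list \<Rightarrow> complex" where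
  "tensor_projection n r f = (\<Sum>ys\<in>tuples n r. cscale (f ys) (pure_tensor (map (centered n) ys)))"

lemma pure_tensor_standard:
  assumes "ys \<in> tuples n r"
  shows "pure_tensor (map (centered n) ys) \<in> tensor_power r (standard_rep n)"
  unfolding tensor_power_def
proof (rule cfun.span_base, intro CollectI exI conjI)
  show "length (map (centered n) ys) = r" using assms by (simp add: tuples_def)
  show "set (map (centered n) ys) \<subseteq> standard_rep n"
    using assms centered_standard by (auto simp: tuples_def)
qed (rule refl)

lemma tensor_power_supported: "tensor_power r (standard_rep n) \<subseteq> supported (tuples n r)"
  unfolding tensor_power_def
proof (rule cfun.span_minimal[OF _ subspace_supported], safe)
  fix vs assume vs: "r = length vs" "set vs \<subseteq> standard_rep n"
  have "pure_tensor vs xs = 0" if xs: "xs \<notin> tuples n (length vs)" for xs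
  proof (cases "length xs = length vs")
    case True
    with xs obtain j where j: "j < length vs" "xs ! j \<notin> {1..n}"
      by (auto simp: tuples_def set_conv_nth subset_iff)
    then have "vs ! j \<in> standard_rep n" using vs by auto
    then have "(vs ! j) (xs ! j) = 0" using j unfolding standard_rep_def by blast
    then show ?thesis using j True by (auto simp: pure_tensor_def)
  qed (simp add: pure_tensor_def)
  then show "pure_tensor vs \<in> supported (tuples n (length vs))" by (simp add: supported_def)
qed

text \<open>On a pure tensor the sum over tuples factors, and \<open>sum_centered\<close> reproduces
  each factor.\<close>

lemma tensor_projection_pure:
  assumes vs: "length vs = r" "set vs \<subseteq> standard_rep n"
  shows "tensor_projection n r (pure_tensor vs) = pure_tensor vs"
proof
  fix xs
  show "tensor_projection n r (pure_tensor vs) xs = pure_tensor vs xs"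
  proof (cases "length xs = r")
    case True
    have "tensor_projection n r (pure_tensor vs) xs
        = (\<Sum>ys\<in>tuples n r. \<Prod>j<r. (vs ! j) (ys ! j) * centered n (ys ! j) (xs ! j))"
      unfolding tensor_projection_def sum_fun_apply
    proof (rule sum.cong[OF refl])
      fix ys assume "ys \<in> tuples n r"
      then have "length ys = r" by (simp add: tuples_def)
      then show "cscale (pure_tensor vs ys) (pure_tensor (map (centered n) ys)) xs
          = (\<Prod>j<r. (vs ! j) (ys ! j) * centered n (ys ! j) (xs ! j))"
        using True vs(1) by (simp add: cscale_def pure_tensor_def prod.distrib)
    qed
    also have "\<dots> = (\<Prod>j<r. \<Sum>y\<in>{1..n}. (vs ! j) y * centered n y (xs ! j))"
      by (rule sum_tuples_prod)
    also have "\<dots> = (\<Prod>j<r. (vs ! j) (xs ! j))"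
      using vs by (intro prod.cong refl sum_centered) auto
    finally show ?thesis using True vs(1) by (simp add: pure_tensor_def)
  next
    case False
    then have "tensor_projection n r (pure_tensor vs) xs = 0"
      unfolding tensor_projection_def sum_fun_apply
      by (intro sum.neutral) (auto simp: cscale_def pure_tensor_def tuples_def)
    then show ?thesis using False vs(1) by (simp add: pure_tensor_def)
  qed
qed

lemma tensor_projection_lin: "lin (tensor_projection n r)"
  unfolding tensor_projection_def
  by (rule linear_map_on_sum_ops) (auto simp: linear_map_on_def cscale_def fun_eq_iff algebra_simps)

lemma is_projection_tensor:
  "is_projection (tensor_power r (standard_rep n)) (tensor_projection n r)"
  unfolding is_projection_def
proof (intro conjI ballI)
  show "lin (tensor_projection n r)" by (rule tensor_projection_lin)
  show "range (tensor_projection n r) \<subseteq> tensor_power r (standard_rep n)"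
  proof safe
    fix f
    show "tensor_projection n r f \<in> tensor_power r (standard_rep n)"
      unfolding tensor_projection_def
      by (intro cfun.subspace_sum cfun.subspace_scale pure_tensor_standard)
        (simp_all add: tensor_power_def)
  qed
  fix v assume "v \<in> tensor_power r (standard_rep n)"
  then show "tensor_projection n r v = v"
    unfolding tensor_power_def
  proof (induction rule: cfun.span_induct_alt)
    case base
    show ?case by (rule linear_map_on_0[OF tensor_projection_lin cfun.subspace_UNIV])
  next
    case (step c x y)
    then have "tensor_projection n r x = x" using tensor_projection_pure by blast
    then have "tensor_projection n r (cscale c x + y) = cscale c x + y"
      using step.IH linear_map_onD[OF tensor_projection_lin[of n r]] by (simp only: UNIV_I)
    then show ?case .
  qed
qed

text \<open>The trace is a sum over tuples of products, so it factors into \<open>r\<close> equal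
  traces on one tensor factor. There the terms \<open>1 / of_nat n\<close> add up to 1, which is
  where \<open>n > 0\<close> enters.\<close>

lemma char_on_tensor_power:
  assumes g: "g permutes {1..n}" and "n > 0"
  shows "char_on (tuples n r) tuple_action (tensor_power r (standard_rep n)) g
    = (of_nat (num_fixed n g) - 1) ^ r"
proof -
  have "char_on (tuples n r) tuple_action (tensor_power r (standard_rep n)) g
      = trace_on (tuples n r) (tuple_action g \<circ> tensor_projection n r)"
    using g by (intro char_on_eq_trace[OF group_rep_tensor_power finite_tuples tensor_power_supported is_projection_tensor])
      (simp add: sym_group_carrier)
  also have "\<dots> = (\<Sum>xs\<in>tuples n r. \<Prod>j<r. centered n (xs ! j) (inv' g (xs ! j)))"
    unfolding trace_on_def
  proof (rule sum.cong[OF refl])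
    fix xs assume xs: "xs \<in> tuples n r"
    have "tensor_projection n r (unit_fun xs) = pure_tensor (map (centered n) xs)"
    proof
      fix zs
      have "tensor_projection n r (unit_fun xs) zs
          = (\<Sum>ys\<in>tuples n r. if ys = xs then pure_tensor (map (centered n) ys) zs else 0)"
        unfolding tensor_projection_def sum_fun_apply
        by (intro sum.cong) (auto simp: cscale_def unit_fun_def)
      then show "tensor_projection n r (unit_fun xs) zs = pure_tensor (map (centered n) xs) zs"
        using xs finite_tuples by (simp add: sum.delta)
    qed
    then show "(tuple_action g \<circ> tensor_projection n r) (unit_fun xs) xs
        = (\<Prod>j<r. centered n (xs ! j) (inv' g (xs ! j)))"
      using xs by (simp add: fun_action_def pure_tensor_def tuples_def)
  qed
  also have "\<dots> = (\<Prod>j<r. \<Sum>x\<in>{1..n}. centered n x (inv' g x))"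
    by (rule sum_tuples_prod)
  also have "(\<Sum>x\<in>{1..n}. centered n x (inv' g x)) = (\<Sum>x\<in>{1..n}. (if g x = x then 1 else 0) - 1 / of_nat n)"
  proof (rule sum.cong[OF refl])
    fix x assume "x \<in> {1..n}"
    then have "inv' g x \<in> {1..n}" using permutes_in_image[OF permutes_inv[OF g]] by simp
    then show "centered n x (inv' g x) = (if g x = x then 1 else 0) - 1 / of_nat n"
      by (simp add: centered_def inv_fixed_iff[OF g])
  qed
  also have "\<dots> = of_nat (num_fixed n g) - 1"
    using \<open>n > 0\<close> by (simp add: sum_subtractf num_fixed_def sum.If_cases Int_def)
  finally show ?thesis by simp
qed

text \<open>For \<open>i \<le> n\<close> the functions on these tuples form the module induced from
  the trivial representation of the symmetric group on \<open>n - i\<close> letters: the stabilizer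
  of a tuple permutes the letters that do not occur in it.\<close>

definition inj_tuples :: "nat \<Rightarrow> nat \<Rightarrow> nat list set" where
  "inj_tuples n i = {xs. length xs = i \<and> distinct xs \<and> set xs \<subseteq> {1..n}}"

lemma finite_inj_tuples: "finite (inj_tuples n i)"
  by (rule finite_subset[OF _ finite_tuples[of n i]]) (auto simp: inj_tuples_def tuples_def)

lemma map_fixed_iff: "map g xs = xs \<longleftrightarrow> (\<forall>x\<in>set xs. g x = x)"
  by (metis map_idI map_eq_conv list.map_ident)

lemma group_rep_inj_tuples:
  "group_rep (sym_group n) tuple_action (supported (inj_tuples n i))"
proof (rule group_rep_fun_action[OF finite_inj_tuples subspace_supported])
  fix p :: "nat \<Rightarrow> nat" and f assume p: "p permutes {1..n}" and f: "f \<in> supported (inj_tuples n i)"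
  have "map (inv' p) xs \<in> inj_tuples n i \<longleftrightarrow> xs \<in> inj_tuples n i" for xs
    using permutes_in_image[OF permutes_inv[OF p]] permutes_inj[OF permutes_inv[OF p]]
    by (auto simp: inj_tuples_def distinct_map inj_on_subset)
  then show "tuple_action p f \<in> supported (inj_tuples n i)"
    using f by (auto simp: supported_def fun_action_def)
qed (auto simp: supported_def)

definition num_fixed_tuples :: "nat \<Rightarrow> nat \<Rightarrow> (nat \<Rightarrow> nat) \<Rightarrow> nat" where
  "num_fixed_tuples n i g = card {xs\<in>inj_tuples n i. map g xs = xs}"

lemma num_fixed_tuples_inv:
  assumes "g permutes {1..n}"
  shows "num_fixed_tuples n i (inv' g) = num_fixed_tuples n i g"
  unfolding num_fixed_tuples_def map_fixed_iff inv_fixed_iff[OF assms] ..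

lemma char_on_inj_tuples:
  assumes g: "g permutes {1..n}"
  shows "char_on (inj_tuples n i) tuple_action (supported (inj_tuples n i)) g = of_nat (num_fixed_tuples n i g)"
proof -
  let ?X = "inj_tuples n i"
  let ?P = "\<lambda>f x. if x \<in> ?X then f x else 0 :: complex"
  have "is_projection (supported ?X) ?P"
    by (auto simp: is_projection_def linear_map_on_def cscale_def supported_def fun_eq_iff)
  then have "char_on ?X tuple_action (supported ?X) g = trace_on ?X (tuple_action g \<circ> ?P)"
    using g by (intro char_on_eq_trace[OF group_rep_inj_tuples finite_inj_tuples subset_refl])
      (simp_all add: sym_group_carrier)
  also have "\<dots> = (\<Sum>xs\<in>?X. if map g xs = xs then 1 else 0)"
    unfolding trace_on_def
  proof (rule sum.cong[OF refl])
    fix xs assume "xs \<in> ?X"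
    then show "(tuple_action g \<circ> ?P) (unit_fun xs) xs = (if map g xs = xs then 1 else 0)"
      using map_fixed_iff[of "inv' g" xs] map_fixed_iff[of g xs]
      by (auto simp: fun_action_def unit_fun_def inv_fixed_iff[OF g])
  qed
  also have "\<dots> = of_nat (num_fixed_tuples n i g)"
    using finite_inj_tuples by (simp add: num_fixed_tuples_def sum.If_cases Int_def)
  finally show ?thesis .
qed

text \<open>Truncated subtraction is harmless: for \<open>i > x\<close> the factor with
  \<open>j = x\<close> is 0, as it is over the integers.\<close>

definition falling :: "nat \<Rightarrow> nat \<Rightarrow> nat" where
  "falling x i = (\<Prod>j<i. x - j)"

lemma falling_Suc: "falling x (Suc i) = falling x i * (x - i)"
  by (simp add: falling_def)

lemma falling_eq_0: "x < i \<Longrightarrow> falling x i = 0"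
  unfolding falling_def by (rule prod_zero) auto

lemma falling_fact:
  assumes "i \<le> n"
  shows "falling n i * fact (n - i) = fact n"
  using assms
proof (induction i)
  case (Suc i)
  then have "n - i = Suc (n - Suc i)" by simp
  then have "fact (n - i) = (n - i) * fact (n - Suc i)" by (metis fact_Suc of_nat_id)
  then show ?case using Suc by (simp add: falling_Suc mult.assoc)
qed (simp add: falling_def)

lemma card_distinct_lists:
  assumes "finite A"
  shows "card {xs. length xs = i \<and> distinct xs \<and> set xs \<subseteq> A} = falling (card A) i"
proof (cases "i \<le> card A")
  case True
  have "\<Prod>{card A - i + 1..card A} = falling (card A) i"
    unfolding falling_def
    by (rule prod.reindex_bij_witness[where i = "\<lambda>j. card A - j" and j = "\<lambda>x. card A - x"])
      (use True in auto)
  then show ?thesis using card_lists_distinct_length_eq[OF assms True] by simp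
next
  case False
  have "{xs. length xs = i \<and> distinct xs \<and> set xs \<subseteq> A} = {}"
  proof (rule equals0I)
    fix xs assume "xs \<in> {xs. length xs = i \<and> distinct xs \<and> set xs \<subseteq> A}"
    then have "i = card (set xs)" "set xs \<subseteq> A" by (auto simp: distinct_card)
    then show False using False card_mono[OF assms] by blast
  qed
  moreover have "falling (card A) i = 0" using False by (intro falling_eq_0) simp
  ultimately show ?thesis by (simp only: card.empty)
qed

lemma num_fixed_tuples_falling: "num_fixed_tuples n i g = falling (num_fixed n g) i"
proof -
  have "{xs\<in>inj_tuples n i. map g xs = xs}
      = {xs. length xs = i \<and> distinct xs \<and> set xs \<subseteq> {x\<in>{1..n}. g x = x}}"
    by (auto simp: inj_tuples_def map_fixed_iff)
  then show ?thesis
    unfolding num_fixed_tuples_def num_fixed_def by (simp only:) (rule card_distinct_lists, simp)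
qed

lemma card_inj_tuples: "card (inj_tuples n i) = falling n i"
  unfolding inj_tuples_def using card_distinct_lists[of "{1..n}" i] by simp

text \<open>Maps from an \<open>s\<close>-set to an \<open>x\<close>-set are sorted by their
  partition into fibres. The proof follows the recurrence of the Stirling numbers.\<close>

lemma power_eq_sum_Stirling: "x ^ s = (\<Sum>i\<le>s. Stirling s i * falling x i)"
proof (induction s)
  case 0
  show ?case by (simp add: falling_def)
next
  case (Suc s)
  have step: "falling x i * x = falling x (Suc i) + i * falling x i" for i
  proof (cases "i \<le> x")
    case True
    have "falling x i * ((x - i) + i) = falling x i * (x - i) + falling x i * i" by (rule distrib_left)
    then show ?thesis using True by (simp add: falling_Suc mult.commute)
  qed (simp add: falling_Suc falling_eq_0)
  \<comment> \<open>The boundary terms vanish: \<open>i = 0\<close> by its factor,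
    \<open>i = Suc s\<close> because \<open>Stirling s (Suc s) = 0\<close>.\<close>
  have shift: "(\<Sum>i\<le>s. Suc i * Stirling s (Suc i) * falling x (Suc i)) = (\<Sum>i\<le>s. i * Stirling s i * falling x i)"
  proof -
    have "(\<Sum>i\<le>Suc s. i * Stirling s i * falling x i)
        = (\<Sum>i\<le>s. Suc i * Stirling s (Suc i) * falling x (Suc i))"
      by (subst sum.atMost_Suc_shift) simp
    then show ?thesis by simp
  qed
  have "(\<Sum>i\<le>Suc s. Stirling (Suc s) i * falling x i) = (\<Sum>i\<le>s. Stirling (Suc s) (Suc i) * falling x (Suc i))"
    by (subst sum.atMost_Suc_shift) simp
  also have "\<dots> = (\<Sum>i\<le>s. Suc i * Stirling s (Suc i) * falling x (Suc i)) + (\<Sum>i\<le>s. Stirling s i * falling x (Suc i))"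
    by (simp add: sum.distrib[symmetric] algebra_simps)
  also have "\<dots> = (\<Sum>i\<le>s. Stirling s i * (falling x (Suc i) + i * falling x i))"
    unfolding shift by (simp add: sum.distrib[symmetric] algebra_simps)
  also have "\<dots> = (\<Sum>i\<le>s. Stirling s i * falling x i) * x"
    by (simp add: step[symmetric] sum_distrib_right mult.assoc)
  finally show ?case using Suc by simp
qed

section \<open>Multiplicities of Specht modules\<close>

lemma sym_group_inv:
  assumes "g permutes {1..n}"
  shows "inv\<^bsub>sym_group n\<^esub> g = inv' g"
proof -
  interpret group "sym_group n" by (rule sym_group_is_group)
  show ?thesis
    by (rule inv_equality)
      (use assms permutes_inv permutes_inv_o(2) in \<open>auto simp: sym_group_carrier sym_group_mult sym_group_one\<close>)
qed

lemma finite_sym_group: "finite (carrier (sym_group n))"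
  by (simp add: sym_group_def finite_permutations)

lemma card_sym_group: "card (carrier (sym_group n)) = fact n"
  by (simp add: sym_group_def card_permutations)

definition specht_char :: "nat \<Rightarrow> nat list \<Rightarrow> (nat \<Rightarrow> nat) \<Rightarrow> complex" where
  "specht_char n lam = char_on (tabloid_space n lam) tabloid_action (specht lam)"

definition fixed_dim :: "nat \<Rightarrow> nat list \<Rightarrow> nat" where
  "fixed_dim m lam = cfun.dim (fixed_space (sym_group m) tabloid_action (specht lam))"

lemma sum_specht_char_initial:
  assumes lam: "is_partition lam n" and "m \<le> n"
  shows "(\<Sum>g | g permutes {1..m}. specht_char n lam g) = fact m * of_nat (fixed_dim m lam)"
proof -
  have n: "sum_list lam = n" using lam by (simp add: is_partition_def)
  show ?thesis
    using sum_char_on[OF sym_group_is_group finite_sym_group group_rep_specht_le[OF assms]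
        finite_tabloid_space specht_supported[OF n]]
    unfolding card_sym_group specht_char_def fixed_dim_def by (simp add: sym_group_def)
qed

lemma permutes_conj:
  assumes h: "h permutes T" and u: "u permutes S"
  shows "h \<circ> u \<circ> inv' h permutes h ` S"
proof (rule bij_imp_permutes)
  have "bij_betw (inv' h) (h ` S) S"
    using permutes_inverses[OF h] by (intro bij_betw_byWitness[where f' = h]) auto
  moreover have "bij_betw h S (h ` S)" using permutes_inj_on[OF h] by (simp add: bij_betw_def)
  ultimately show "bij_betw (h \<circ> u \<circ> inv' h) (h ` S) (h ` S)"
    using permutes_imp_bij[OF u] by (intro bij_betw_trans)
  fix x assume "x \<notin> h ` S"
  then have "inv' h x \<notin> S" using permutes_inverses(1)[OF h, of x] by (metis imageI)
  then show "(h \<circ> u \<circ> inv' h) x = x" using permutes_not_in[OF u] permutes_inverses(1)[OF h] by simp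
qed

text \<open>A bijection from \<open>S\<close> to \<open>A\<close> is glued to one between the
  complements in \<open>T\<close>.\<close>

lemma permutes_mapping_exists:
  assumes "finite T" "S \<subseteq> T" "A \<subseteq> T" "card S = card A"
  obtains h where "h permutes T" "h ` S = A"
proof -
  have fin: "finite S" "finite A" using assms finite_subset by auto
  obtain f1 where f1: "bij_betw f1 S A" using finite_same_card_bij[OF fin assms(4)] by blast
  have "card (T - S) = card (T - A)" using assms fin by (simp add: card_Diff_subset)
  then obtain f2 where f2: "bij_betw f2 (T - S) (T - A)"
    using finite_same_card_bij[of "T - S" "T - A"] assms(1) by auto
  define h where "h x = (if x \<in> S then f1 x else if x \<in> T then f2 x else x)" for x
  have h1: "bij_betw h S A" using f1 by (subst bij_betw_cong[of _ _ f1]) (auto simp: h_def)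
  have h2: "bij_betw h (T - S) (T - A)" using f2 by (subst bij_betw_cong[of _ _ f2]) (auto simp: h_def)
  have "bij_betw h (S \<union> (T - S)) (A \<union> (T - A))" by (rule bij_betw_combine[OF h1 h2]) auto
  moreover have "S \<union> (T - S) = T" "A \<union> (T - A) = T" using assms by auto
  ultimately have "bij_betw h T T" by simp
  then have "h permutes T" by (rule bij_imp_permutes) (use assms(2) in \<open>auto simp: h_def\<close>)
  then show ?thesis using that h1 by (simp add: bij_betw_def)
qed

text \<open>Some permutation carries \<open>{1..m}\<close> to \<open>A\<close>, and characters are
  constant on conjugacy classes.\<close>

lemma sum_specht_char_stabilizer:
  assumes lam: "is_partition lam n" and A: "A \<subseteq> {1..n}" "card A = m"
  shows "(\<Sum>g | g permutes A. specht_char n lam g) = fact m * of_nat (fixed_dim m lam)"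
proof -
  have n: "sum_list lam = n" using lam by (simp add: is_partition_def)
  have mn: "m \<le> n" using card_mono[OF _ A(1)] A(2) by simp
  obtain h where h: "h permutes {1..n}" "h ` {1..m} = A"
    using permutes_mapping_exists[of "{1..n}" "{1..m}" A] A mn by auto
  note inv = permutes_inverses[OF h(1)]
  have "(\<Sum>u | u permutes {1..m}. specht_char n lam u) = (\<Sum>g | g permutes A. specht_char n lam g)"
  proof (rule sum.reindex_bij_witness[where i = "\<lambda>g. inv' h \<circ> g \<circ> h" and j = "\<lambda>u. h \<circ> u \<circ> inv' h"])
    fix u assume "u \<in> {u. u permutes {1..m}}"
    then have u: "u permutes {1..m}" by simp
    show "inv' h \<circ> (h \<circ> u \<circ> inv' h) \<circ> h = u" using inv by (simp add: fun_eq_iff)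
    show "h \<circ> u \<circ> inv' h \<in> {g. g permutes A}" using permutes_conj[OF h(1) u] h(2) by simp
    have un: "u permutes {1..n}" by (rule permutes_subset[OF u]) (use mn in auto)
    have "char_on (tabloid_space n lam) tabloid_action (specht lam)
        (h \<otimes>\<^bsub>sym_group n\<^esub> u \<otimes>\<^bsub>sym_group n\<^esub> inv\<^bsub>sym_group n\<^esub> h)
      = char_on (tabloid_space n lam) tabloid_action (specht lam) u"
      using un h(1)
      by (intro char_on_conj[OF sym_group_is_group group_rep_specht[OF lam] finite_tabloid_space specht_supported[OF n]])
        (auto simp: sym_group_carrier)
    then show "specht_char n lam (h \<circ> u \<circ> inv' h) = specht_char n lam u"
      by (simp add: specht_char_def sym_group_mult sym_group_inv[OF h(1)])
  next
    fix g assume "g \<in> {g. g permutes A}"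
    then have g: "g permutes A" by simp
    show "h \<circ> (inv' h \<circ> g \<circ> h) \<circ> inv' h = g" using inv by (simp add: fun_eq_iff)
    have "inv' h \<circ> g \<circ> inv' (inv' h) permutes inv' h ` A"
      by (rule permutes_conj[OF permutes_inv[OF h(1)] g])
    moreover have "inv' h ` A = {1..m}" unfolding h(2)[symmetric] using inv by (auto simp: image_iff)
    ultimately show "inv' h \<circ> g \<circ> h \<in> {u. u permutes {1..m}}"
      using permutes_inv_inv[OF h(1)] by simp
  qed
  then show ?thesis using sum_specht_char_initial[OF lam mn] by simp
qed

text \<open>Frobenius reciprocity by counting pairs of a permutation and a tuple fixed by it. The
  permutations fixing \<open>xs\<close> are those of the other \<open>n - i\<close> letters, so each
  tuple contributes \<open>fact (n - i)\<close> times a dimension, and the number of tuples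
  completes the factor to \<open>fact n\<close>.\<close>

lemma sum_fixed_tuples_char:
  assumes lam: "is_partition lam n" and "i \<le> n"
  shows "(\<Sum>g | g permutes {1..n}. of_nat (num_fixed_tuples n i g) * specht_char n lam g)
    = fact n * of_nat (fixed_dim (n - i) lam)"
proof -
  let ?G = "{g. g permutes {1..n}}" and ?X = "inj_tuples n i"
  have finG: "finite ?G" by (rule finite_permutations) simp
  have "(\<Sum>g\<in>?G. of_nat (num_fixed_tuples n i g) * specht_char n lam g)
      = (\<Sum>g\<in>?G. \<Sum>xs\<in>?X. if map g xs = xs then specht_char n lam g else 0)"
    using finite_inj_tuples by (simp add: num_fixed_tuples_def sum.If_cases Int_def)
  also have "\<dots> = (\<Sum>xs\<in>?X. \<Sum>g\<in>?G. if map g xs = xs then specht_char n lam g else 0)"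
    by (rule sum.swap)
  also have "\<dots> = (\<Sum>xs\<in>?X. fact (n - i) * of_nat (fixed_dim (n - i) lam))"
  proof (rule sum.cong[OF refl])
    fix xs assume xs: "xs \<in> ?X"
    let ?A = "{1..n} - set xs"
    have A: "?A \<subseteq> {1..n}" "card ?A = n - i"
      using xs by (auto simp: inj_tuples_def card_Diff_subset distinct_card)
    have "{g\<in>?G. map g xs = xs} = {g. g permutes ?A}"
    proof (intro equalityI subsetI)
      fix g assume g: "g \<in> {g\<in>?G. map g xs = xs}"
      have "g permutes ?A"
        by (rule permutes_superset[of g "{1..n}"]) (use g in \<open>auto simp: map_fixed_iff\<close>)
      then show "g \<in> {g. g permutes ?A}" by simp
    next
      fix g assume "g \<in> {g. g permutes ?A}"
      then have g: "g permutes ?A" by simp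
      then show "g \<in> {g\<in>?G. map g xs = xs}"
        using permutes_subset[OF g A(1)] permutes_not_in[OF g] by (auto simp: map_fixed_iff)
    qed
    then show "(\<Sum>g\<in>?G. if map g xs = xs then specht_char n lam g else 0)
        = fact (n - i) * of_nat (fixed_dim (n - i) lam)"
      using sum_specht_char_stabilizer[OF lam A] finG by (simp add: sum.If_cases Int_def)
  qed
  also have "\<dots> = of_nat (card ?X * fact (n - i)) * of_nat (fixed_dim (n - i) lam)"
    by simp
  also have "card ?X * fact (n - i) = fact n"
    unfolding card_inj_tuples by (rule falling_fact[OF \<open>i \<le> n\<close>])
  finally show ?thesis by simp
qed

lemma multiplicity_specht:
  assumes lam: "is_partition lam n" and V: "group_rep (sym_group n) \<rho> V" and X: "finite X" "V \<subseteq> supported X"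
  shows "of_nat (multiplicity_rep (sym_group n) tabloid_action (specht lam) \<rho> V) * fact n
    = (\<Sum>g | g permutes {1..n}. char_on X \<rho> V (inv' g) * specht_char n lam g)"
proof -
  have n: "sum_list lam = n" using lam by (simp add: is_partition_def)
  have "of_nat (multiplicity_rep (sym_group n) tabloid_action (specht lam) \<rho> V) * of_nat (card (carrier (sym_group n)))
    = (\<Sum>g\<in>carrier (sym_group n). char_on X \<rho> V (inv\<^bsub>sym_group n\<^esub> g)
        * char_on (tabloid_space n lam) tabloid_action (specht lam) g)"
    by (rule multiplicity_rep_char[OF sym_group_is_group finite_sym_group V X irreducible_specht[OF lam]
        finite_tabloid_space specht_supported[OF n] scalar_endomorphisms_specht[OF lam]])
  also have "\<dots> = (\<Sum>g | g permutes {1..n}. char_on X \<rho> V (inv' g) * specht_char n lam g)"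
    by (intro sum.cong) (auto simp: sym_group_def specht_char_def simp flip: sym_group_inv)
  finally show ?thesis by (simp add: card_sym_group)
qed

section \<open>Bounding the fixed dimensions from both sides\<close>

lemma specht_dim:
  assumes lam: "is_partition lam n"
  shows "cfun.dim (specht lam) = fixed_dim 0 lam"
proof -
  have "carrier (sym_group 0) = {id}" by (auto simp: sym_group_carrier)
  then have "fixed_space (sym_group 0) tabloid_action (specht lam) = specht lam"
    by (simp add: fixed_space_def fun_action_def)
  then show ?thesis by (simp add: fixed_dim_def)
qed

text \<open>
  Decomposing the functions on injective \<open>(n - m)\<close>-tuples; a summand cannot be
  isomorphic to two different Specht modules.
\<close>

lemma sum_fixed_dim_le:
  assumes "m \<le> n"
  shows "(\<Sum>lam | is_partition lam n. fixed_dim m lam * fixed_dim 0 lam) * fact m \<le> fact n"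
proof -
  let ?i = "n - m" and ?G = "sym_group n"
  let ?X = "inj_tuples n ?i"
  let ?V = "supported ?X"
  let ?iso = "\<lambda>lam W. isomorphic_reps ?G tuple_action W tabloid_action (specht lam)"
  let ?P = "{lam. is_partition lam n}"
  note V = group_rep_inj_tuples[of n ?i] and X = finite_inj_tuples[of n ?i] subset_refl
  obtain \<W> where dec: "irreducible_decomposition ?G tuple_action ?V \<W>"
    using maschke[OF sym_group_is_group finite_sym_group V X] by blast
  note D = irreducible_decompositionD[OF dec]
  have W_rep: "group_rep ?G tuple_action W" if "W \<in> \<W>" for W using irreducible_repD(1)[OF D(3)[OF that]] .
  have part: "sum_list lam = n" if "lam \<in> ?P" for lam using that by (simp add: is_partition_def)
  have count: "card {W \<in> \<W>. ?iso lam W} = fixed_dim m lam" if lam: "lam \<in> ?P" for lam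
  proof -
    have lam': "is_partition lam n" using lam by simp
    have "of_nat (card {W \<in> \<W>. ?iso lam W}) * of_nat (card (carrier ?G))
      = (\<Sum>g\<in>carrier ?G. char_on ?X tuple_action ?V (inv\<^bsub>?G\<^esub> g) * char_on (tabloid_space n lam) tabloid_action (specht lam) g)"
      by (rule card_isomorphic_summands[OF sym_group_is_group finite_sym_group V X dec irreducible_specht[OF lam']
          finite_tabloid_space specht_supported[OF part[OF lam]] scalar_endomorphisms_specht[OF lam']])
    also have "\<dots> = (\<Sum>g | g permutes {1..n}. of_nat (num_fixed_tuples n ?i g) * specht_char n lam g)"
    proof (rule sum.cong)
      fix g assume "g \<in> {g. g permutes {1..n}}"
      then have g: "g permutes {1..n}" by simp
      show "char_on ?X tuple_action ?V (inv\<^bsub>?G\<^esub> g) * char_on (tabloid_space n lam) tabloid_action (specht lam) g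
        = of_nat (num_fixed_tuples n ?i g) * specht_char n lam g"
        by (simp add: sym_group_inv[OF g] char_on_inj_tuples[OF permutes_inv[OF g]] num_fixed_tuples_inv[OF g] specht_char_def)
    qed (simp add: sym_group_def)
    also have "\<dots> = fact n * of_nat (fixed_dim (n - ?i) lam)"
      by (rule sum_fixed_tuples_char[OF lam']) simp
    finally have "(of_nat (card {W \<in> \<W>. ?iso lam W}) :: complex) = of_nat (fixed_dim m lam)"
      using assms by (simp add: card_sym_group)
    then show ?thesis by (simp only: of_nat_eq_iff)
  qed
  have dimW: "cfun.dim W = fixed_dim 0 lam" if lam: "lam \<in> ?P" and W: "W \<in> \<W>" "?iso lam W" for lam W
  proof -
    have lam': "is_partition lam n" using lam by simp
    have WX: "W \<subseteq> supported ?X" using D(2)[OF W(1)] .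
    have one: "\<one>\<^bsub>?G\<^esub> \<in> carrier ?G" using group.is_monoid[OF sym_group_is_group] by (rule monoid.one_closed)
    have "(of_nat (cfun.dim W) :: complex) = of_nat (cfun.dim (specht lam))"
      using char_on_isomorphic[OF W_rep[OF W(1)] X(1) WX group_rep_specht[OF lam'] finite_tabloid_space
          specht_supported[OF part[OF lam]] W(2) one]
      unfolding char_on_one[OF W_rep[OF W(1)] X(1) WX]
        char_on_one[OF group_rep_specht[OF lam'] finite_tabloid_space specht_supported[OF part[OF lam]]] .
    then show ?thesis using specht_dim[OF lam'] by simp
  qed
  have unique: "lam = mu" if lam: "lam \<in> ?P" and mu: "mu \<in> ?P" and W: "W \<in> \<W>" "?iso lam W" "?iso mu W" for lam mu W
  proof (rule ccontr)
    assume ne: "lam \<noteq> mu"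
    have lm: "is_partition lam n" "is_partition mu n" using lam mu by auto
    have WX: "W \<subseteq> supported ?X" using D(2)[OF W(1)] .
    have eq: "specht_char n lam g = specht_char n mu g" if "g \<in> carrier ?G" for g
      using char_on_isomorphic[OF W_rep[OF W(1)] X(1) WX group_rep_specht[OF lm(1)] finite_tabloid_space
          specht_supported[OF part[OF lam]] W(2) that]
        char_on_isomorphic[OF W_rep[OF W(1)] X(1) WX group_rep_specht[OF lm(2)] finite_tabloid_space
          specht_supported[OF part[OF mu]] W(3) that]
      by (simp add: specht_char_def)
    interpret group ?G by (rule sym_group_is_group)
    have norm: "(\<Sum>g\<in>carrier ?G. specht_char n lam (inv\<^bsub>?G\<^esub> g) * specht_char n lam g) \<noteq> 0"
      unfolding specht_char_def
        char_norm[OF sym_group_is_group finite_sym_group group_rep_specht[OF lm(1)] specht_neq_0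
          finite_tabloid_space specht_supported[OF part[OF lam]] scalar_endomorphisms_specht[OF lm(1)]]
      by (simp add: card_sym_group)
    \<comment> \<open>Both Specht modules have the character of \<open>W\<close>. Were they not
      isomorphic, this character would be orthogonal to itself, against its nonzero norm. The claim
      is stated for general \<open>a\<close> and \<open>b\<close> to serve in both
      directions.\<close>
    have "isomorphic_reps ?G tabloid_action (specht a) tabloid_action (specht b)"
      if ab: "is_partition a n" "is_partition b n"
        "\<And>g. g \<in> carrier ?G \<Longrightarrow> specht_char n a g = specht_char n lam g"
        "\<And>g. g \<in> carrier ?G \<Longrightarrow> specht_char n b g = specht_char n lam g" for a b
    proof (rule ccontr)
      assume "\<not> ?thesis"
      then have "(\<Sum>g\<in>carrier ?G. specht_char n a (inv\<^bsub>?G\<^esub> g) * specht_char n b g) = 0"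
        unfolding specht_char_def
        by (rule char_orthogonal[OF sym_group_is_group irreducible_specht[OF ab(1)] irreducible_specht[OF ab(2)]])
      moreover have "(\<Sum>g\<in>carrier ?G. specht_char n a (inv\<^bsub>?G\<^esub> g) * specht_char n b g)
          = (\<Sum>g\<in>carrier ?G. specht_char n lam (inv\<^bsub>?G\<^esub> g) * specht_char n lam g)"
        by (intro sum.cong refl arg_cong2[where f = "(*)"] ab(3,4) inv_closed)
      ultimately show False using norm by simp
    qed
    then have "lam = mu" using eq lm by (intro isomorphic_specht_imp_eq[OF lm]) simp_all
    then show False using ne by contradiction
  qed
  have finP: "finite ?P" by (rule finite_partitions)
  have one: "\<one>\<^bsub>?G\<^esub> \<in> carrier ?G" using group.is_monoid[OF sym_group_is_group] by (rule monoid.one_closed)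
  have dimV: "(\<Sum>W\<in>\<W>. cfun.dim W) = falling n ?i"
  proof -
    have "(of_nat (\<Sum>W\<in>\<W>. cfun.dim W) :: complex) = (\<Sum>W\<in>\<W>. char_on ?X tuple_action W \<one>\<^bsub>?G\<^esub>)"
      unfolding of_nat_sum by (intro sum.cong refl char_on_one[symmetric] W_rep X(1) D(2))
    also have "\<dots> = char_on ?X tuple_action ?V \<one>\<^bsub>?G\<^esub>"
      by (rule char_on_decomposition[OF V X dec one, symmetric])
    also have "\<dots> = of_nat (num_fixed_tuples n ?i id)"
      unfolding sym_group_one by (rule char_on_inj_tuples[OF permutes_id])
    also have "num_fixed_tuples n ?i id = falling n ?i"
      by (simp add: num_fixed_tuples_def card_inj_tuples)
    finally show ?thesis by (simp only: of_nat_eq_iff)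
  qed
  have "(\<Sum>lam\<in>?P. fixed_dim m lam * fixed_dim 0 lam) = (\<Sum>lam\<in>?P. \<Sum>W\<in>{W\<in>\<W>. ?iso lam W}. cfun.dim W)"
  proof (rule sum.cong[OF refl])
    fix lam assume lam: "lam \<in> ?P"
    have "(\<Sum>W\<in>{W\<in>\<W>. ?iso lam W}. cfun.dim W) = (\<Sum>W\<in>{W\<in>\<W>. ?iso lam W}. fixed_dim 0 lam)"
      using dimW[OF lam] by (intro sum.cong) auto
    then show "fixed_dim m lam * fixed_dim 0 lam = (\<Sum>W\<in>{W\<in>\<W>. ?iso lam W}. cfun.dim W)"
      using count[OF lam] by simp
  qed
  also have "\<dots> = (\<Sum>W\<in>(\<Union>lam\<in>?P. {W\<in>\<W>. ?iso lam W}). cfun.dim W)"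
    by (rule sum.UNION_disjoint[symmetric]) (use finP D(1) unique in auto)
  \<comment> \<open>Summands isomorphic to no Specht module are not ruled out, which is why only an
    inequality is claimed.\<close>
  also have "\<dots> \<le> (\<Sum>W\<in>\<W>. cfun.dim W)" by (rule sum_mono2) (use D(1) in auto)
  finally have "(\<Sum>lam\<in>?P. fixed_dim m lam * fixed_dim 0 lam) \<le> falling n ?i" unfolding dimV .
  then have "(\<Sum>lam\<in>?P. fixed_dim m lam * fixed_dim 0 lam) * fact m \<le> falling n ?i * fact (n - ?i)"
    using assms by simp
  also have "\<dots> = fact n" by (rule falling_fact) simp
  finally show ?thesis .
qed

lemma num_fillings_le_fixed_dim:
  assumes "is_partition lam n" "m \<le> n"
  shows "num_fillings m (diagram lam) \<le> fixed_dim m lam"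
  using dim_fixed_space_ge[OF assms] unfolding num_fillings_def fillings_diagram fixed_dim_def .

text \<open>
  Both sides of the lower bound have the same total \<open>n! / m!\<close> when weighted with the numbers of
  standard tableaux, so it is an equality.
\<close>

theorem fixed_dim_eq:
  assumes lam: "is_partition lam n" and m: "m \<le> n" and pos: "num_fillings 0 (diagram lam) > 0"
  shows "fixed_dim m lam = num_fillings m (diagram lam)"
proof -
  let ?P = "{lam. is_partition lam n}"
  let ?K = "\<lambda>m lam. num_fillings m (diagram lam)"
  have le: "?K m lam * ?K 0 lam \<le> fixed_dim m lam * fixed_dim 0 lam" if "lam \<in> ?P" for lam
    using that num_fillings_le_fixed_dim[of lam n] m by (intro mult_mono) auto
  have "(\<Sum>lam\<in>?P. fixed_dim m lam * fixed_dim 0 lam) * fact m \<le> (\<Sum>lam\<in>?P. ?K m lam * ?K 0 lam) * fact m"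
    using sum_fixed_dim_le[OF m] sum_partitions[OF m] by simp
  then have "(\<Sum>lam\<in>?P. fixed_dim m lam * fixed_dim 0 lam) \<le> (\<Sum>lam\<in>?P. ?K m lam * ?K 0 lam)"
    by simp
  then have "(\<Sum>lam\<in>?P. ?K m lam * ?K 0 lam) = (\<Sum>lam\<in>?P. fixed_dim m lam * fixed_dim 0 lam)"
    using sum_mono[OF le] by (intro antisym)
  then have eq: "?K m lam * ?K 0 lam = fixed_dim m lam * fixed_dim 0 lam"
    using sum_mono_inv[of "\<lambda>lam. ?K m lam * ?K 0 lam" ?P "\<lambda>lam. fixed_dim m lam * fixed_dim 0 lam" lam]
      le lam finite_partitions by blast
  have a: "?K m lam \<le> fixed_dim m lam" and b: "?K 0 lam \<le> fixed_dim 0 lam"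
    using num_fillings_le_fixed_dim[OF lam] m by auto
  show ?thesis
  proof (rule ccontr)
    assume "fixed_dim m lam \<noteq> ?K m lam"
    then have "?K m lam < fixed_dim m lam" using a by simp
    \<comment> \<open>Positivity of the number of standard tableaux keeps the inequality strict
      after multiplication.\<close>
    then have "?K m lam * ?K 0 lam < fixed_dim m lam * ?K 0 lam" using pos by simp
    also have "\<dots> \<le> fixed_dim m lam * fixed_dim 0 lam" using b by simp
    finally show False using eq by simp
  qed
qed

text \<open>The end of the last nonempty row can always be removed, so the recursion never meets an
  empty sum before the empty diagram is reached.\<close>

lemma num_fillings_pos:
  assumes "young D"
  shows "num_fillings 0 D > 0"
  using assms
proof (induction "card D" arbitrary: D)
    case 0
    then have "D = {}" using young_finite by auto
    then show ?case by (simp add: num_fillings_empty)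
  next
    case (Suc k)
    note D = Suc.prems
    have fD: "finite D" by (rule young_finite[OF D])
    define i where "i = Max (fst ` D)"
    have "D \<noteq> {}" using Suc.hyps(2) by auto
    then have "i \<in> fst ` D" unfolding i_def using fD by (intro Max_in) auto
    then have "row_len D i > 0" using young_row[OF D] by force
    moreover have "row_len D (Suc i) = 0"
    proof (rule ccontr)
      assume "row_len D (Suc i) \<noteq> 0"
      then have "(Suc i, 0) \<in> D" using young_row[OF D] by simp
      then have "Suc i \<le> i" unfolding i_def using fD by (metis Max_ge finite_imageI fst_conv imageI)
      then show False by simp
    qed
    ultimately have "(i, row_len D i - 1) \<in> removable D" unfolding removable_eq[OF D] by auto
    then obtain c where c: "c \<in> removable D" by blast
    then have "0 < num_fillings 0 (D - {c})"
      using Suc.hyps(2) fD by (intro Suc.hyps(1)) (auto simp: removable_def)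
    also have "\<dots> \<le> (\<Sum>c\<in>removable D. num_fillings 0 (D - {c}))"
      by (rule member_le_sum[OF c]) (auto simp: finite_removable[OF D])
    also have "\<dots> = num_fillings 0 D"
      using num_fillings_rec[OF D, of 0] Suc.hyps(2) by simp
    finally show ?case .
qed

lemma fixed_dim_first_row:
  assumes lam: "is_partition lam n" and "part lam 2 \<le> m" "m \<le> n"
  shows "fixed_dim m lam = ((n - m) choose sum_list (tl lam)) * num_SYT (tl lam)"
proof -
  have Y: "young (diagram lam)" by (rule young_diagram[OF lam])
  have "card (diagram lam) = m + (n - m)"
    using lam assms(3) by (simp add: card_diagram is_partition_def)
  \<comment> \<open>The second part is the row with index 1: parts are numbered from 1, rows of
    cells from 0.\<close>
  moreover have "row_len (diagram lam) 1 \<le> m" using assms(2) by (simp add: row_len_diagram part_def)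
  ultimately have "num_fillings m (diagram lam)
      = ((n - m) choose card (lower_rows (diagram lam))) * num_fillings 0 (lower_rows (diagram lam))"
    by (intro num_fillings_first_row[OF Y])
  then show ?thesis
    using fixed_dim_eq[OF lam assms(3) num_fillings_pos[OF Y]]
    by (simp add: lower_rows_diagram card_diagram num_SYT_eq)
qed

theorem corollary1:
  fixes n r :: nat and lam :: "nat list"
  assumes "n \<ge> 2"
    and "is_partition lam n"
    and "1 \<le> r" and "r \<le> n - part lam 2"
  defines "bar \<equiv> tl lam"
  defines "k \<equiv> sum_list bar"
  shows "int (multiplicity_rep (sym_group n) tabloid_action (specht lam)
                tuple_action (tensor_power r (standard_rep n))) =
           int (num_SYT bar) *
           (\<Sum>s=k..r. (-1) ^ (r - s) * int (r choose s) *
              (\<Sum>i=k..s. int (i choose k) * int (Stirling s i)))"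
proof -
  note lam = assms(2)
  let ?m = "multiplicity_rep (sym_group n) tabloid_action (specht lam)
                tuple_action (tensor_power r (standard_rep n))"
  let ?G = "{g. g permutes {1..n}}"
  let ?\<chi> = "specht_char n lam"
  let ?N = "fact n :: complex"
  \<comment> \<open>With this, the hypothesis on \<open>r\<close>, which involves a truncated
    difference, gives \<open>part lam 2 \<le> n - i\<close> for every
    \<open>i \<le> r\<close>.\<close>
  have "part lam 2 \<le> n"
    using lam member_le_sum_list[of "lam ! 1" lam]
    by (cases "1 < length lam") (auto simp: part_def nth_default_def is_partition_def)
  then have dims: "fixed_dim (n - i) lam = (i choose k) * num_SYT bar" if "i \<le> r" for i
    using fixed_dim_first_row[OF lam, of "n - i"] that assms(4) by (simp add: bar_def k_def)
  have part_sum: "(\<Sum>g\<in>?G. of_nat (num_fixed n g) ^ s * ?\<chi> g)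
      = ?N * (\<Sum>i\<le>s. of_nat (Stirling s i) * of_nat ((i choose k) * num_SYT bar))" if s: "s \<le> r" for s
  proof -
    have "(\<Sum>g\<in>?G. of_nat (num_fixed n g) ^ s * ?\<chi> g)
        = (\<Sum>g\<in>?G. \<Sum>i\<le>s. of_nat (Stirling s i) * (of_nat (num_fixed_tuples n i g) * ?\<chi> g))"
      unfolding of_nat_power[symmetric] power_eq_sum_Stirling num_fixed_tuples_falling
      by (simp add: sum_distrib_right mult.assoc)
    also have "\<dots> = (\<Sum>i\<le>s. of_nat (Stirling s i) * (\<Sum>g\<in>?G. of_nat (num_fixed_tuples n i g) * ?\<chi> g))"
      by (subst sum.swap) (simp add: sum_distrib_left)
    also have "\<dots> = (\<Sum>i\<le>s. of_nat (Stirling s i) * (?N * of_nat ((i choose k) * num_SYT bar)))"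
    proof (rule sum.cong[OF refl])
      fix i assume "i \<in> {..s}"
      then have "i \<le> r" "i \<le> n" using s assms(4) by auto
      then show "of_nat (Stirling s i) * (\<Sum>g\<in>?G. of_nat (num_fixed_tuples n i g) * ?\<chi> g)
          = of_nat (Stirling s i) * (?N * of_nat ((i choose k) * num_SYT bar))"
        using sum_fixed_tuples_char[OF lam] dims by simp
    qed
    finally show ?thesis by (simp add: sum_distrib_left mult_ac)
  qed
  have "of_nat ?m * ?N = (\<Sum>g\<in>?G. char_on (tuples n r) tuple_action (tensor_power r (standard_rep n)) (inv' g) * ?\<chi> g)"
    by (rule multiplicity_specht[OF lam group_rep_tensor_power finite_tuples tensor_power_supported])
  \<comment> \<open>The difference is written as a sum to match the binomial theorem in
    \<open>binomial_ring\<close>.\<close>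
  also have "\<dots> = (\<Sum>g\<in>?G. (of_nat (num_fixed n g) + (- 1)) ^ r * ?\<chi> g)"
  proof (rule sum.cong[OF refl])
    fix g assume "g \<in> ?G"
    then have g: "g permutes {1..n}" by simp
    have "n > 0" using assms(1) by simp
    then show "char_on (tuples n r) tuple_action (tensor_power r (standard_rep n)) (inv' g) * ?\<chi> g
        = (of_nat (num_fixed n g) + (- 1)) ^ r * ?\<chi> g"
      using char_on_tensor_power[OF permutes_inv[OF g]] num_fixed_inv[OF g] by simp
  qed
  also have "\<dots> = (\<Sum>g\<in>?G. \<Sum>s\<le>r. of_nat (r choose s) * (-1) ^ (r - s) * (of_nat (num_fixed n g) ^ s * ?\<chi> g))"
    unfolding binomial_ring sum_distrib_right by (intro sum.cong refl) (simp only: mult_ac)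
  also have "\<dots> = (\<Sum>s\<le>r. of_nat (r choose s) * (-1) ^ (r - s) * (\<Sum>g\<in>?G. of_nat (num_fixed n g) ^ s * ?\<chi> g))"
    by (subst sum.swap) (simp add: sum_distrib_left)
  also have "\<dots> = (\<Sum>s\<le>r. of_nat (r choose s) * (-1) ^ (r - s) *
      (?N * (\<Sum>i\<le>s. of_nat (Stirling s i) * of_nat ((i choose k) * num_SYT bar))))"
    by (intro sum.cong refl arg_cong2[where f = "(*)"] part_sum) simp
  also have "\<dots> = of_int (\<Sum>s\<le>r. int (r choose s) * (-1) ^ (r - s) *
      (\<Sum>i\<le>s. int (Stirling s i) * int ((i choose k) * num_SYT bar))) * ?N"
    by (simp add: sum_distrib_left sum_distrib_right mult_ac)
  finally have "(of_int (int ?m) :: complex) = of_int (\<Sum>s\<le>r. int (r choose s) * (-1) ^ (r - s) *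
      (\<Sum>i\<le>s. int (Stirling s i) * int ((i choose k) * num_SYT bar)))"
    by simp
  then have "int ?m = (\<Sum>s\<le>r. int (r choose s) * (-1) ^ (r - s) *
      (\<Sum>i\<le>s. int (Stirling s i) * int ((i choose k) * num_SYT bar)))"
    by (simp only: of_int_eq_iff)
  \<comment> \<open>Terms with \<open>i < k\<close> vanish because \<open>i choose k = 0\<close>.
    For \<open>s < k\<close> the inner sum is then empty, so the outer sum may start at
    \<open>k\<close> as well.\<close>
  also have "\<dots> = (\<Sum>s\<le>r. int (r choose s) * (-1) ^ (r - s) *
      (\<Sum>i=k..s. int (Stirling s i) * int ((i choose k) * num_SYT bar)))"
    by (intro sum.cong refl arg_cong2[where f = "(*)"] sum.mono_neutral_right)
      (auto simp: binomial_eq_0)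
  also have "\<dots> = (\<Sum>s=k..r. int (r choose s) * (-1) ^ (r - s) *
      (\<Sum>i=k..s. int (Stirling s i) * int ((i choose k) * num_SYT bar)))"
    by (intro sum.mono_neutral_right) auto
  also have "\<dots> = int (num_SYT bar) * (\<Sum>s=k..r. (-1) ^ (r - s) * int (r choose s) *
      (\<Sum>i=k..s. int (i choose k) * int (Stirling s i)))"
    by (simp add: sum_distrib_left mult_ac)
  finally show ?thesis .
qed

end
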